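(* Let $n\ge3$ and let $\varphi:\mathfrak{aw}(n)\to \mathrm{U}_q(\mathfrak{sl}_2)^{\otimes n}$ be the morphism of algebras given by $\varphi(C_I)=Q_I$ for connected $I\subseteq\{1,\dots,n\}$. For every $S\subseteq\{1,\dots,n\}$ with $|S|\ge3$, the central element $\omega_S$ is in the kernel of $\varphi$: $$\varphi(\omega_S)=0.$$
   Context: Base field $\mathbb{C}(q)$, $q$ an indeterminate. $[A,B]=AB-BA$, $[A,B]_q=\frac{1}{q-q^{-1}}(qAB-q^{-1}BA)$. For $I,J\subseteq\{1,\dots,n\}$, $I<J$ means every element of $I$ is strictly smaller than every element of $J$. A connected subset is a non-empty set of consecutive integers. Two disjoint connected subsets are adjacent if their union is connected. A sequence $(I_1,\dots,I_k)$ of connected subsets is monotonic if $I_1<\dots<I_k$ or $I_1>\dots>I_k$; it is a monotonic sequence of adjacent subsets if moreover $I_j,I_{j+1}$ are adjacent for all $j$. Elements: $C_I$ for $I\subseteq\{1,\dots,n\}$ connected; $C_\varnothing:=1$. Adjacent sets in an index are merged (e.g. $C_{I_1I_2}=C_{I_2I_1}:=C_{I_1\cup I_2}$ if $I_1,I_2$ are adjacent; $C_{I_1I_3I_4}$ with $I_3,I_4$ adjacent means $C_{I_1(I_3\cup I_4)}$); empty sets are dropped. For a monotonic sequence $(I_1,\dots,I_k)$, $k\ge2$, of connected subsets with non-empty holes $H_a$ (the set of integers strictly between $I_a$ and $I_{a+1}$), define recursively on $k$, for any choice of $a\in\{1,\dots,k-1\}$ (the result does not depend on $a$; one may take $a=1$),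 $$C_{I_1\dots I_k}:=-[C_{I_1\dots I_aH_a},C_{H_aI_{a+1}\dots I_k}]_q+C_{I_1\dots I_a}C_{I_{a+1}\dots I_k}+C_{H_a}C_{I_1\dots I_aH_aI_{a+1}\dots I_k}.$$ For $k=2$ this reads $C_{I_1I_2}=-[C_{I_1H},C_{HI_2}]_q+C_{I_1}C_{I_2}+C_HC_{I_1HI_2}$, with $H$ the hole between $I_1$ and $I_2$. The algebra $\mathfrak{aw}(n)$ is the unital associative algebra generated by the $C_I$, $I$ a connected subset of $\{1,\dots,n\}$, with relations: (i) $[C_I,C_J]=0$ for connected $I,J$ with $I\cap J=\varnothing$ or $I\subset J$; (ii) $C_{I_1I_2}=-[C_{I_2I_3},C_{I_1I_3}]_q+C_{I_1}C_{I_2}+C_{I_3}C_{I_1I_2I_3}$ for every monotonic sequence $(I_1,I_2,I_3)$ of adjacent connected subsets; (iii) $C_{I_1I_4}=-[C_{I_1I_3},C_{I_3I_4}]_q+C_{I_1}C_{I_4}+C_{I_3}C_{I_1I_3I_4}$ for every monotonic sequence $(I_1,I_2,I_3,I_4)$ of adjacent connected subsets. For an arbitrary subset $S\subseteq\{1,\dots,n\}$ with maximal connected components $S_1<\dots<S_k$, write $C_S:=C_{S_1\dots S_k}$ (increasing order). For subsets $I_1<I_2<I_3$ (arbitrary, possibly empty or not connected, not necessarily adjacent), write $C_{I_1I_2}=C_{I_1\cup I_2}$ etc., and set $$\begin{aligned}\varOmega_{I_1,I_2,I_3}={}&qC_{I_1I_2}C_{I_2I_3}C_{I_1I_3}+\frac{q^2C_{I_1I_2}^2+q^{-2}C_{I_2I_3}^2+q^2C_{I_1I_3}^2+C_{I_1I_2I_3}^2+C_{I_1}^2+C_{I_2}^2+C_{I_3}^2}{q+q^{-1}}\\&-qC_{I_1I_2}(C_{I_1}C_{I_2}+C_{I_3}C_{I_1I_2I_3})-q^{-1}C_{I_2I_3}(C_{I_2}C_{I_3}+C_{I_1}C_{I_1I_2I_3})\\&-qC_{I_1I_3}(C_{I_1}C_{I_3}+C_{I_2}C_{I_1I_2I_3})+(q+q^{-1})C_{I_1}C_{I_2}C_{I_3}C_{I_1I_2I_3}-\frac{1}{q+q^{-1}},\end{aligned}$$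 which is $0$ if one of the $I_j$ is empty. For $|S|\ge3$, choose non-empty $I_1<I_2<I_3$ with $I_1\cup I_2\cup I_3=S$ and set $\omega_S=\sum_{I\subseteq I_1,\,J\subseteq I_2,\,K\subseteq I_3}(-1)^{|S|-|I|-|J|-|K|}\varOmega_{I,J,K}$, which does not depend on the choice of $I_1,I_2,I_3$ and is central in $\mathfrak{aw}(n)$. $\mathrm{U}_q(\mathfrak{sl}_2)$: generated by $E,F,q^{\pm H}$ with $q^HE=q\,Eq^H$, $q^HF=q^{-1}Fq^H$, $[E,F]=\frac{q^{2H}-q^{-2H}}{q-q^{-1}}$; coproduct $\Delta(E)=E\otimes q^{-H}+q^H\otimes E$, $\Delta(F)=F\otimes q^{-H}+q^H\otimes F$, $\Delta(q^{\pm H})=q^{\pm H}\otimes q^{\pm H}$; normalised Casimir element $Q=\frac{1}{q+q^{-1}}\left((q-q^{-1})^2FE+q\,q^{2H}+q^{-1}q^{-2H}\right)$. For $I=\{i,\dots,j\}\subseteq\{1,\dots,n\}$, the intermediate Casimir element is $Q_I=1^{\otimes(i-1)}\otimes\Delta^{(j-i)}(Q)\otimes1^{\otimes(n-j)}\in \mathrm{U}_q(\mathfrak{sl}_2)^{\otimes n}$, where $\Delta^{(m)}$ is the $m$-fold iterated coproduct into $m+1$ tensor factors. The assignment $C_I\mapsto Q_I$ is known to extend to an algebra morphism $\varphi$. *)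

theory Defs
  imports
    "HOL-Library.Poly_Mapping"
    "HOL-Library.Numeral_Type"
    "HOL-Computational_Algebra.Polynomial"
    "HOL-Computational_Algebra.Fraction_Field"
begin

section \<open>The base field and algebras over it\<close>

type_synonym cq = "complex poly fract"

text \<open>Without this, \<open>lift_definition\<close> would unfold the scalars to pairs of polynomials.\<close>

lifting_forget fract.lifting
lifting_forget poly.lifting

definition qq :: cq where "qq = Fract [:0, 1:] 1"

class cq_module = ab_group_add +
  fixes scaleq :: "cq \<Rightarrow> 'a \<Rightarrow> 'a"  (infixr \<open>*\<^sub>q\<close> 75)
  assumes scaleq_add_right: "c *\<^sub>q (x + y) = c *\<^sub>q x + c *\<^sub>q y"
    and scaleq_add_left: "(c + d) *\<^sub>q x = c *\<^sub>q x + d *\<^sub>q x"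
    and scaleq_scaleq: "c *\<^sub>q d *\<^sub>q x = (c * d) *\<^sub>q x"
    and scaleq_one: "1 *\<^sub>q x = x"

class cq_algebra = cq_module + ring + monoid_mult +
  assumes mult_scaleq_left: "(c *\<^sub>q x) * y = c *\<^sub>q (x * y)"
    and mult_scaleq_right: "x * (c *\<^sub>q y) = c *\<^sub>q (x * y)"

global_interpretation cq: vector_space "scaleq :: cq \<Rightarrow> 'a \<Rightarrow> 'a::cq_module"
  by standard (rule scaleq_add_right scaleq_add_left scaleq_scaleq scaleq_one)+

definition cq_algebra_hom :: "('a::cq_algebra \<Rightarrow> 'b::cq_algebra) \<Rightarrow> bool" where
  "cq_algebra_hom f \<longleftrightarrow>
     (\<forall>x y. f (x + y) = f x + f y) \<and> (\<forall>c x. f (c *\<^sub>q x) = c *\<^sub>q f x) \<and>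
     (\<forall>x y. f (x * y) = f x * f y) \<and> f 1 = 1"

definition qcomm :: "'a::cq_algebra \<Rightarrow> 'a \<Rightarrow> 'a" where
  "qcomm A B = inverse (qq - inverse qq) *\<^sub>q (qq *\<^sub>q (A * B) - inverse qq *\<^sub>q (B * A))"

definition ideal_gen :: "'a::cq_algebra set \<Rightarrow> 'a set" where
  "ideal_gen R = cq.span {a * r * b | a r b. r \<in> R}"

lemma ideal_gen_base:
  assumes "r \<in> R" shows "r \<in> ideal_gen R"
proof -
  have "r = 1 * r * 1" by simp
  then show ?thesis
    unfolding ideal_gen_def using assms by (intro cq.span_base) blast
qed

lemma ideal_gen_mult_left:
  assumes "x \<in> ideal_gen R" shows "a * x \<in> ideal_gen R"
  using assms unfolding ideal_gen_def
proof (induction rule: cq.span_induct_alt)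
  case base
  then show ?case by (simp add: cq.span_zero)
next
  case (step c x y)
  then obtain u r v where x: "x = u * r * v" "r \<in> R" by blast
  then have "a * x = (a * u) * r * v" by (simp add: mult.assoc)
  then have "a * x \<in> {a * r * b | a r b. r \<in> R}" using x(2) by blast
  then show ?case using step.IH
    by (simp add: distrib_left mult_scaleq_right cq.span_add cq.span_scale cq.span_base)
qed

lemma ideal_gen_mult_right:
  assumes "x \<in> ideal_gen R" shows "x * a \<in> ideal_gen R"
  using assms unfolding ideal_gen_def
proof (induction rule: cq.span_induct_alt)
  case base
  then show ?case by (simp add: cq.span_zero)
next
  case (step c x y)
  then obtain u r v where x: "x = u * r * v" "r \<in> R" by blast
  then have "x * a = u * r * (v * a)" by (simp add: mult.assoc)
  then have "x * a \<in> {a * r * b | a r b. r \<in> R}" using x(2) by blast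
  then show ?case using step.IH
    by (simp add: distrib_right mult_scaleq_left cq.span_add cq.span_scale cq.span_base)
qed

lemma ideal_gen_cong_mult:
  assumes "x - x' \<in> ideal_gen R" "y - y' \<in> ideal_gen R"
  shows "x * y - x' * y' \<in> ideal_gen R"
proof -
  have "x * y - x' * y' = (x - x') * y + x' * (y - y')"
    by (simp add: algebra_simps)
  then show ?thesis
    using ideal_gen_mult_right[OF assms(1), of y] ideal_gen_mult_left[OF assms(2), of x']
    by (simp add: ideal_gen_def cq.span_add)
qed

lemma equivp_diff_span: "equivp (\<lambda>x y. x - y \<in> cq.span R)"
proof (rule equivpI)
  show "reflp (\<lambda>x y. x - y \<in> cq.span R)" by (simp add: reflp_def cq.span_zero)
  show "symp (\<lambda>x y. x - y \<in> cq.span R)"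
    by (rule sympI) (metis cq.span_neg minus_diff_eq)
  show "transp (\<lambda>x y. x - y \<in> cq.span R)"
  proof (rule transpI)
    fix x y z :: 'a assume "x - y \<in> cq.span R" "y - z \<in> cq.span R"
    from cq.span_add[OF this] show "x - z \<in> cq.span R" by simp
  qed
qed

lemma equivp_diff_ideal: "equivp (\<lambda>x y. x - y \<in> ideal_gen R)"
  unfolding ideal_gen_def by (rule equivp_diff_span)

lemma diff_span_add:
  "x - x' \<in> cq.span R \<Longrightarrow> y - y' \<in> cq.span R \<Longrightarrow> (x + y) - (x' + y') \<in> cq.span R"
  using cq.span_add[of "x - x'" R "y - y'"] by (simp add: algebra_simps)

lemma diff_span_diff:
  "x - x' \<in> cq.span R \<Longrightarrow> y - y' \<in> cq.span R \<Longrightarrow> (x - y) - (x' - y') \<in> cq.span R"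
  using cq.span_diff[of "x - x'" R "y - y'"] by (simp add: algebra_simps)

lemma diff_span_neg: "x - x' \<in> cq.span R \<Longrightarrow> (- x) - (- x') \<in> cq.span R"
  using cq.span_neg[of "x - x'" R] by (simp add: algebra_simps)

lemma diff_span_scale: "x - x' \<in> cq.span R \<Longrightarrow> c *\<^sub>q x - c *\<^sub>q x' \<in> cq.span R"
  using cq.span_scale[of "x - x'" R c] by (simp add: cq.scale_right_diff_distrib)


section \<open>Free modules and free algebras\<close>

text \<open>\<open>'k fvec\<close> is the free \<open>cq\<close>-module on \<open>'k\<close>; if \<open>'k\<close> is a monoid (written additively, as
  required by \<^theory>\<open>HOL-Library.Poly_Mapping\<close>), it is the monoid algebra.\<close>

typedef 'k fvec = "UNIV :: ('k \<Rightarrow>\<^sub>0 cq) set" by simp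

setup_lifting type_definition_fvec

instantiation fvec :: (type) cq_module
begin
lift_definition zero_fvec :: "'a fvec" is 0 .
lift_definition plus_fvec :: "'a fvec \<Rightarrow> 'a fvec \<Rightarrow> 'a fvec" is "(+)" .
lift_definition minus_fvec :: "'a fvec \<Rightarrow> 'a fvec \<Rightarrow> 'a fvec" is "(-)" .
lift_definition uminus_fvec :: "'a fvec \<Rightarrow> 'a fvec" is uminus .
lift_definition scaleq_fvec :: "cq \<Rightarrow> 'a fvec \<Rightarrow> 'a fvec" is "\<lambda>c. Poly_Mapping.map ((*) c)" .
instance
proof
  fix a b c :: "'a fvec"
  show "a + b + c = a + (b + c)" by transfer (rule add.assoc)
  show "a + b = b + a" by transfer (rule add.commute)
  show "0 + a = a" by transfer simp
  show "- a + a = 0" by transfer simp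
  show "a - b = a + - b" by transfer simp
next
  fix c d :: cq and x y :: "'a fvec"
  show "c *\<^sub>q (x + y) = c *\<^sub>q x + c *\<^sub>q y"
    by transfer (rule poly_mapping_eqI,
      auto simp: map.rep_eq lookup_add when_def distrib_left simp flip: distrib_left)
  show "(c + d) *\<^sub>q x = c *\<^sub>q x + d *\<^sub>q x"
    by transfer (rule poly_mapping_eqI, simp add: map.rep_eq lookup_add when_def algebra_simps)
  show "c *\<^sub>q d *\<^sub>q x = (c * d) *\<^sub>q x"
    by transfer (rule poly_mapping_eqI, simp add: map.rep_eq when_def)
  show "1 *\<^sub>q x = x"
    by transfer (rule poly_mapping_eqI, simp add: map.rep_eq when_def)
qed
end

lift_definition basis :: "'k \<Rightarrow> 'k fvec" is "\<lambda>k. Poly_Mapping.single k 1" .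

lemma map_eq_single_mult:
  "Poly_Mapping.map ((*) c) x = Poly_Mapping.single 0 c * (x :: 'k::monoid_add \<Rightarrow>\<^sub>0 cq)"
proof (induction x rule: update_induct)
  case const
  then show ?case by (simp add: poly_mapping_eq_iff map.rep_eq fun_eq_iff)
next
  case (update f a b)
  have u: "Poly_Mapping.update a b f = f + Poly_Mapping.single a b"
    using update(1) by (intro poly_mapping_eqI)
      (auto simp: lookup_update lookup_add lookup_single when_def in_keys_iff)
  have m: "Poly_Mapping.map ((*) c) (f + g) = Poly_Mapping.map ((*) c) f + Poly_Mapping.map ((*) c) g" for g
    by (rule poly_mapping_eqI)
      (auto simp: map.rep_eq lookup_add when_def distrib_left simp flip: distrib_left)
  have s: "Poly_Mapping.map ((*) c) (Poly_Mapping.single a b) = Poly_Mapping.single a (c * b)"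
    by (rule poly_mapping_eqI) (simp add: map.rep_eq lookup_single when_def)
  show ?case by (simp add: u m s update.IH distrib_left mult_single)
qed

lemma mult_single_zero_right:
  "x * Poly_Mapping.single 0 c = Poly_Mapping.single 0 c * (x :: 'k::monoid_add \<Rightarrow>\<^sub>0 cq)"
proof (induction x rule: update_induct)
  case const
  then show ?case by simp
next
  case (update f a b)
  have u: "Poly_Mapping.update a b f = f + Poly_Mapping.single a b"
    using update(1) by (intro poly_mapping_eqI)
      (auto simp: lookup_update lookup_add lookup_single when_def in_keys_iff)
  show ?case by (simp add: u update.IH distrib_left distrib_right mult_single mult.commute)
qed

instantiation fvec :: (monoid_add) cq_algebra
begin
lift_definition one_fvec :: "'a fvec" is 1 .
lift_definition times_fvec :: "'a fvec \<Rightarrow> 'a fvec \<Rightarrow> 'a fvec" is "(*)" .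
instance
proof
  fix a b c :: "'a fvec"
  show "a * b * c = a * (b * c)" by transfer (rule mult.assoc)
  show "(a + b) * c = a * c + b * c" by transfer (rule distrib_right)
  show "a * (b + c) = a * b + a * c" by transfer (rule distrib_left)
  show "1 * a = a" by transfer simp
  show "a * 1 = a" by transfer simp
  fix k :: cq
  show "(k *\<^sub>q a) * b = k *\<^sub>q (a * b)"
    by transfer (simp add: map_eq_single_mult mult.assoc)
  show "a * (k *\<^sub>q b) = k *\<^sub>q (a * b)"
    by transfer (metis map_eq_single_mult mult.assoc mult_single_zero_right)
qed
end

lemma fvec_induct [case_names zero add]:
  assumes "P 0" "\<And>k c y. P y \<Longrightarrow> P (c *\<^sub>q basis k + y)"
  shows "P (x :: 'k fvec)"
proof -
  have "P (Abs_fvec p)" for p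
  proof (induction p rule: update_induct)
    case const
    then show ?case using assms(1) by (simp add: zero_fvec_def)
  next
    case (update f a b)
    have "Poly_Mapping.update a b f = Poly_Mapping.map ((*) b) (Poly_Mapping.single a 1) + f"
      using update(1) by (intro poly_mapping_eqI)
        (auto simp: lookup_update lookup_add lookup_single when_def in_keys_iff map.rep_eq)
    then have "Abs_fvec (Poly_Mapping.update a b f) = b *\<^sub>q basis a + Abs_fvec f"
      by (simp add: plus_fvec_def scaleq_fvec_def basis_def Abs_fvec_inverse)
    then show ?case using assms(2)[OF update.IH] by simp
  qed
  then show ?thesis by (metis Rep_fvec_inverse)
qed

lemma basis_mult: "basis a * basis b = basis (a + b)"
  by transfer (simp add: mult_single)

lemma basis_zero: "basis 0 = 1"
  by transfer simp

definition lin_ext :: "('k \<Rightarrow> 'b::cq_module) \<Rightarrow> 'k fvec \<Rightarrow> 'b" where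
  "lin_ext g x = (\<Sum>k\<in>Poly_Mapping.keys (Rep_fvec x). Poly_Mapping.lookup (Rep_fvec x) k *\<^sub>q g k)"

lemma lin_ext_superset:
  assumes "finite A" "Poly_Mapping.keys (Rep_fvec x) \<subseteq> A"
  shows "lin_ext g x = (\<Sum>k\<in>A. Poly_Mapping.lookup (Rep_fvec x) k *\<^sub>q g k)"
  unfolding lin_ext_def
  by (rule sum.mono_neutral_left) (use assms in \<open>auto simp: in_keys_iff\<close>)

lemma lin_ext_add: "lin_ext g (x + y) = lin_ext g x + lin_ext g y"
proof -
  let ?A = "Poly_Mapping.keys (Rep_fvec x) \<union> Poly_Mapping.keys (Rep_fvec y)"
  have "Poly_Mapping.keys (Rep_fvec (x + y)) \<subseteq> ?A"
    by (simp add: plus_fvec.rep_eq keys_add)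
  then show ?thesis
    using lin_ext_superset[of ?A "x + y" g] lin_ext_superset[of ?A x g] lin_ext_superset[of ?A y g]
    by (simp add: plus_fvec.rep_eq lookup_add scaleq_add_left sum.distrib)
qed

lemma lin_ext_scale: "lin_ext g (c *\<^sub>q x) = c *\<^sub>q lin_ext g x"
proof -
  have "Poly_Mapping.keys (Rep_fvec (c *\<^sub>q x)) \<subseteq> Poly_Mapping.keys (Rep_fvec x)"
    by (auto simp: scaleq_fvec.rep_eq in_keys_iff map.rep_eq when_def)
  then show ?thesis
    using lin_ext_superset[of "Poly_Mapping.keys (Rep_fvec x)" "c *\<^sub>q x" g]
    by (simp add: scaleq_fvec.rep_eq map.rep_eq when_def lin_ext_def cq.scale_sum_right)
      (auto intro!: sum.cong simp: in_keys_iff)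
qed

lemma lin_ext_zero: "lin_ext g 0 = 0"
  by (simp add: lin_ext_def zero_fvec.rep_eq)

lemma lin_ext_basis: "lin_ext g (basis k) = g k"
  by (simp add: lin_ext_def basis.rep_eq)

lemma lin_ext_diff: "lin_ext g (x - y) = lin_ext g x - lin_ext g y"
  using lin_ext_add[of g "x - y" y] by (simp add: algebra_simps)

lemma lin_ext_span:
  assumes "x \<in> cq.span R" "\<And>r. r \<in> R \<Longrightarrow> lin_ext g r \<in> cq.span T"
  shows "lin_ext g x \<in> cq.span T"
  using assms(1)
proof (induction rule: cq.span_induct_alt)
  case base
  show ?case by (simp add: lin_ext_zero cq.span_zero)
next
  case (step c x y)
  then show ?case
    by (simp add: lin_ext_add lin_ext_scale cq.span_add cq.span_scale assms(2))
qed

datatype 'x word = Word (letters: "'x list")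

instantiation word :: (type) monoid_add
begin
definition "0 = Word []"
definition "u + v = Word (letters u @ letters v)"
instance by standard (simp_all add: zero_word_def plus_word_def)
end

type_synonym 'x free_alg = "'x word fvec"

definition fgen :: "'x \<Rightarrow> 'x free_alg" where
  "fgen x = basis (Word [x])"

definition free_eval :: "('x \<Rightarrow> 'a::cq_algebra) \<Rightarrow> 'x free_alg \<Rightarrow> 'a" where
  "free_eval g = lin_ext (\<lambda>w. prod_list (map g (letters w)))"

lemma free_eval_mult: "free_eval g (x * y) = free_eval g x * free_eval g y"
proof -
  have *: "free_eval g (basis k * y) = free_eval g (basis k) * free_eval g y" for k
    by (induction y rule: fvec_induct)
      (simp_all add: free_eval_def lin_ext_zero lin_ext_add lin_ext_scale lin_ext_basis
        distrib_left mult_scaleq_right basis_mult plus_word_def)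
  show ?thesis
  proof (induction x rule: fvec_induct)
    case zero
    then show ?case by (simp add: free_eval_def lin_ext_zero)
  next
    case (add k c z)
    then show ?case using *
      by (simp add: free_eval_def lin_ext_add lin_ext_scale distrib_right mult_scaleq_left)
  qed
qed

lemma free_eval_hom: "cq_algebra_hom (free_eval g)"
proof -
  have "free_eval g 1 = 1"
    unfolding basis_zero[symmetric] by (simp add: free_eval_def lin_ext_basis zero_word_def)
  then show ?thesis
    by (simp add: cq_algebra_hom_def free_eval_mult)
      (simp add: free_eval_def lin_ext_add lin_ext_scale)
qed

lemma free_eval_fgen: "free_eval g (fgen x) = g x"
  by (simp add: free_eval_def fgen_def lin_ext_basis)

lemma free_eval_ideal:
  assumes "x \<in> ideal_gen R" "\<And>r. r \<in> R \<Longrightarrow> free_eval g r = 0"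
  shows "free_eval g x = 0"
  using assms(1) unfolding ideal_gen_def
proof (induction rule: cq.span_induct_alt)
  case base
  then show ?case by (simp add: free_eval_def lin_ext_zero)
next
  case (step c x y)
  then obtain u r v where "x = u * r * v" "r \<in> R" by blast
  then have "free_eval g x = 0" using assms(2) by (simp add: free_eval_mult)
  then show ?case using step.IH by (simp add: free_eval_def lin_ext_add lin_ext_scale)
qed


section \<open>Tensor powers\<close>

text \<open>\<open>'a tens\<close> is the direct sum of all tensor powers of the algebra \<open>'a\<close> over \<open>cq\<close>: the free
  module on all finite tuples, modulo multilinearity in each entry.\<close>

definition multilin_rels :: "'a::cq_algebra list fvec set" where
  "multilin_rels =
     {basis (xs @ (x + y) # ys) - basis (xs @ x # ys) - basis (xs @ y # ys) | xs x y ys. True} \<union>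
     {basis (xs @ (c *\<^sub>q x) # ys) - c *\<^sub>q basis (xs @ x # ys) | xs c x ys. True}"

quotient_type (overloaded) 'a tens =
  "'a::cq_algebra list fvec" / "\<lambda>x y. x - y \<in> cq.span multilin_rels"
  by (rule equivp_diff_span)

lift_definition pure :: "'a::cq_algebra list \<Rightarrow> 'a tens" is basis .

definition multilinear :: "('a::cq_algebra list \<Rightarrow> 'b::cq_module) \<Rightarrow> bool" where
  "multilinear g \<longleftrightarrow>
     (\<forall>xs x y ys. g (xs @ (x + y) # ys) = g (xs @ x # ys) + g (xs @ y # ys)) \<and>
     (\<forall>xs c x ys. g (xs @ (c *\<^sub>q x) # ys) = c *\<^sub>q g (xs @ x # ys))"

instantiation tens :: (cq_algebra) cq_module
begin
lift_definition zero_tens :: "'a tens" is 0 .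
lift_definition plus_tens :: "'a tens \<Rightarrow> 'a tens \<Rightarrow> 'a tens" is "(+)" by (rule diff_span_add)
lift_definition minus_tens :: "'a tens \<Rightarrow> 'a tens \<Rightarrow> 'a tens" is "(-)" by (rule diff_span_diff)
lift_definition uminus_tens :: "'a tens \<Rightarrow> 'a tens" is uminus by (rule diff_span_neg)
lift_definition scaleq_tens :: "cq \<Rightarrow> 'a tens \<Rightarrow> 'a tens" is scaleq by (rule diff_span_scale)
instance
  by standard
    (transfer, simp add: cq.span_zero algebra_simps scaleq_add_right scaleq_add_left scaleq_scaleq
      scaleq_one)+
end

lemma pure_multilinear: "multilinear pure"
  unfolding multilinear_def
proof (intro conjI allI)
  fix xs ys :: "'a list" and x y c
  show "pure (xs @ (x + y) # ys) = pure (xs @ x # ys) + pure (xs @ y # ys)"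
    by transfer (rule cq.span_base, simp add: multilin_rels_def diff_diff_eq, blast)
  show "pure (xs @ (c *\<^sub>q x) # ys) = c *\<^sub>q pure (xs @ x # ys)"
    by transfer (rule cq.span_base, simp add: multilin_rels_def, blast)
qed

lemma abs_tens_surj: obtains u where "x = abs_tens u"
  using Quotient3_abs_rep[OF Quotient3_tens, of x] by metis

lemma tens_induct [case_names zero add]:
  assumes "P 0" "\<And>k c y. P y \<Longrightarrow> P (c *\<^sub>q pure k + y)"
  shows "P (x :: 'a::cq_algebra tens)"
proof -
  have "P (abs_tens u)" for u
  proof (induction u rule: fvec_induct)
    case zero
    then show ?case using assms(1) by (simp add: zero_tens.abs_eq)
  next
    case (add k c y)
    then show ?case using assms(2)[OF add, of c k]
      by (simp add: plus_tens.abs_eq[symmetric] scaleq_tens.abs_eq[symmetric] pure.abs_eq)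
  qed
  then show ?thesis by (metis abs_tens_surj)
qed

text \<open>The linear map on tensors induced by a function on tuples. It is used for multilinear \<open>g\<close>
  only, for which it does not depend on the representative.\<close>

definition tens_lift :: "('a::cq_algebra list \<Rightarrow> 'b::cq_module) \<Rightarrow> 'a tens \<Rightarrow> 'b" where
  "tens_lift g t = lin_ext g (rep_tens t)"

lemma lin_ext_multilin:
  assumes "multilinear g" "x - y \<in> cq.span multilin_rels"
  shows "lin_ext g x = lin_ext g y"
proof -
  have "lin_ext g (x - y) \<in> cq.span {}"
    by (rule lin_ext_span[OF assms(2)])
      (use assms(1) in \<open>auto simp: multilin_rels_def multilinear_def lin_ext_diff lin_ext_scale
        lin_ext_basis\<close>)
  then show ?thesis by (simp add: lin_ext_diff)
qed

lemma tens_lift_abs: "multilinear g \<Longrightarrow> tens_lift g (abs_tens u) = lin_ext g u"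
  unfolding tens_lift_def
  by (rule lin_ext_multilin) (simp_all add: Quotient3_rep_abs[OF Quotient3_tens] cq.span_zero)

lemma tens_lift_pure: "multilinear g \<Longrightarrow> tens_lift g (pure xs) = g xs"
  by (simp add: pure.abs_eq tens_lift_abs lin_ext_basis)

lemma tens_lift_zero: "multilinear g \<Longrightarrow> tens_lift g 0 = 0"
  by (simp add: zero_tens.abs_eq tens_lift_abs lin_ext_zero)

lemma tens_lift_add:
  "multilinear g \<Longrightarrow> tens_lift g (s + t) = tens_lift g s + tens_lift g t"
  by (rule abs_tens_surj[of s], rule abs_tens_surj[of t])
    (simp add: plus_tens.abs_eq tens_lift_abs lin_ext_add)

lemma tens_lift_scale:
  "multilinear g \<Longrightarrow> tens_lift g (c *\<^sub>q t) = c *\<^sub>q tens_lift g t"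
  by (rule abs_tens_surj[of t]) (simp add: scaleq_tens.abs_eq tens_lift_abs lin_ext_scale)

lemmas tens_lift_simps = tens_lift_pure tens_lift_zero tens_lift_add tens_lift_scale

lemma tens_lift_fun:
  "tens_lift (\<lambda>xs. g xs + h xs) t = tens_lift g t + tens_lift h t"
  "tens_lift (\<lambda>xs. c *\<^sub>q g xs) t = c *\<^sub>q tens_lift g t"
  "tens_lift (\<lambda>xs. 0) t = 0"
  by (simp_all add: tens_lift_def lin_ext_def scaleq_add_right sum.distrib cq.scale_sum_right
      scaleq_scaleq mult.commute)

lemma multilinear_pure_map2:
  fixes xs ys :: "'a::cq_algebra list"
  shows
  "multilinear (\<lambda>ys. if length xs = length ys then pure (map2 (*) xs ys) else 0)"
    (is ?A)
  "multilinear (\<lambda>xs. if length xs = length ys then pure (map2 (*) xs ys) else 0)"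
    (is ?B)
proof -
  have split: "\<exists>us v ws. zs = us @ v # ws \<and> length us = length as \<and> length ws = length bs"
    if "length zs = length (as @ b # bs)" for zs as bs :: "'a list" and b
    using that
    by (intro exI[of _ "take (length as) zs"] exI[of _ "zs ! length as"]
        exI[of _ "drop (Suc (length as)) zs"]) (simp add: id_take_nth_drop)
  have p: "pure (as @ (b + c) # bs) = pure (as @ b # bs) + pure (as @ c # bs)"
    "pure (as @ (k *\<^sub>q b) # bs) = k *\<^sub>q pure (as @ b # bs)" for as bs and b c :: 'a and k
    using pure_multilinear[where 'a = 'a] by (auto simp: multilinear_def)
  show ?A unfolding multilinear_def
  proof (intro conjI allI)
    fix as bs :: "'a list" and b c k
    show "(if length xs = length (as @ (b + c) # bs) then pure (map2 (*) xs (as @ (b + c) # bs)) else 0)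
      = (if length xs = length (as @ b # bs) then pure (map2 (*) xs (as @ b # bs)) else 0)
      + (if length xs = length (as @ c # bs) then pure (map2 (*) xs (as @ c # bs)) else 0)"
      using split[of xs as b bs] by (cases "length xs = length (as @ b # bs)")
        (auto simp: distrib_left p)
    show "(if length xs = length (as @ (k *\<^sub>q b) # bs) then pure (map2 (*) xs (as @ (k *\<^sub>q b) # bs)) else 0)
      = k *\<^sub>q (if length xs = length (as @ b # bs) then pure (map2 (*) xs (as @ b # bs)) else 0)"
      using split[of xs as b bs] by (cases "length xs = length (as @ b # bs)")
        (auto simp: mult_scaleq_right p)
  qed
  show ?B unfolding multilinear_def
  proof (intro conjI allI)
    fix as bs :: "'a list" and b c k
    show "(if length (as @ (b + c) # bs) = length ys then pure (map2 (*) (as @ (b + c) # bs) ys) else 0)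
      = (if length (as @ b # bs) = length ys then pure (map2 (*) (as @ b # bs) ys) else 0)
      + (if length (as @ c # bs) = length ys then pure (map2 (*) (as @ c # bs) ys) else 0)"
      using split[of ys as b bs] by (cases "length ys = length (as @ b # bs)")
        (auto simp: distrib_right p)
    show "(if length (as @ (k *\<^sub>q b) # bs) = length ys then pure (map2 (*) (as @ (k *\<^sub>q b) # bs) ys) else 0)
      = k *\<^sub>q (if length (as @ b # bs) = length ys then pure (map2 (*) (as @ b # bs) ys) else 0)"
      using split[of ys as b bs] by (cases "length ys = length (as @ b # bs)")
        (auto simp: mult_scaleq_left p)
  qed
qed

lemma multilinear_tens_lift:
  assumes "\<And>ys. multilinear (\<lambda>xs. h xs ys)"
  shows "multilinear (\<lambda>xs. tens_lift (h xs) t)"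
proof -
  have h: "h (xs @ (x + y) # zs) = (\<lambda>ws. h (xs @ x # zs) ws + h (xs @ y # zs) ws)"
    "h (xs @ (c *\<^sub>q x) # zs) = (\<lambda>ws. c *\<^sub>q h (xs @ x # zs) ws)" for xs x y zs c
    using assms by (auto simp: multilinear_def)
  show ?thesis
    unfolding multilinear_def h tens_lift_fun by simp
qed

text \<open>Componentwise product; tensors of different degrees multiply to zero.\<close>

instantiation tens :: (cq_algebra) ring
begin
definition times_tens :: "'a tens \<Rightarrow> 'a tens \<Rightarrow> 'a tens" where
  "s * t = tens_lift (\<lambda>xs. tens_lift
     (\<lambda>ys. if length xs = length ys then pure (map2 (*) xs ys) else 0) t) s"

lemmas times_tens_multilinear =
  multilinear_pure_map2 multilinear_tens_lift[OF multilinear_pure_map2(2)]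

lemma pure_mult:
  "pure xs * pure ys = (if length xs = length ys then pure (map2 (*) xs ys) else (0 :: 'a tens))"
  by (simp add: times_tens_def tens_lift_pure times_tens_multilinear)

lemma times_tens_bilinear:
  "(s + s') * t = s * t + s' * (t :: 'a tens)" "s * (t + t') = s * t + s * t'"
  "(c *\<^sub>q s) * t = c *\<^sub>q (s * t)" "s * (c *\<^sub>q t) = c *\<^sub>q (s * t)"
  "0 * t = 0" "s * 0 = 0"
proof -
  note d = times_tens_def tens_lift_simps tens_lift_fun times_tens_multilinear
  show "(s + s') * t = s * t + s' * t" "(c *\<^sub>q s) * t = c *\<^sub>q (s * t)" "0 * t = 0"
    "s * (t + t') = s * t + s * t'" "s * (c *\<^sub>q t) = c *\<^sub>q (s * t)" "s * 0 = 0"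
    by (simp_all add: d)
qed

lemma map2_mult_assoc:
  "length xs = length ys \<Longrightarrow> length ys = length zs \<Longrightarrow>
    map2 (*) (map2 (*) xs ys) zs = map2 (*) xs (map2 (*) ys (zs :: 'a list))"
  by (induction xs ys zs rule: list_induct3) (simp_all add: mult.assoc)

instance
proof
  fix a b c :: "'a tens"
  have 1: "pure x * pure y * pure z = pure x * (pure y * pure z :: 'a tens)" for x y z
    by (simp add: pure_mult times_tens_bilinear map2_mult_assoc)
  have 2: "pure x * pure y * c = pure x * (pure y * c)" for x y
    by (induction c rule: tens_induct) (simp_all add: times_tens_bilinear 1)
  have 3: "pure x * b * c = pure x * (b * c)" for x
    by (induction b rule: tens_induct) (simp_all add: times_tens_bilinear 2)
  show "a * b * c = a * (b * c)"
    by (induction a rule: tens_induct) (simp_all add: times_tens_bilinear 3)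
  show "(a + b) * c = a * c + b * c" "a * (b + c) = a * b + a * c"
    by (rule times_tens_bilinear)+
qed
end

text \<open>The outer product, from degrees \<open>k\<close> and \<open>m\<close> to degree \<open>k + m\<close>.\<close>

definition tcat :: "'a::cq_algebra tens \<Rightarrow> 'a tens \<Rightarrow> 'a tens"  (infixr \<open>\<boxtimes>\<close> 70) where
  "s \<boxtimes> t = tens_lift (\<lambda>xs. tens_lift (\<lambda>ys. pure (xs @ ys)) t) s"

lemma multilinear_pure_append:
  "multilinear (\<lambda>ys. pure (xs @ ys))" "multilinear (\<lambda>xs. pure (xs @ ys))"
  using pure_multilinear unfolding multilinear_def
  by (metis append.assoc, metis append.assoc append_Cons)

lemmas tcat_multilinear =
  multilinear_pure_append multilinear_tens_lift[OF multilinear_pure_append(2)]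

lemma tcat_pure: "pure xs \<boxtimes> pure ys = pure (xs @ ys)"
  by (simp add: tcat_def tens_lift_pure tcat_multilinear)

lemma tcat_bilinear:
  "(s + s') \<boxtimes> t = s \<boxtimes> t + s' \<boxtimes> t" "s \<boxtimes> (t + t') = s \<boxtimes> t + s \<boxtimes> t'"
  "(c *\<^sub>q s) \<boxtimes> t = c *\<^sub>q (s \<boxtimes> t)" "s \<boxtimes> (c *\<^sub>q t) = c *\<^sub>q (s \<boxtimes> t)"
  "0 \<boxtimes> t = 0" "s \<boxtimes> 0 = 0"
proof -
  note d = tcat_def tens_lift_simps tens_lift_fun tcat_multilinear
  show "(s + s') \<boxtimes> t = s \<boxtimes> t + s' \<boxtimes> t" "(c *\<^sub>q s) \<boxtimes> t = c *\<^sub>q (s \<boxtimes> t)" "0 \<boxtimes> t = 0"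
    "s \<boxtimes> (t + t') = s \<boxtimes> t + s \<boxtimes> t'" "s \<boxtimes> (c *\<^sub>q t) = c *\<^sub>q (s \<boxtimes> t)" "s \<boxtimes> 0 = 0"
    by (simp_all add: d)
qed

definition tdegree :: "nat \<Rightarrow> 'a::cq_algebra tens set" where
  "tdegree n = cq.span {pure xs | xs. length xs = n}"

lemma tdegree_pure: "length xs = n \<Longrightarrow> pure xs \<in> tdegree n"
  unfolding tdegree_def by (rule cq.span_base) auto

lemma tdegree_induct [consumes 1, case_names zero add]:
  assumes "x \<in> tdegree n" "P 0"
    "\<And>c xs y. length xs = n \<Longrightarrow> y \<in> tdegree n \<Longrightarrow> P y \<Longrightarrow> P (c *\<^sub>q pure xs + y)"
  shows "P x"
proof -
  have "x \<in> tdegree n \<and> P x"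
    using assms(1) unfolding tdegree_def
  proof (induction rule: cq.span_induct_alt)
    case base
    then show ?case using assms(2) by (simp add: cq.span_zero)
  next
    case (step c x y)
    then show ?case using assms(3)
      by (auto simp: tdegree_def cq.span_add cq.span_scale cq.span_base)
  qed
  then show ?thesis by simp
qed

lemma tdegree_module:
  "0 \<in> tdegree n" "x \<in> tdegree n \<Longrightarrow> y \<in> tdegree n \<Longrightarrow> x + y \<in> tdegree n"
  "x \<in> tdegree n \<Longrightarrow> y \<in> tdegree n \<Longrightarrow> x - y \<in> tdegree n"
  "x \<in> tdegree n \<Longrightarrow> - x \<in> tdegree n" "x \<in> tdegree n \<Longrightarrow> c *\<^sub>q x \<in> tdegree n"
  by (simp_all add: tdegree_def cq.span_zero cq.span_add cq.span_diff cq.span_neg cq.span_scale)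

lemma tdegree_bilinear:
  assumes "x \<in> tdegree m" "y \<in> tdegree n"
    and b: "\<And>s s' t. f (s + s') t = f s t + f s' t" "\<And>s t t'. f s (t + t') = f s t + f s t'"
      "\<And>c s t. f (c *\<^sub>q s) t = c *\<^sub>q f s t" "\<And>c s t. f s (c *\<^sub>q t) = c *\<^sub>q f s t"
      "\<And>t. f 0 t = 0" "\<And>s. f s 0 = 0"
    and p: "\<And>xs ys. length xs = m \<Longrightarrow> length ys = n \<Longrightarrow> f (pure xs) (pure ys) \<in> tdegree k"
  shows "f x y \<in> tdegree k"
  using assms(1)
proof (induction rule: tdegree_induct)
  case zero
  then show ?case by (simp add: b tdegree_module)
next
  case (add c xs z)
  have "f (pure xs) y \<in> tdegree k"
    using assms(2) by (induction rule: tdegree_induct) (simp_all add: b p tdegree_module add.hyps)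
  then show ?case using add.IH by (simp add: b tdegree_module)
qed

lemma tdegree_mult: "x \<in> tdegree n \<Longrightarrow> y \<in> tdegree n \<Longrightarrow> x * y \<in> tdegree n"
  by (rule tdegree_bilinear[where f = "(*)"])
    (assumption | simp add: times_tens_bilinear pure_mult tdegree_pure)+

lemma tdegree_tcat: "x \<in> tdegree m \<Longrightarrow> y \<in> tdegree n \<Longrightarrow> x \<boxtimes> y \<in> tdegree (m + n)"
  by (rule tdegree_bilinear[where f = "(\<boxtimes>)"])
    (assumption | simp add: tcat_bilinear tcat_pure | simp add: tcat_pure tdegree_pure)+

lemma tdegree_unit:
  assumes "x \<in> tdegree n"
  shows "pure (replicate n 1) * x = x" "x * pure (replicate n 1) = x"
proof -
  have m: "map2 (*) (replicate (length xs) 1) xs = xs" "map2 (*) xs (replicate (length xs) 1) = xs"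
    for xs :: "'a list"
    by (induction xs) simp_all
  show "pure (replicate n 1) * x = x" "x * pure (replicate n 1) = x"
    using assms by (induction rule: tdegree_induct)
      (auto simp: times_tens_bilinear pure_mult m)
qed

text \<open>The \<open>n\<close>-th tensor power of \<open>'a\<close>, where \<open>n = CARD('n)\<close>.\<close>

typedef (overloaded) ('a::cq_algebra, 'n::finite) tpow = "tdegree CARD('n) :: 'a tens set"
  using tdegree_module(1) by blast

setup_lifting type_definition_tpow

instantiation tpow :: (cq_algebra, finite) cq_algebra
begin
lift_definition zero_tpow :: "('a, 'b) tpow" is 0 by (rule tdegree_module)
lift_definition plus_tpow :: "('a, 'b) tpow \<Rightarrow> ('a, 'b) tpow \<Rightarrow> ('a, 'b) tpow" is "(+)"
  by (rule tdegree_module)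
lift_definition minus_tpow :: "('a, 'b) tpow \<Rightarrow> ('a, 'b) tpow \<Rightarrow> ('a, 'b) tpow" is "(-)"
  by (rule tdegree_module)
lift_definition uminus_tpow :: "('a, 'b) tpow \<Rightarrow> ('a, 'b) tpow" is uminus
  by (rule tdegree_module)
lift_definition scaleq_tpow :: "cq \<Rightarrow> ('a, 'b) tpow \<Rightarrow> ('a, 'b) tpow" is scaleq
  by (rule tdegree_module)
lift_definition times_tpow :: "('a, 'b) tpow \<Rightarrow> ('a, 'b) tpow \<Rightarrow> ('a, 'b) tpow" is "(*)"
  by (rule tdegree_mult)
lift_definition one_tpow :: "('a, 'b) tpow" is "pure (replicate CARD('b) 1)"
  by (rule tdegree_pure) simp
instance
  by standard
    (transfer, simp add: algebra_simps scaleq_add_right scaleq_add_left scaleq_scaleq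
      scaleq_one times_tens_bilinear tdegree_unit)+
end


section \<open>The quantum group\<close>

datatype uq_gen = gE | gF | gK | gKi

text \<open>\<open>gK\<close> and \<open>gKi\<close> stand for \<open>q\<^sup>H\<close> and \<open>q\<^sup>-\<^sup>H\<close>.\<close>

definition uq_rels :: "uq_gen free_alg set" where
  "uq_rels =
    (let E = fgen gE; F = fgen gF; K = fgen gK; K' = fgen gKi in
     {K * K' - 1, K' * K - 1,
      K * E - qq *\<^sub>q (E * K),
      K * F - inverse qq *\<^sub>q (F * K),
      (E * F - F * E) - inverse (qq - inverse qq) *\<^sub>q (K\<^sup>2 - K'\<^sup>2)})"

quotient_type uq = "uq_gen free_alg" / "\<lambda>x y. x - y \<in> ideal_gen uq_rels"
  by (rule equivp_diff_ideal)

instantiation uq :: cq_algebra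
begin
lift_definition zero_uq :: uq is 0 .
lift_definition one_uq :: uq is 1 .
lift_definition plus_uq :: "uq \<Rightarrow> uq \<Rightarrow> uq" is "(+)"
  unfolding ideal_gen_def by (rule diff_span_add)
lift_definition minus_uq :: "uq \<Rightarrow> uq \<Rightarrow> uq" is "(-)"
  unfolding ideal_gen_def by (rule diff_span_diff)
lift_definition uminus_uq :: "uq \<Rightarrow> uq" is uminus
  unfolding ideal_gen_def by (rule diff_span_neg)
lift_definition scaleq_uq :: "cq \<Rightarrow> uq \<Rightarrow> uq" is scaleq
  unfolding ideal_gen_def by (rule diff_span_scale)
lift_definition times_uq :: "uq \<Rightarrow> uq \<Rightarrow> uq" is "(*)"
  by (rule ideal_gen_cong_mult)
instance
  by standard
    (transfer, simp add: ideal_gen_def cq.span_zero algebra_simps scaleq_add_right scaleq_add_left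
      scaleq_scaleq scaleq_one mult_scaleq_left mult_scaleq_right)+
end

lift_definition uE :: uq is "fgen gE" .
lift_definition uF :: uq is "fgen gF" .
lift_definition uK :: uq is "fgen gK" .
lift_definition uKi :: uq is "fgen gKi" .

lemma qq_nonzero: "qq \<noteq> 0"
  by (simp add: qq_def Zero_fract_def eq_fract)

lemma uq_relations:
  "uK * uKi = 1" "uKi * uK = 1"
  "uK * uE = qq *\<^sub>q (uE * uK)" "uK * uF = inverse qq *\<^sub>q (uF * uK)"
  "uE * uF - uF * uE = inverse (qq - inverse qq) *\<^sub>q (uK * uK - uKi * uKi)"
  by (transfer, rule ideal_gen_base, simp add: uq_rels_def Let_def power2_eq_square)+

lemma uq_relations':
  "uE * uK = inverse qq *\<^sub>q (uK * uE)" "uF * uK = qq *\<^sub>q (uK * uF)"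
  by (simp_all add: uq_relations scaleq_scaleq qq_nonzero scaleq_one)

lemma uKi_commute:
  "uKi * uE = inverse qq *\<^sub>q (uE * uKi)" "uKi * uF = qq *\<^sub>q (uF * uKi)"
proof -
  have "uKi * uE = uKi * (uE * uK) * uKi" by (simp add: mult.assoc uq_relations(1,2))
  also have "\<dots> = inverse qq *\<^sub>q (uE * uKi)"
    by (simp add: uq_relations' mult_scaleq_left mult_scaleq_right mult.assoc[symmetric] uq_relations(1,2))
  finally show "uKi * uE = inverse qq *\<^sub>q (uE * uKi)" .
  have "uKi * uF = uKi * (uF * uK) * uKi" by (simp add: mult.assoc uq_relations(1,2))
  also have "\<dots> = qq *\<^sub>q (uF * uKi)"
    by (simp add: uq_relations' mult_scaleq_left mult_scaleq_right mult.assoc[symmetric] uq_relations(1,2))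
  finally show "uKi * uF = qq *\<^sub>q (uF * uKi)" .
qed

definition casimir :: uq where
  "casimir = inverse (qq + inverse qq) *\<^sub>q
     ((qq - inverse qq)\<^sup>2 *\<^sub>q (uF * uE) + qq *\<^sub>q uK\<^sup>2 + inverse qq *\<^sub>q uKi\<^sup>2)"

lift_definition tpair :: "'a::cq_algebra \<Rightarrow> 'a \<Rightarrow> ('a, 2) tpow" is "\<lambda>x y. pure [x, y]"
  by (rule tdegree_pure) simp

primrec comult_gen :: "uq_gen \<Rightarrow> (uq, 2) tpow" where
  "comult_gen gE = tpair uE uKi + tpair uK uE"
| "comult_gen gF = tpair uF uKi + tpair uK uF"
| "comult_gen gK = tpair uK uK"
| "comult_gen gKi = tpair uKi uKi"

lemma tpair_mult: "tpair a b * tpair c d = tpair (a * c) (b * d)"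
  by transfer (simp add: pure_mult)

lemma tpair_one: "tpair 1 1 = 1"
  by transfer (simp add: numeral_2_eq_2)

lemma tpair_bilinear:
  "tpair (a + b) c = tpair a c + tpair b c" "tpair a (b + c) = tpair a b + tpair a c"
  "tpair (k *\<^sub>q a) b = k *\<^sub>q tpair a b" "tpair a (k *\<^sub>q b) = k *\<^sub>q tpair a b"
proof -
  have p: "pure (xs @ (x + y) # ys) = pure (xs @ x # ys) + pure (xs @ y # ys)"
    "pure (xs @ (k *\<^sub>q x) # ys) = k *\<^sub>q pure (xs @ x # ys)" for xs ys and x y :: 'a and k
    using pure_multilinear[where 'a = 'a] by (auto simp: multilinear_def)
  show "tpair (a + b) c = tpair a c + tpair b c"
    by transfer (use p(1)[of "[]"] in simp)
  show "tpair a (b + c) = tpair a b + tpair a c"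
    by transfer (use p(1)[of "[_]"] in simp)
  show "tpair (k *\<^sub>q a) b = k *\<^sub>q tpair a b"
    by transfer (use p(2)[of "[]"] in simp)
  show "tpair a (k *\<^sub>q b) = k *\<^sub>q tpair a b"
    by transfer (use p(2)[of "[_]"] in simp)
qed

lemma tpair_diff:
  "tpair (a - b) c = tpair a c - tpair b c" "tpair a (b - c) = tpair a b - tpair a c"
  using tpair_bilinear(1)[of "a - b" b c] tpair_bilinear(2)[of a "b - c" c]
  by (simp_all add: algebra_simps)

lemma comult_gen_rels:
  assumes "r \<in> uq_rels" shows "free_eval comult_gen r = 0"
proof -
  define K K' E F where d: "K = comult_gen gK" "K' = comult_gen gKi" "E = comult_gen gE"
    "F = comult_gen gF"
  note e = d comult_gen.simps distrib_left distrib_right tpair_mult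
  have h: "free_eval comult_gen (x + y) = free_eval comult_gen x + free_eval comult_gen y"
    "free_eval comult_gen (x - y) = free_eval comult_gen x - free_eval comult_gen y"
    "free_eval comult_gen (c *\<^sub>q x) = c *\<^sub>q free_eval comult_gen x"
    "free_eval comult_gen 1 = 1" for x y c
    using free_eval_hom[of comult_gen]
    by (simp_all add: cq_algebra_hom_def) (simp add: free_eval_def lin_ext_diff)
  have 1: "K * K' = 1" "K' * K = 1"
    by (simp_all add: e uq_relations tpair_one)
  have 2: "K * E = qq *\<^sub>q (E * K)"
    by (simp add: e uq_relations uKi_commute tpair_bilinear scaleq_add_right)
  have 3: "K * F = inverse qq *\<^sub>q (F * K)"
    by (simp add: e uq_relations uKi_commute tpair_bilinear scaleq_add_right)
  have m1: "tpair (uK * uF) (uE * uKi) = tpair (uF * uK) (uKi * uE)"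
    by (simp add: uq_relations uKi_commute tpair_bilinear scaleq_scaleq)
  have m2: "tpair (uE * uK) (uKi * uF) = tpair (uK * uE) (uF * uKi)"
    by (simp add: uq_relations' uKi_commute tpair_bilinear scaleq_scaleq qq_nonzero scaleq_one)
  have "E * F - F * E = tpair (uE * uF - uF * uE) (uKi * uKi) + tpair (uK * uK) (uE * uF - uF * uE)"
    using m1 m2 by (simp add: e tpair_diff algebra_simps)
  also have "\<dots> = inverse (qq - inverse qq) *\<^sub>q (K * K - K' * K')"
    by (simp add: e uq_relations tpair_diff tpair_bilinear cq.scale_right_diff_distrib)
  finally have 4: "E * F - F * E = inverse (qq - inverse qq) *\<^sub>q (K * K - K' * K')" .
  show ?thesis
    using assms 1 2 3 4
    by (auto simp: uq_rels_def Let_def h free_eval_mult free_eval_fgen power2_eq_square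
        d[symmetric] simp del: comult_gen.simps)
qed

lift_definition comult :: "uq \<Rightarrow> (uq, 2) tpow" is "free_eval comult_gen"
proof -
  fix x y assume "x - y \<in> ideal_gen uq_rels"
  then have "free_eval comult_gen (x - y) = 0"
    by (rule free_eval_ideal) (rule comult_gen_rels)
  then show "free_eval comult_gen x = free_eval comult_gen y"
    by (simp add: free_eval_def lin_ext_diff)
qed

lemma comult_hom: "cq_algebra_hom comult"
proof -
  have h: "free_eval comult_gen (x + y) = free_eval comult_gen x + free_eval comult_gen y"
    "free_eval comult_gen (c *\<^sub>q x) = c *\<^sub>q free_eval comult_gen x"
    "free_eval comult_gen (x * y) = free_eval comult_gen x * free_eval comult_gen y"
    "free_eval comult_gen 1 = 1" for x y c
    using free_eval_hom[of comult_gen] by (simp_all add: cq_algebra_hom_def)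
  have "comult (x + y) = comult x + comult y" for x y by transfer (rule h)
  moreover have "comult (c *\<^sub>q x) = c *\<^sub>q comult x" for c x by transfer (rule h)
  moreover have "comult (x * y) = comult x * comult y" for x y by transfer (rule h)
  moreover have "comult 1 = 1" by transfer (rule h)
  ultimately show ?thesis by (simp add: cq_algebra_hom_def)
qed

lemma comult_generators:
  "comult uE = tpair uE uKi + tpair uK uE" "comult uF = tpair uF uKi + tpair uK uF"
  "comult uK = tpair uK uK" "comult uKi = tpair uKi uKi"
proof -
  note f = free_eval_fgen[of comult_gen]
  show "comult uE = tpair uE uKi + tpair uK uE" by (simp add: uE.abs_eq comult.abs_eq f)
  show "comult uF = tpair uF uKi + tpair uK uF" by (simp add: uF.abs_eq comult.abs_eq f)
  show "comult uK = tpair uK uK" by (simp add: uK.abs_eq comult.abs_eq f)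
  show "comult uKi = tpair uKi uKi" by (simp add: uKi.abs_eq comult.abs_eq f)
qed

text \<open>The iterated coproduct is \<open>\<Delta>\<^sup>(\<^sup>m\<^sup>+\<^sup>1\<^sup>) = (\<Delta> \<otimes> id \<otimes> \<dots> \<otimes> id) \<Delta>\<^sup>(\<^sup>m\<^sup>)\<close>. It lives in \<open>uq tens\<close>
  because its degree varies; the empty tuple never occurs in it.\<close>

definition comult_head_tuple :: "uq list \<Rightarrow> uq tens" where
  "comult_head_tuple xs =
     (case xs of [] \<Rightarrow> 0 | x # ys \<Rightarrow> Rep_tpow (comult x) \<boxtimes> pure ys)"

definition comult_head :: "uq tens \<Rightarrow> uq tens" where
  "comult_head = tens_lift comult_head_tuple"

primrec iter_comult :: "nat \<Rightarrow> uq \<Rightarrow> uq tens" where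
  "iter_comult 0 x = pure [x]"
| "iter_comult (Suc m) x = comult_head (iter_comult m x)"

lemma multilinear_comult_head_tuple: "multilinear comult_head_tuple"
proof -
  have c: "comult (x + y) = comult x + comult y" "comult (k *\<^sub>q x) = k *\<^sub>q comult x" for x y k
    using comult_hom by (simp_all add: cq_algebra_hom_def)
  have p: "pure (xs @ (x + y) # ys) = pure (xs @ x # ys) + pure (xs @ y # ys)"
    "pure (xs @ (k *\<^sub>q x) # ys) = k *\<^sub>q pure (xs @ x # ys)" for xs ys and x y :: uq and k
    using pure_multilinear[where 'a = uq] by (auto simp: multilinear_def)
  show ?thesis
    unfolding multilinear_def
  proof (intro conjI allI)
    fix xs ys :: "uq list" and x y k
    show "comult_head_tuple (xs @ (x + y) # ys) =
        comult_head_tuple (xs @ x # ys) + comult_head_tuple (xs @ y # ys)"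
      by (cases xs) (simp_all add: comult_head_tuple_def c p plus_tpow.rep_eq tcat_bilinear)
    show "comult_head_tuple (xs @ (k *\<^sub>q x) # ys) = k *\<^sub>q comult_head_tuple (xs @ x # ys)"
      by (cases xs) (simp_all add: comult_head_tuple_def c p scaleq_tpow.rep_eq tcat_bilinear)
  qed
qed

lemma tdegree_comult_head:
  assumes "x \<in> tdegree (Suc m)" shows "comult_head x \<in> tdegree (Suc (Suc m))"
  using assms
proof (induction rule: tdegree_induct)
  case zero
  then show ?case
    by (simp add: comult_head_def tens_lift_simps multilinear_comult_head_tuple tdegree_module)
next
  case (add c xs y)
  then obtain z zs where xs: "xs = z # zs" "length zs = m" by (cases xs) auto
  have "Rep_tpow (comult z) \<in> tdegree 2" using Rep_tpow[of "comult z"] by simp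
  from tdegree_tcat[OF this tdegree_pure[OF xs(2)]]
  have "comult_head_tuple xs \<in> tdegree (Suc (Suc m))"
    by (simp add: comult_head_tuple_def xs)
  then show ?case using add.IH
    by (simp add: comult_head_def tens_lift_simps multilinear_comult_head_tuple tdegree_module)
qed

lemma tdegree_iter_comult: "iter_comult m x \<in> tdegree (Suc m)"
  by (induction m) (simp_all add: tdegree_pure tdegree_comult_head)


section \<open>Connected sets\<close>

definition is_connected :: "nat set \<Rightarrow> bool" where
  "is_connected I \<longleftrightarrow> (\<exists>i j. i \<le> j \<and> I = {i..j})"

definition set_less :: "nat set \<Rightarrow> nat set \<Rightarrow> bool"  (infix \<open>\<prec>\<close> 50) where
  "I \<prec> J \<longleftrightarrow> (\<forall>x\<in>I. \<forall>y\<in>J. x < y)"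

definition is_adjacent :: "nat set \<Rightarrow> nat set \<Rightarrow> bool" where
  "is_adjacent I J \<longleftrightarrow>
     is_connected I \<and> is_connected J \<and> I \<inter> J = {} \<and> is_connected (I \<union> J)"

definition monotonic :: "nat set list \<Rightarrow> bool" where
  "monotonic Is \<longleftrightarrow> sorted_wrt (\<prec>) Is \<or> sorted_wrt (\<lambda>I J. J \<prec> I) Is"

definition monotonic_adjacent :: "nat \<Rightarrow> nat set list \<Rightarrow> bool" where
  "monotonic_adjacent n Is \<longleftrightarrow>
     (\<forall>I\<in>set Is. is_connected I \<and> I \<subseteq> {1..n}) \<and> monotonic Is \<and> successively is_adjacent Is"

definition hole :: "nat set \<Rightarrow> nat set \<Rightarrow> nat set" where
  "hole I J = {x. (\<forall>a\<in>I. \<forall>b\<in>J. a < x \<and> x < b) \<or> (\<forall>a\<in>I. \<forall>b\<in>J. b < x \<and> x < a)}"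

text \<open>\<open>C_seq c [I\<^sub>1, \<dots>, I\<^sub>k]\<close> is \<open>C\<^bsub>I\<^sub>1\<dots>I\<^sub>k\<^esub>\<close>, where the values on connected sets are given by \<open>c\<close>. An
  empty hole means that neighbouring sets are adjacent, and they are merged. Where there is a hole,
  the recursion is taken at the first position, with the merges in its four index sequences
  carried out.\<close>

fun C_seq :: "(nat set \<Rightarrow> 'a::cq_algebra) \<Rightarrow> nat set list \<Rightarrow> 'a" where
  "C_seq c [] = 1"
| "C_seq c [I] = c I"
| "C_seq c (I # J # Js) =
    (if hole I J = {} then C_seq c ((I \<union> J) # Js)
     else - qcomm (C_seq c [I \<union> hole I J]) (C_seq c ((hole I J \<union> J) # Js))
          + C_seq c [I] * C_seq c (J # Js)
          + C_seq c [hole I J] * C_seq c ((I \<union> hole I J \<union> J) # Js))"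

definition max_connected :: "nat set \<Rightarrow> nat set set" where
  "max_connected S =
     {I. is_connected I \<and> I \<subseteq> S \<and> (\<forall>J. is_connected J \<longrightarrow> I \<subseteq> J \<longrightarrow> J \<subseteq> S \<longrightarrow> J = I)}"

definition components :: "nat set \<Rightarrow> nat set list" where
  "components S = (THE Is. sorted_wrt (\<prec>) Is \<and> set Is = max_connected S)"

lemma is_connected_finite: "is_connected I \<Longrightarrow> finite I \<and> I \<noteq> {}"
  by (auto simp: is_connected_def)

lemma set_less_Min: "is_connected I \<Longrightarrow> is_connected J \<Longrightarrow> I \<prec> J \<Longrightarrow> Min I < Min J"
  using is_connected_finite by (simp add: set_less_def)

lemma strict_sorted_Min:
  assumes "sorted_wrt (\<prec>) Is" "\<forall>I\<in>set Is. is_connected I"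
  shows "sorted_wrt (<) (map Min Is)"
  unfolding sorted_wrt_map using assms(1)
  by (rule sorted_wrt_mono_rel[rotated]) (simp add: assms(2) set_less_Min)

lemma max_connectedD:
  assumes "I \<in> max_connected S"
  shows "is_connected I" "I \<subseteq> S" "is_connected J \<Longrightarrow> I \<subseteq> J \<Longrightarrow> J \<subseteq> S \<Longrightarrow> J = I"
  using assms by (auto simp only: max_connected_def mem_Collect_eq)

lemma components_eqI:
  assumes "sorted_wrt (\<prec>) Is" "set Is = max_connected S"
  shows "components S = Is"
  unfolding components_def
proof (rule the_equality)
  show "sorted_wrt (\<prec>) Is \<and> set Is = max_connected S" using assms by simp
  fix Js assume Js: "sorted_wrt (\<prec>) Js \<and> set Js = max_connected S"
  have c: "\<forall>I\<in>max_connected S. is_connected I" by (blast dest: max_connectedD(1))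
  have 1: "sorted_wrt (<) (map Min Is)" "sorted_wrt (<) (map Min Js)"
    by (rule strict_sorted_Min; use assms Js c in simp)+
  have "map Min Js = map Min Is"
    by (rule strict_sorted_equal) (use 1 assms Js in simp_all)
  moreover have "inj_on Min (set Js \<union> set Is)"
    using 1(1) assms Js by (auto simp: strict_sorted_iff distinct_map)
  ultimately show "Js = Is" by (rule map_inj_on)
qed

lemma max_connected_less:
  assumes "I \<in> max_connected S" "J \<in> max_connected S" "Min I < Min J"
  shows "I \<prec> J"
proof -
  obtain a b c d where I: "I = {a..b}" "a \<le> b" and J: "J = {c..d}" "c \<le> d"
    using assms(1,2)[THEN max_connectedD(1)] unfolding is_connected_def by auto
  have "Min I = a" "Min J = c" using I J by (auto intro: Min_eqI)
  with assms(3) have ac: "a < c" by simp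
  have "b < c"
  proof (rule ccontr)
    assume "\<not> b < c"
    then have u: "I \<union> J = {a..max b d}" using ac I J by (auto simp: le_max_iff_disj)
    have con: "is_connected (I \<union> J)"
      unfolding u is_connected_def using I by (intro exI[of _ a] exI[of _ "max b d"]) simp
    have "I \<union> J \<subseteq> S" using assms(1,2)[THEN max_connectedD(2)] by simp
    then have "I \<union> J = J" using max_connectedD(3)[OF assms(2) con] by simp
    moreover have "a \<in> I" "a \<notin> J" using ac I J by auto
    ultimately show False by blast
  qed
  then show ?thesis using I J by (auto simp: set_less_def)
qed

lemma components_correct:
  assumes "finite S"
  shows "sorted_wrt (\<prec>) (components S)" "set (components S) = max_connected S"
proof -
  have fin: "finite (max_connected S)"
    by (rule finite_subset[of _ "Pow S"]) (use assms max_connectedD(2) in auto)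
  have inj: "inj_on Min (max_connected S)"
  proof (rule inj_onI)
    fix I J assume IJ: "I \<in> max_connected S" "J \<in> max_connected S" "Min I = Min J"
    then obtain a b c d where ab: "I = {a..b}" "a \<le> b" "J = {c..d}" "c \<le> d"
      using IJ(1,2)[THEN max_connectedD(1)] unfolding is_connected_def by auto
    then have "Min I = a" "Min J = c" by (auto intro: Min_eqI)
    with IJ(3) ab have "I \<subseteq> J \<or> J \<subseteq> I" by auto
    then show "I = J"
      using max_connectedD[OF IJ(1)] max_connectedD[OF IJ(2)] by metis
  qed
  obtain xs where xs: "set xs = max_connected S" "distinct xs"
    using finite_distinct_list[OF fin] by blast
  define Is where "Is = sort_key Min xs"
  have "sorted (map Min Is)" "distinct (map Min Is)" "set Is = max_connected S"
    using xs inj by (simp_all add: Is_def distinct_map)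
  then have "sorted_wrt (\<lambda>I J. Min I < Min J) Is"
    by (simp flip: sorted_wrt_map add: strict_sorted_iff)
  then have "sorted_wrt (\<prec>) Is"
    by (rule sorted_wrt_mono_rel[rotated])
      (simp add: max_connected_less \<open>set Is = max_connected S\<close>)
  with \<open>set Is = max_connected S\<close>
  show "sorted_wrt (\<prec>) (components S)" "set (components S) = max_connected S"
    using components_eqI by simp_all
qed


section \<open>The algebra \<open>aw(n)\<close>\<close>

typedef (overloaded) 'n conn = "{I. is_connected I \<and> I \<subseteq> {1..CARD('n::finite)}}"
proof
  show "{1} \<in> {I. is_connected I \<and> I \<subseteq> {1..CARD('n)}}"
    by (auto simp: is_connected_def Suc_le_eq intro!: exI[of _ 1])
qed

setup_lifting type_definition_conn

text \<open>The type variable \<open>'n\<close> enters only through \<open>n = CARD('n)\<close>. The functions \<open>aw_sym\<close>, \<open>aw_gen\<close> and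
  \<open>Q_casimir\<close> are unspecified outside the connected subsets of \<open>{1..n}\<close>.\<close>

definition aw_sym :: "nat set \<Rightarrow> 'n::finite conn free_alg" where
  "aw_sym I = fgen (Abs_conn I)"

definition aw_rels :: "'n::finite conn free_alg set" where
  "aw_rels = (let n = CARD('n); C = C_seq (aw_sym :: nat set \<Rightarrow> 'n conn free_alg) in
     {C [I] * C [J] - C [J] * C [I] | I J.
        is_connected I \<and> is_connected J \<and> I \<subseteq> {1..n} \<and> J \<subseteq> {1..n} \<and> (I \<inter> J = {} \<or> I \<subset> J)} \<union>
     {C [I1, I2] - (- qcomm (C [I2, I3]) (C [I1, I3]) + C [I1] * C [I2] + C [I3] * C [I1, I2, I3])
        | I1 I2 I3. monotonic_adjacent n [I1, I2, I3]} \<union>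
     {C [I1, I4] - (- qcomm (C [I1, I3]) (C [I3, I4]) + C [I1] * C [I4] + C [I3] * C [I1, I3, I4])
        | I1 I2 I3 I4. monotonic_adjacent n [I1, I2, I3, I4]})"

quotient_type (overloaded) 'n aw =
  "'n::finite conn free_alg" / "\<lambda>x y. x - y \<in> ideal_gen aw_rels"
  by (rule equivp_diff_ideal)

instantiation aw :: (finite) cq_algebra
begin
lift_definition zero_aw :: "'a aw" is 0 .
lift_definition one_aw :: "'a aw" is 1 .
lift_definition plus_aw :: "'a aw \<Rightarrow> 'a aw \<Rightarrow> 'a aw" is "(+)"
  unfolding ideal_gen_def by (rule diff_span_add)
lift_definition minus_aw :: "'a aw \<Rightarrow> 'a aw \<Rightarrow> 'a aw" is "(-)"
  unfolding ideal_gen_def by (rule diff_span_diff)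
lift_definition uminus_aw :: "'a aw \<Rightarrow> 'a aw" is uminus
  unfolding ideal_gen_def by (rule diff_span_neg)
lift_definition scaleq_aw :: "cq \<Rightarrow> 'a aw \<Rightarrow> 'a aw" is scaleq
  unfolding ideal_gen_def by (rule diff_span_scale)
lift_definition times_aw :: "'a aw \<Rightarrow> 'a aw \<Rightarrow> 'a aw" is "(*)"
  by (rule ideal_gen_cong_mult)
instance
  by standard
    (transfer, simp add: ideal_gen_def cq.span_zero algebra_simps scaleq_add_right scaleq_add_left
      scaleq_scaleq scaleq_one mult_scaleq_left mult_scaleq_right)+
end

lift_definition aw_gen :: "nat set \<Rightarrow> 'n::finite aw" is aw_sym .

definition C_set :: "nat set \<Rightarrow> 'n::finite aw" where
  "C_set S = C_seq aw_gen (components S)"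

definition Omega :: "nat set \<Rightarrow> nat set \<Rightarrow> nat set \<Rightarrow> 'n::finite aw" where
  "Omega I1 I2 I3 =
    (let q = qq; q' = inverse qq;
         C1 = C_set I1; C2 = C_set I2; C3 = C_set I3;
         C12 = C_set (I1 \<union> I2); C23 = C_set (I2 \<union> I3); C13 = C_set (I1 \<union> I3);
         C123 = C_set (I1 \<union> I2 \<union> I3)
     in q *\<^sub>q (C12 * C23 * C13)
        + inverse (q + q') *\<^sub>q
            (q\<^sup>2 *\<^sub>q C12\<^sup>2 + q'\<^sup>2 *\<^sub>q C23\<^sup>2 + q\<^sup>2 *\<^sub>q C13\<^sup>2 + C123\<^sup>2 + C1\<^sup>2 + C2\<^sup>2 + C3\<^sup>2)
        - q *\<^sub>q (C12 * (C1 * C2 + C3 * C123))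
        - q' *\<^sub>q (C23 * (C2 * C3 + C1 * C123))
        - q *\<^sub>q (C13 * (C1 * C3 + C2 * C123))
        + (q + q') *\<^sub>q (C1 * C2 * C3 * C123)
        - inverse (q + q') *\<^sub>q 1)"

text \<open>\<open>omega I\<^sub>1 I\<^sub>2 I\<^sub>3\<close> is \<open>\<omega>\<^sub>S\<close> computed from the decomposition \<open>S = I\<^sub>1 \<union> I\<^sub>2 \<union> I\<^sub>3\<close>.\<close>

definition omega :: "nat set \<Rightarrow> nat set \<Rightarrow> nat set \<Rightarrow> 'n::finite aw" where
  "omega I1 I2 I3 =
    (\<Sum>I\<in>Pow I1. \<Sum>J\<in>Pow I2. \<Sum>K\<in>Pow I3.
       ((-1) ^ (card (I1 \<union> I2 \<union> I3) - card I - card J - card K)) *\<^sub>q Omega I J K)"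


section \<open>Intermediate Casimir elements\<close>

lift_definition conn_casimir :: "'n::finite conn \<Rightarrow> (uq, 'n) tpow" is
  "\<lambda>I. pure (replicate (Min I - 1) 1) \<boxtimes> iter_comult (Max I - Min I) casimir \<boxtimes>
       pure (replicate (CARD('n) - Max I) 1)"
proof -
  fix I assume "is_connected I \<and> I \<subseteq> {1..CARD('n)}"
  then obtain i j where ij: "i \<le> j" "I = {i..j}" "1 \<le> i" "j \<le> CARD('n)"
    by (auto simp: is_connected_def)
  then have m: "Min I = i" "Max I = j" by (auto intro: Min_eqI Max_eqI)
  have "i - 1 + (Suc (j - i) + (CARD('n) - j)) = CARD('n)" using ij by simp
  moreover have "pure (replicate (i - 1) 1) \<boxtimes> iter_comult (j - i) casimir \<boxtimes>
      pure (replicate (CARD('n) - j) 1) \<in> tdegree (i - 1 + (Suc (j - i) + (CARD('n) - j)))"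
    by (intro tdegree_tcat tdegree_iter_comult tdegree_pure) simp_all
  ultimately show "pure (replicate (Min I - 1) 1) \<boxtimes> iter_comult (Max I - Min I) casimir \<boxtimes>
      pure (replicate (CARD('n) - Max I) 1) \<in> tdegree CARD('n)"
    by (simp add: m)
qed

definition Q_casimir :: "nat set \<Rightarrow> (uq, 'n::finite) tpow" where
  "Q_casimir I = conn_casimir (Abs_conn I)"

end

theory Submission
  imports Defs
begin

text \<open>Write the Casimir elements as quantum traces. In each copy of the quantum group there is a two by
  two matrix \<open>L = L\<^sup>+ (L\<^sup>-)\<^sup>-\<^sup>1\<close> whose quantum trace \<open>q L\<^sub>1\<^sub>1 + q\<^sup>-\<^sup>1 L\<^sub>2\<^sub>2\<close> is \<open>(q + q\<^sup>-\<^sup>1) Q\<close>. Conjugating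
  by the \<open>L\<^sup>+\<close> of all earlier copies gives matrices \<open>M\<^sub>1, \<dots>, M\<^sub>n\<close> which satisfy a Cayley-Hamilton identity
  and pairwise exchange relations, both inherited by ordered products. For every subset \<open>S\<close>, connected or
  not, \<open>\<phi>(C\<^sub>S)\<close> is then the normalised quantum trace of the ordered product of the \<open>M\<^sub>j\<close> with \<open>j \<in> S\<close>:
  the recursion for \<open>C\<^sub>S\<close> is a trace identity for three exchanging matrices. The vanishing of the image of
  \<open>\<Omega>\<close> is another one, a quantum Fricke relation, so every summand of \<open>\<omega>\<^sub>S\<close> is already in the kernel.\<close>

section \<open>Two by two matrices and the quantum trace\<close>

text \<open>At q = 1, with commuting entries, \<open>exch\<close> is the polarised Cayley-Hamilton
  identity and the relation behind \<Omega> is the classical Fricke relation between the traces of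
  three matrices of determinant one and of their products. For general q the obstacle is that
  \<open>qtr\<close> is not cyclic. Two devices replace cyclicity. The trace of A is, as a scalar
  matrix, q A + q^-1 A^-1, so a product of two traces resolves into traces of single words once one
  of them can be moved to a suitable place in the other word. And conjugation preserves the quantum
  trace when the two matrices exchange in the right order; the exchange relation is not symmetric,
  so the order of the factors matters throughout. The dressing is needed because the product of the
  undressed matrices \<open>L i\<close> is not the L-operator of the coproduct. Once dressed, a set
  with holes needs no new construction: the copies in the hole are left out of the product.\<close>

datatype 'a mat2 = Mat2 (m11: 'a) (m12: 'a) (m21: 'a) (m22: 'a)

instantiation mat2 :: (cq_algebra) cq_algebra
begin
definition "0 = Mat2 0 0 0 0"
definition "1 = Mat2 1 0 0 1"
definition "A + B = Mat2 (m11 A + m11 B) (m12 A + m12 B) (m21 A + m21 B) (m22 A + m22 B)"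
definition "A - B = Mat2 (m11 A - m11 B) (m12 A - m12 B) (m21 A - m21 B) (m22 A - m22 B)"
definition "- A = Mat2 (- m11 A) (- m12 A) (- m21 A) (- m22 A)"
definition "c *\<^sub>q A = Mat2 (c *\<^sub>q m11 A) (c *\<^sub>q m12 A) (c *\<^sub>q m21 A) (c *\<^sub>q m22 A)"
definition "A * B = Mat2 (m11 A * m11 B + m12 A * m21 B) (m11 A * m12 B + m12 A * m22 B)
  (m21 A * m11 B + m22 A * m21 B) (m21 A * m12 B + m22 A * m22 B)"
instance
  by standard (simp_all add: zero_mat2_def one_mat2_def plus_mat2_def minus_mat2_def uminus_mat2_def
    scaleq_mat2_def times_mat2_def algebra_simps scaleq_add_right scaleq_add_left scaleq_scaleq
    scaleq_one mult_scaleq_left mult_scaleq_right)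
end

lemmas mat2_defs = zero_mat2_def one_mat2_def plus_mat2_def minus_mat2_def uminus_mat2_def
  scaleq_mat2_def times_mat2_def

definition scal :: "'a::cq_algebra \<Rightarrow> 'a mat2" where "scal x = Mat2 x 0 0 x"

definition qtr :: "'a::cq_algebra mat2 \<Rightarrow> 'a" where
  "qtr A = qq *\<^sub>q m11 A + inverse qq *\<^sub>q m22 A"

declare cq.scale_scale [simp del]

lemma scaleq_cancel [simp]:
  "qq *\<^sub>q inverse qq *\<^sub>q x = x" "inverse qq *\<^sub>q qq *\<^sub>q x = x"
  by (simp_all add: scaleq_scaleq qq_nonzero scaleq_one)

text \<open>Normal form for the scalars: nested multiplications by \<open>qq\<close> alone or by \<open>inverse qq\<close> alone.\<close>

lemmas scaleq_nf = scaleq_add_right scaleq_add_left cq.scale_right_diff_distrib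
  cq.scale_left_diff_distrib cq.scale_minus_right cq.scale_minus_left mult_scaleq_left mult_scaleq_right
  scaleq_one

lemmas ring_nf = scaleq_nf distrib_left distrib_right left_diff_distrib right_diff_distrib mult.assoc

lemma qtr_linear:
  "qtr (A + B) = qtr A + qtr B" "qtr (A - B) = qtr A - qtr B" "qtr (- A) = - qtr A"
  "qtr (c *\<^sub>q A) = c *\<^sub>q qtr A"
  by (simp_all add: qtr_def mat2_defs scaleq_nf scaleq_scaleq mult.commute)

lemma qtr_scal:
  "qtr (scal x * A) = x * qtr A" "qtr (A * scal x) = qtr A * x"
  "qtr (scal x) = qq *\<^sub>q x + inverse qq *\<^sub>q x" "qtr 1 = qq *\<^sub>q 1 + inverse qq *\<^sub>q 1"
  by (simp_all add: qtr_def mat2_defs scaleq_nf scal_def distrib_left distrib_right)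

lemma scal_algebra:
  "scal (x + y) = scal x + scal y" "scal (x - y) = scal x - scal y" "scal (c *\<^sub>q x) = c *\<^sub>q scal x"
  "scal (x * y) = scal x * scal y" "scal 1 = 1" "scal (- x) = - scal x" "scal 0 = 0"
  by (simp_all add: scal_def mat2_defs)

text \<open>The consequence of the exchange relation
  \<open>R X\<^sub>1 R\<^sup>-\<^sup>1 Y\<^sub>2 = Y\<^sub>2 R X\<^sub>1 R\<^sup>-\<^sup>1\<close> obtained by contracting the two auxiliary spaces, together with the
  fact that the quantum trace of each matrix commutes with the entries of the other.\<close>

definition exch :: "'a::cq_algebra mat2 \<Rightarrow> 'a mat2 \<Rightarrow> bool" where
  "exch X Y \<longleftrightarrow> Y * X = inverse qq *\<^sub>q scal (qtr Y) * X + inverse qq *\<^sub>q scal (qtr X) * Y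
     + inverse qq *\<^sub>q inverse qq *\<^sub>q inverse qq *\<^sub>q scal (qtr (X * Y)) - inverse qq *\<^sub>q inverse qq *\<^sub>q scal (qtr X * qtr Y)
     - inverse qq *\<^sub>q inverse qq *\<^sub>q (X * Y)
   \<and> scal (qtr X) * Y = Y * scal (qtr X) \<and> scal (qtr Y) * X = X * scal (qtr Y)"

lemma exchD:
  assumes "exch X Y"
  shows "Y * X = inverse qq *\<^sub>q scal (qtr Y) * X + inverse qq *\<^sub>q scal (qtr X) * Y
     + inverse qq *\<^sub>q inverse qq *\<^sub>q inverse qq *\<^sub>q scal (qtr (X * Y)) - inverse qq *\<^sub>q inverse qq *\<^sub>q scal (qtr X * qtr Y)
     - inverse qq *\<^sub>q inverse qq *\<^sub>q (X * Y)"
    "scal (qtr X) * Y = Y * scal (qtr X)" "scal (qtr Y) * X = X * scal (qtr Y)"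
  using assms unfolding exch_def by auto

text \<open>The q-version of X^2 = tr(X) X - 1. For invertible X it says that the quantum trace, as
  a scalar matrix, is q X + q^-1 X^-1. The commutation is carried along because the entries do not
  commute.\<close>

definition cayley_hamilton :: "'a::cq_algebra mat2 \<Rightarrow> bool" where
  "cayley_hamilton X \<longleftrightarrow> X * X = inverse qq *\<^sub>q scal (qtr X) * X - inverse qq *\<^sub>q inverse qq *\<^sub>q 1 \<and>
     scal (qtr X) * X = X * scal (qtr X)"

text \<open>The inverse read off from Cayley-Hamilton. Being linear in X and its trace, it stays in
  the classes \<open>lower\<close> and \<open>upper\<close> below, so words with inverses exchange
  as well.\<close>

definition qinv :: "'a::cq_algebra mat2 \<Rightarrow> 'a mat2" where
  "qinv X = qq *\<^sub>q scal (qtr X) - qq *\<^sub>q qq *\<^sub>q X"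

lemma qinv:
  assumes "cayley_hamilton X"
  shows "X * qinv X = 1" "qinv X * X = 1"
proof -
  have X: "X * X = inverse qq *\<^sub>q scal (qtr X) * X - inverse qq *\<^sub>q inverse qq *\<^sub>q 1" "X * scal (qtr X) = scal (qtr X) * X"
    using assms by (simp_all add: cayley_hamilton_def)
  show "X * qinv X = 1" "qinv X * X = 1"
    by (simp_all add: X qinv_def scaleq_nf algebra_simps)
qed

lemma scaleq_inj: "inverse qq *\<^sub>q x = inverse qq *\<^sub>q y \<longleftrightarrow> x = y" "qq *\<^sub>q x = qq *\<^sub>q y \<longleftrightarrow> x = y"
  by (metis scaleq_cancel)+

text \<open>The exchange relation, solved for the trace of X * Y (this is \<open>G\<close>), is
  multiplied by X * Y once from the right and once from the left. Reduction by the two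
  Cayley-Hamilton identities gives the same matrix both times, so the quadratic identity and the
  commutation come out together.\<close>

lemma cayley_hamilton_mult:
  assumes "cayley_hamilton X" "cayley_hamilton Y" "exch X Y"
  shows "cayley_hamilton (X * Y)"
proof -
  define x y m where "x = scal (qtr X)" and "y = scal (qtr Y)" and "m = scal (qtr (X * Y))"
  note d = x_def[symmetric] y_def[symmetric] m_def[symmetric] scal_algebra
  have X: "X * X = inverse qq *\<^sub>q x * X - inverse qq *\<^sub>q inverse qq *\<^sub>q 1" "X * x = x * X"
    and Y: "Y * Y = inverse qq *\<^sub>q y * Y - inverse qq *\<^sub>q inverse qq *\<^sub>q 1" "Y * y = y * Y"
    and xy: "Y * x = x * Y" "X * y = y * X"
    using assms exchD[OF assms(3)] by (simp_all add: cayley_hamilton_def d)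
  have yx: "y * x = x * y"
  proof -
    have "qtr Y * qtr X = qtr (scal (qtr Y) * X)" by (simp add: qtr_scal)
    also have "\<dots> = qtr X * qtr Y" unfolding exchD(3)[OF assms(3)] by (simp add: qtr_scal)
    finally show ?thesis by (simp add: x_def y_def flip: scal_algebra)
  qed
  note r = X Y xy yx
  have r': "X * (X * Z) = inverse qq *\<^sub>q x * X * Z - inverse qq *\<^sub>q inverse qq *\<^sub>q Z" "X * (x * Z) = x * (X * Z)"
    "Y * (Y * Z) = inverse qq *\<^sub>q y * Y * Z - inverse qq *\<^sub>q inverse qq *\<^sub>q Z" "Y * (y * Z) = y * (Y * Z)"
    "Y * (x * Z) = x * (Y * Z)" "X * (y * Z) = y * (X * Z)" "y * (x * Z) = x * (y * Z)" for Z
    by (simp_all add: r left_diff_distrib mult_scaleq_left flip: mult.assoc)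
  have G: "inverse qq *\<^sub>q inverse qq *\<^sub>q inverse qq *\<^sub>q m = Y * X + inverse qq *\<^sub>q inverse qq *\<^sub>q (X * Y) + inverse qq *\<^sub>q inverse qq *\<^sub>q (x * y)
      - inverse qq *\<^sub>q y * X - inverse qq *\<^sub>q x * Y"
    using assms(3) by (simp add: exch_def d algebra_simps mult_scaleq_left)
  have "inverse qq *\<^sub>q inverse qq *\<^sub>q (inverse qq *\<^sub>q m * (X * Y)) = (inverse qq *\<^sub>q inverse qq *\<^sub>q inverse qq *\<^sub>q m) * (X * Y)"
    by (simp add: mult_scaleq_left)
  also have "\<dots> = inverse qq *\<^sub>q inverse qq *\<^sub>q (X * Y * (X * Y) + inverse qq *\<^sub>q inverse qq *\<^sub>q 1)"
    unfolding G by (simp add: r r' scaleq_nf algebra_simps)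
  finally have 1: "inverse qq *\<^sub>q m * (X * Y) = X * Y * (X * Y) + inverse qq *\<^sub>q inverse qq *\<^sub>q 1"
    by (simp add: scaleq_inj qq_nonzero)
  have "inverse qq *\<^sub>q inverse qq *\<^sub>q (X * Y * (inverse qq *\<^sub>q m)) = X * Y * (inverse qq *\<^sub>q inverse qq *\<^sub>q inverse qq *\<^sub>q m)"
    by (simp add: mult_scaleq_right)
  also have "\<dots> = inverse qq *\<^sub>q inverse qq *\<^sub>q (X * Y * (X * Y) + inverse qq *\<^sub>q inverse qq *\<^sub>q 1)"
    unfolding G by (simp add: r r' scaleq_nf algebra_simps)
  finally have 2: "X * Y * (inverse qq *\<^sub>q m) = X * Y * (X * Y) + inverse qq *\<^sub>q inverse qq *\<^sub>q 1"
    by (simp add: scaleq_inj qq_nonzero)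
  have 3: "m * (X * Y) = X * Y * m"
    using 1 2 by (metis mult_scaleq_left mult_scaleq_right scaleq_cancel(2))
  show ?thesis
    unfolding cayley_hamilton_def m_def[symmetric]
    using 1 3 by (intro conjI) (simp_all add: eq_diff_eq mult_scaleq_left)
qed

lemma scal_commute_qtr: "scal x * A = A * scal x \<Longrightarrow> x * qtr A = qtr A * x"
  by (metis qtr_scal(1,2))

text \<open>The exact defect of cyclicity, found by taking \<open>qtr\<close> of the exchange
  relation; the terms q^-2 qtr (X * Y) cancel because qtr 1 = q + q^-1.\<close>

lemma qtr_swap:
  assumes "exch X Y"
  shows "qtr (Y * X) = inverse qq *\<^sub>q inverse qq *\<^sub>q inverse qq *\<^sub>q inverse qq *\<^sub>q qtr (X * Y) + inverse qq *\<^sub>q (qtr X * qtr Y)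
    - inverse qq *\<^sub>q inverse qq *\<^sub>q inverse qq *\<^sub>q (qtr X * qtr Y)"
  unfolding exchD(1)[OF assms] using scal_commute_qtr[OF exchD(2)[OF assms]]
  by (simp add: qtr_linear qtr_scal scaleq_nf algebra_simps)

text \<open>The exchange relation is used backwards, to express X * W through W * X. After
  multiplication by X^-1 the word W * X * X^-1 collapses, and the one product left is W * X, whose
  trace is given by \<open>qtr_swap\<close>.\<close>

lemma qtr_conj_left:
  assumes "exch X W" "cayley_hamilton X"
  shows "qtr (X * W * qinv X) = qtr W"
proof -
  define x w u where "x = qtr X" "w = qtr W" "u = qtr (X * W)"
  have X: "scal x * X = X * scal x" using assms(2) by (simp add: cayley_hamilton_def x_w_u_def)
  then have XW: "scal x * (X * W) = X * W * scal x"
    using exchD(2)[OF assms(1)] by (metis mult.assoc x_w_u_def(1))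
  note c = scal_commute_qtr[OF exchD(2)[OF assms(1)], folded x_w_u_def] scal_commute_qtr[OF XW, folded x_w_u_def]
  have c': "x * (w * z) = w * (x * z)" for z using c by (metis mult.assoc)
  have "inverse qq *\<^sub>q inverse qq *\<^sub>q (X * W) = inverse qq *\<^sub>q scal w * X + inverse qq *\<^sub>q scal x * W
     + inverse qq *\<^sub>q inverse qq *\<^sub>q inverse qq *\<^sub>q scal u - inverse qq *\<^sub>q inverse qq *\<^sub>q scal (x * w) - W * X"
    using exchD(1)[OF assms(1)] by (simp add: x_w_u_def)
  from arg_cong[OF this, of "\<lambda>A. A * qinv X"]
  have "inverse qq *\<^sub>q inverse qq *\<^sub>q (X * W * qinv X) = - W * (X * qinv X) + inverse qq *\<^sub>q scal w * (X * qinv X)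
     + inverse qq *\<^sub>q scal x * W * qinv X + inverse qq *\<^sub>q inverse qq *\<^sub>q inverse qq *\<^sub>q scal u * qinv X
     - inverse qq *\<^sub>q inverse qq *\<^sub>q scal (x * w) * qinv X"
    by (simp add: scaleq_nf algebra_simps)
  also have "\<dots> = - W + inverse qq *\<^sub>q scal w + inverse qq *\<^sub>q scal x * W * qinv X
     + inverse qq *\<^sub>q inverse qq *\<^sub>q inverse qq *\<^sub>q scal u * qinv X - inverse qq *\<^sub>q inverse qq *\<^sub>q scal (x * w) * qinv X"
    using qinv[OF assms(2)] by simp
  finally have "inverse qq *\<^sub>q inverse qq *\<^sub>q qtr (X * W * qinv X) = qtr (\<dots>)"
    by (simp flip: qtr_linear)
  also have "\<dots> = inverse qq *\<^sub>q inverse qq *\<^sub>q w"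
    unfolding qinv_def
    by (simp add: qtr_linear qtr_scal ring_nf qtr_swap[OF assms(1), folded x_w_u_def]
      x_w_u_def[symmetric] scal_algebra c c')
  finally show ?thesis by (simp add: scaleq_inj qq_nonzero x_w_u_def)
qed

lemma qtr_conj_right:
  assumes "exch W Z" "cayley_hamilton Z"
  shows "qtr (qinv Z * W * Z) = qtr W"
proof -
  define z w u where "z = qtr Z" "w = qtr W" "u = qtr (W * Z)"
  have Z: "scal z * Z = Z * scal z" using assms(2) by (simp add: cayley_hamilton_def z_w_u_def)
  then have WZ: "scal z * (W * Z) = W * Z * scal z"
    using exchD(3)[OF assms(1)] by (metis mult.assoc z_w_u_def(1))
  have Zs: "Z * scal z = scal z * Z" "Z * (scal z * V) = scal z * (Z * V)"
    "Z * scal w = scal w * Z" "Z * (scal w * V) = scal w * (Z * V)" for V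
  proof -
    show 1: "Z * scal z = scal z * Z" "Z * scal w = scal w * Z"
      using Z exchD(2)[OF assms(1)] by (simp_all add: z_w_u_def)
    show "Z * (scal z * V) = scal z * (Z * V)" "Z * (scal w * V) = scal w * (Z * V)"
      using 1 by (metis mult.assoc)+
  qed
  note c = scal_commute_qtr[OF exchD(3)[OF assms(1)], folded z_w_u_def] scal_commute_qtr[OF WZ, folded z_w_u_def]
  have c': "z * (w * y) = w * (z * y)" for y using c by (metis mult.assoc)
  have "inverse qq *\<^sub>q inverse qq *\<^sub>q (W * Z) = inverse qq *\<^sub>q Z * scal w + inverse qq *\<^sub>q scal z * W
     + inverse qq *\<^sub>q inverse qq *\<^sub>q inverse qq *\<^sub>q scal u - inverse qq *\<^sub>q inverse qq *\<^sub>q scal (w * z) - Z * W"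
    using exchD(1,2)[OF assms(1)] by (simp add: z_w_u_def mult_scaleq_left mult_scaleq_right)
  from arg_cong[OF this, of "\<lambda>A. qinv Z * A"]
  have "inverse qq *\<^sub>q inverse qq *\<^sub>q (qinv Z * W * Z) = inverse qq *\<^sub>q (qinv Z * Z) * scal w
     + inverse qq *\<^sub>q qinv Z * scal z * W + inverse qq *\<^sub>q inverse qq *\<^sub>q inverse qq *\<^sub>q qinv Z * scal u
     - inverse qq *\<^sub>q inverse qq *\<^sub>q qinv Z * scal (w * z) - qinv Z * Z * W"
    by (simp add: scaleq_nf algebra_simps)
  also have "\<dots> = inverse qq *\<^sub>q scal w
     + inverse qq *\<^sub>q qinv Z * scal z * W + inverse qq *\<^sub>q inverse qq *\<^sub>q inverse qq *\<^sub>q qinv Z * scal u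
     - inverse qq *\<^sub>q inverse qq *\<^sub>q qinv Z * scal (w * z) - W"
    using qinv[OF assms(2)] by (simp add: mult_scaleq_left)
  finally have "inverse qq *\<^sub>q inverse qq *\<^sub>q qtr (qinv Z * W * Z) = qtr (\<dots>)"
    by (simp flip: qtr_linear)
  also have "\<dots> = inverse qq *\<^sub>q inverse qq *\<^sub>q w"
    unfolding qinv_def
    by (simp add: qtr_linear qtr_scal ring_nf qtr_swap[OF assms(1), folded z_w_u_def]
      z_w_u_def[symmetric] scal_algebra c c' Zs)
  finally show ?thesis by (simp add: scaleq_inj qq_nonzero z_w_u_def)
qed

text \<open>Inserting this for a trace that stands inside a word is the q-analogue of tr A tr B = tr
  AB + tr A B^-1.\<close>

lemma scal_qtr_eq:
  assumes "cayley_hamilton M" "M * N = 1"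
  shows "scal (qtr M) = qq *\<^sub>q M + inverse qq *\<^sub>q N"
proof -
  have "M = M * M * N" using assms(2) by (simp add: mult.assoc)
  also have "\<dots> = inverse qq *\<^sub>q scal (qtr M) * (M * N) - inverse qq *\<^sub>q inverse qq *\<^sub>q N"
    using assms(1)[unfolded cayley_hamilton_def, THEN conjunct1]
    by (simp add: left_diff_distrib mult_scaleq_left mult.assoc)
  finally have "qq *\<^sub>q M = qq *\<^sub>q (inverse qq *\<^sub>q scal (qtr M) * (M * N) - inverse qq *\<^sub>q inverse qq *\<^sub>q N)"
    by simp
  then show ?thesis by (simp add: assms(2) scaleq_nf)
qed

section \<open>Trace identities for three exchanging matrices\<close>

locale qtriple =
  fixes X Y Z :: "'a::cq_algebra mat2"
  assumes CH: "cayley_hamilton X" "cayley_hamilton Y" "cayley_hamilton Z"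
    and exch: "exch X Y" "exch X Z" "exch Y Z" "exch X (Y * Z)"
begin

lemma cent:
  "X * scal (qtr Y) = scal (qtr Y) * X" "X * scal (qtr Z) = scal (qtr Z) * X"
  "Y * scal (qtr Z) = scal (qtr Z) * Y" "Y * scal (qtr X) = scal (qtr X) * Y"
  "Z * scal (qtr X) = scal (qtr X) * Z" "Z * scal (qtr Y) = scal (qtr Y) * Z"
  "X * scal (qtr X) = scal (qtr X) * X" "Y * scal (qtr Y) = scal (qtr Y) * Y"
  "Z * scal (qtr Z) = scal (qtr Z) * Z"
  "X * scal (qtr (Y * Z)) = scal (qtr (Y * Z)) * X"
  using exch CH by (simp_all add: exchD cayley_hamilton_def)

lemma cent':
  "X * (scal (qtr Y) * W) = scal (qtr Y) * (X * W)" "X * (scal (qtr Z) * W) = scal (qtr Z) * (X * W)"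
  "Y * (scal (qtr Z) * W) = scal (qtr Z) * (Y * W)" "Y * (scal (qtr X) * W) = scal (qtr X) * (Y * W)"
  "Z * (scal (qtr X) * W) = scal (qtr X) * (Z * W)" "Z * (scal (qtr Y) * W) = scal (qtr Y) * (Z * W)"
  "X * (scal (qtr X) * W) = scal (qtr X) * (X * W)" "Y * (scal (qtr Y) * W) = scal (qtr Y) * (Y * W)"
  "Z * (scal (qtr Z) * W) = scal (qtr Z) * (Z * W)"
  "X * (scal (qtr (Y * Z)) * W) = scal (qtr (Y * Z)) * (X * W)"
  using cent by (metis mult.assoc)+

lemma square:
  "X * X = inverse qq *\<^sub>q scal (qtr X) * X - inverse qq *\<^sub>q inverse qq *\<^sub>q 1"
  "Y * Y = inverse qq *\<^sub>q scal (qtr Y) * Y - inverse qq *\<^sub>q inverse qq *\<^sub>q 1"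
  "Z * Z = inverse qq *\<^sub>q scal (qtr Z) * Z - inverse qq *\<^sub>q inverse qq *\<^sub>q 1"
  using CH by (simp_all add: cayley_hamilton_def)

lemma square':
  "X * (X * W) = inverse qq *\<^sub>q scal (qtr X) * (X * W) - inverse qq *\<^sub>q inverse qq *\<^sub>q W"
  "Y * (Y * W) = inverse qq *\<^sub>q scal (qtr Y) * (Y * W) - inverse qq *\<^sub>q inverse qq *\<^sub>q W"
  "Z * (Z * W) = inverse qq *\<^sub>q scal (qtr Z) * (Z * W) - inverse qq *\<^sub>q inverse qq *\<^sub>q W"
  using square by (simp_all add: mult.assoc[symmetric] left_diff_distrib mult_scaleq_left)

lemma CH_YZ: "cayley_hamilton (Y * Z)"
  using CH exch by (simp add: cayley_hamilton_mult)

lemma inverses: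
  "Y * qinv Y = 1" "qinv Y * Y = 1" "Z * qinv Z = 1" "qinv Z * Z = 1" "X * qinv X = 1" "qinv X * X = 1"
  using CH by (simp_all add: qinv)

lemma inverses':
  "Y * (qinv Y * W) = W" "qinv Y * (Y * W) = W" "Z * (qinv Z * W) = W" "qinv Z * (Z * W) = W"
  "X * (qinv X * W) = W" "qinv X * (X * W) = W"
  using inverses by (simp_all flip: mult.assoc)

lemma scal_p: "scal (qtr (Y * Z)) = qq *\<^sub>q (Y * Z) + inverse qq *\<^sub>q (qinv Z * qinv Y)"
  by (rule scal_qtr_eq[OF CH_YZ]) (simp add: mult.assoc inverses inverses')

text \<open>The trace of Y * Z commutes with X, so it can enter the word X * Y to the left of Y; in
  \<open>qtr_XY_YZ\<close> it enters to the right of Y. No commutation with Y is available, and the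
  two products of traces resolve into different words, X Y Z Y and X Y Z Y^-1.\<close>

lemma qtr_YZ_XY: "qtr (Y * Z) * qtr (X * Y) = qq *\<^sub>q qtr (X * Y * Z * Y)
    + qtr X * qtr Z - qq *\<^sub>q qtr (X * Z)"
proof -
  have "qtr (Y * Z) * qtr (X * Y) = qtr (X * (scal (qtr (Y * Z)) * Y))"
    by (simp add: cent' flip: qtr_scal(1))
  also have "scal (qtr (Y * Z)) * Y = qq *\<^sub>q (Y * Z * Y) + inverse qq *\<^sub>q qinv Z"
    by (simp add: scal_p ring_nf inverses)
  also have "qtr (X * \<dots>) = qq *\<^sub>q qtr (X * Y * Z * Y)
      + qtr X * qtr Z - qq *\<^sub>q qtr (X * Z)"
    by (simp add: qinv_def qtr_linear qtr_scal ring_nf)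
  finally show ?thesis .
qed

lemma qtr_XY_YZ: "qtr (X * Y) * qtr (Y * Z) = qtr Y * qtr (X * Y * Z) - inverse qq *\<^sub>q qtr (X * Z)
    + qtr X * qtr Z - qq *\<^sub>q qtr (X * Y * Z * qinv Y)"
proof -
  have "qtr (X * Y) * qtr (Y * Z) = qtr (X * (Y * scal (qtr (Y * Z))))"
    by (simp flip: qtr_scal(2) add: mult.assoc)
  also have "Y * scal (qtr (Y * Z)) = qq *\<^sub>q (Y * Y * Z) + inverse qq *\<^sub>q (Y * qinv Z * qinv Y)"
    by (simp add: scal_p ring_nf)
  also have "Y * qinv Z * qinv Y = qq *\<^sub>q scal (qtr Z) - qq *\<^sub>q qq *\<^sub>q (Y * Z * qinv Y)"
    unfolding qinv_def[of Z] by (simp add: ring_nf cent' inverses)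
  also have "qtr (X * (qq *\<^sub>q (Y * Y * Z) + inverse qq *\<^sub>q \<dots>)) =
     qtr Y * qtr (X * Y * Z) - inverse qq *\<^sub>q qtr (X * Z)
    + qtr X * qtr Z - qq *\<^sub>q qtr (X * Y * Z * qinv Y)"
    by (simp add: qtr_linear qtr_scal ring_nf square' cent')
  finally show ?thesis .
qed

lemma qtr_XYZYi: "qtr (X * Y * Z * qinv Y) = qq *\<^sub>q (qtr Y * qtr (X * Y * Z))
   - qq *\<^sub>q qq *\<^sub>q qtr (X * Y * Z * Y)"
  by (simp add: qinv_def qtr_linear qtr_scal ring_nf cent cent')

text \<open>Once Y^-1 is expanded, the word X Y Z Y occurs with coefficient q^2 in both products and
  cancels.\<close>

lemma qtr_qcomm:
  "inverse qq *\<^sub>q (qtr (X * Y) * qtr (Y * Z)) - qq *\<^sub>q (qtr (Y * Z) * qtr (X * Y)) =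
   (inverse qq - qq) *\<^sub>q (qtr X * qtr Z + qtr Y * qtr (X * Y * Z) - (qq + inverse qq) *\<^sub>q qtr (X * Z))"
  unfolding qtr_XY_YZ qtr_YZ_XY qtr_XYZYi
  by (simp add: ring_nf algebra_simps)

lemma qtr_sym:
  "qtr X * qtr Y = qtr Y * qtr X" "qtr X * qtr Z = qtr Z * qtr X" "qtr Y * qtr Z = qtr Z * qtr Y"
  using exch by (auto dest!: exchD(2) scal_commute_qtr)

end

lemma qq_square: "qq * qq \<noteq> 1" "qq * qq \<noteq> - 1"
proof -
  have 1: "qq * qq = Fract [:0, 0, 1:] 1" by (simp add: qq_def)
  have "Fract [:0, 0, 1:] 1 \<noteq> (Fract 1 1 :: cq)" "Fract [:0, 0, 1:] 1 \<noteq> (Fract (- 1) 1 :: cq)"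
    by (subst eq_fract(1); simp add: one_pCons)+
  then show "qq * qq \<noteq> 1" "qq * qq \<noteq> - 1"
    unfolding 1 by (simp_all add: One_fract_def)
qed

lemma qq_minus: "qq - inverse qq \<noteq> 0"
proof
  assume "qq - inverse qq = 0"
  then have "qq = inverse qq" by simp
  then have "qq * qq = inverse qq * qq" by (rule arg_cong)
  then show False using qq_square qq_nonzero by simp
qed

lemma qq_plus: "qq + inverse qq \<noteq> 0"
proof
  assume "qq + inverse qq = 0"
  then have "qq = - inverse qq" by (simp add: eq_neg_iff_add_eq_0)
  then have "qq * qq = - inverse qq * qq" by (rule arg_cong)
  then show False using qq_square qq_nonzero by simp
qed

lemma qq_minus': "inverse qq - qq \<noteq> 0"
  using qq_minus by (simp only: right_minus_eq) simp

lemma scal_commute_mult: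
  "scal a * A = A * scal a \<Longrightarrow> scal a * B = B * scal a \<Longrightarrow> scal a * (A * B) = A * B * scal a"
  by (metis mult.assoc)

text \<open>The first assumption gives Cayley-Hamilton for X Y Z and lets its trace commute with
  that of X Y. The second and third make the conjugations in \<open>qtr_XYZYi_XZ\<close> and
  \<open>qtr_XYZYiXZ\<close> preserve the trace.\<close>

locale qtriple_full = qtriple +
  assumes exch': "exch (X * Y) Z" "exch X (Y * Z * qinv Y * qinv Z)"
    "exch (qinv Y * qinv X * qinv Y * X) Z"
begin

lemma CH_products:
  "cayley_hamilton (X * Y)" "cayley_hamilton (X * Z)" "cayley_hamilton (X * Y * Z)"
  using CH exch exch' by (simp_all add: cayley_hamilton_mult)

lemma qtr_YiXZ: "qtr (qinv Y * X * Z) = qtr (X * Y * Z) - qq *\<^sub>q (qtr X * qtr (Y * Z))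
   - inverse qq *\<^sub>q (qtr (X * Y) * qtr Z) + qtr X * qtr Y * qtr Z"
proof -
  have 1: "Y * (X * Z) = (Y * X) * Z" by (simp add: mult.assoc)
  show ?thesis
    by (simp add: qinv_def qtr_linear qtr_scal ring_nf 1 exchD(1)[OF exch(1)] scal_algebra)
qed

lemma scal_m: "qinv Y * qinv X = qq *\<^sub>q scal (qtr (X * Y)) - qq *\<^sub>q qq *\<^sub>q (X * Y)"
proof -
  have "X * Y * (qinv Y * qinv X) = 1" by (simp add: mult.assoc inverses inverses')
  from scal_qtr_eq[OF CH_products(1) this] show ?thesis
    by (simp add: scaleq_nf)
qed

lemma qtr_YiXiYiX: "qtr (qinv Y * qinv X * qinv Y * X) = - (inverse qq *\<^sub>q (qtr (X * Y) * qtr (X * Y)))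
   + qtr (X * Y) * (qtr X * qtr Y) - qq *\<^sub>q (qtr X * qtr X) + inverse qq *\<^sub>q 1 + qq *\<^sub>q 1"
proof -
  have 1: "qtr (qinv Y * X) = - (inverse qq *\<^sub>q inverse qq *\<^sub>q qtr (X * Y)) + inverse qq *\<^sub>q (qtr X * qtr Y)"
    by (simp add: qinv_def qtr_linear qtr_scal ring_nf qtr_swap[OF exch(1)] qtr_sym)
  have "qtr (qinv Y * qinv X * qinv Y * X) = qq *\<^sub>q (qtr (X * Y) * qtr (qinv Y * X))
     - qq *\<^sub>q qq *\<^sub>q qtr (X * X)"
    by (simp add: scal_m qtr_linear qtr_scal ring_nf inverses')
  also have "\<dots> = - (inverse qq *\<^sub>q (qtr (X * Y) * qtr (X * Y)))
   + qtr (X * Y) * (qtr X * qtr Y) - qq *\<^sub>q (qtr X * qtr X) + inverse qq *\<^sub>q 1 + qq *\<^sub>q 1"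
    by (simp add: 1 square qtr_linear qtr_scal ring_nf)
  finally show ?thesis .
qed

lemma qtr_YZYiZ: "qtr (Y * Z * qinv Y * Z) = qtr Y * qtr Z * qtr (Y * Z) - inverse qq *\<^sub>q (qtr Y * qtr Y)
   - qq *\<^sub>q (qtr (Y * Z) * qtr (Y * Z)) + inverse qq *\<^sub>q 1 + qq *\<^sub>q 1"
proof -
  have 1: "Y * (Z * (Y * Z)) = inverse qq *\<^sub>q scal (qtr (Y * Z)) * (Y * Z) - inverse qq *\<^sub>q inverse qq *\<^sub>q 1"
    using CH_YZ by (simp add: cayley_hamilton_def mult.assoc)
  show ?thesis
    by (simp add: qinv_def qtr_linear qtr_scal ring_nf cent' cent square square' 1)
qed

lemma qtr_YZYiZi: "qtr (Y * Z * qinv Y * qinv Z) = qq *\<^sub>q (qtr Z * qtr Z)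
   - qq *\<^sub>q qq *\<^sub>q qtr (Y * Z * qinv Y * Z)"
proof -
  have 1: "qtr (Y * Z * qinv Y) = qtr Z" by (rule qtr_conj_left) (use CH exch in auto)
  have "scal (qtr Z) * (Y * Z * qinv Y) = Y * Z * qinv Y * scal (qtr Z)"
  proof -
    have "scal (qtr Z) * (scal (qtr Y) * W) = scal (qtr Y) * (scal (qtr Z) * W)" for W
      using qtr_sym(3) by (metis mult.assoc scal_algebra(4))
    then show ?thesis by (simp add: qinv_def ring_nf cent cent')
  qed
  from scal_commute_qtr[OF this]
  have "qtr (Y * Z * qinv Y * scal (qtr Z)) = qtr Z * qtr Z"
    by (simp add: 1 qtr_scal)
  then show ?thesis
    unfolding qinv_def[of Z] by (simp add: right_diff_distrib qtr_linear scaleq_nf)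
qed

text \<open>The prefix X Y Z is replaced by q^-1 qtr (X Y Z) - q^-2 (X Y Z)^-1. In the inverse term
  the outer factors are Z^-1 and Z, and \<open>qtr_conj_right\<close> removes them.\<close>

lemma qtr_XYZYiXZ: "qtr (X * Y * Z * qinv Y * X * Z) =
    inverse qq *\<^sub>q (qtr (X * Y * Z) * qtr (qinv Y * X * Z)) - inverse qq *\<^sub>q inverse qq *\<^sub>q qtr (qinv Y * qinv X * qinv Y * X)"
proof -
  have "X * Y * Z * (qinv Z * qinv Y * qinv X) = 1" by (simp add: mult.assoc inverses inverses')
  from scal_qtr_eq[OF CH_products(3) this]
  have "X * Y * Z = inverse qq *\<^sub>q scal (qtr (X * Y * Z)) - inverse qq *\<^sub>q inverse qq *\<^sub>q (qinv Z * qinv Y * qinv X)"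
    by (simp add: scaleq_nf)
  then have "X * Y * Z * (qinv Y * X * Z) = inverse qq *\<^sub>q scal (qtr (X * Y * Z)) * (qinv Y * X * Z)
    - inverse qq *\<^sub>q inverse qq *\<^sub>q (qinv Z * (qinv Y * qinv X * qinv Y * X) * Z)"
    by (metis (no_types) left_diff_distrib mult.assoc mult_scaleq_left)
  then have "qtr (X * Y * Z * (qinv Y * X * Z)) = inverse qq *\<^sub>q (qtr (X * Y * Z) * qtr (qinv Y * X * Z))
    - inverse qq *\<^sub>q inverse qq *\<^sub>q qtr (qinv Z * (qinv Y * qinv X * qinv Y * X) * Z)"
    by (simp add: qtr_linear qtr_scal mult_scaleq_left)
  also have "qtr (qinv Z * (qinv Y * qinv X * qinv Y * X) * Z) = qtr (qinv Y * qinv X * qinv Y * X)"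
    by (rule qtr_conj_right) (use CH exch' in auto)
  finally show ?thesis by (simp add: mult.assoc)
qed

text \<open>Resolving qtr (X * Z), the inverse part Z^-1 X^-1 ends the word with X^-1, so that X
  conjugates the commutator Y Z Y^-1 Z^-1.\<close>

lemma qtr_XYZYi_XZ: "qtr (X * Y * Z * qinv Y) * qtr (X * Z) = qq *\<^sub>q qtr (X * Y * Z * qinv Y * X * Z)
    + inverse qq *\<^sub>q qtr (Y * Z * qinv Y * qinv Z)"
proof -
  have "X * Z * (qinv Z * qinv X) = 1" by (simp add: mult.assoc inverses inverses')
  note v = scal_qtr_eq[OF CH_products(2) this]
  have "qtr (X * Y * Z * qinv Y) * qtr (X * Z) = qtr (X * Y * Z * qinv Y * scal (qtr (X * Z)))"
    by (simp add: qtr_scal)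
  also have "\<dots> = qq *\<^sub>q qtr (X * Y * Z * qinv Y * X * Z)
    + inverse qq *\<^sub>q qtr (X * (Y * Z * qinv Y * qinv Z) * qinv X)"
    by (simp add: v ring_nf qtr_linear)
  also have "qtr (X * (Y * Z * qinv Y * qinv Z) * qinv X) = qtr (Y * Z * qinv Y * qinv Z)"
    by (rule qtr_conj_left) (use CH exch' in auto)
  finally show ?thesis .
qed

lemma qtr_central:
  assumes "\<And>W. W \<in> {X, Y, Z} \<Longrightarrow> scal a * W = W * scal a"
  shows "a * qtr (X * Y) = qtr (X * Y) * a" "a * qtr (Y * Z) = qtr (Y * Z) * a"
    "a * qtr (X * Z) = qtr (X * Z) * a" "a * qtr (X * Y * Z) = qtr (X * Y * Z) * a"
  using assms by (auto intro!: scal_commute_qtr scal_commute_mult)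

text \<open>X Z is not a consecutive part of the word X Y Z, so its trace is not reached by the
  argument for X Y and Y Z. But \<open>qtr_qcomm\<close> writes (q + q^-1) qtr (X * Z) as a
  polynomial in the remaining traces, all of which commute with qtr (X * Y * Z).\<close>

lemma qtr_n_comm:
  "qtr (X * Y * Z) * qtr (X * Y) = qtr (X * Y) * qtr (X * Y * Z)" (is "?n * ?m = _")
  "qtr (X * Y * Z) * qtr (Y * Z) = qtr (Y * Z) * qtr (X * Y * Z)" (is "_ * ?p = _")
  "qtr (X * Y * Z) * qtr (X * Z) = qtr (X * Z) * qtr (X * Y * Z)" (is "_ * ?v = _")
proof -
  have "scal ?m * (X * Y * Z) = X * Y * Z * scal ?m"
    using CH_products(1) exchD(2)[OF exch'(1)] unfolding cayley_hamilton_def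
    by (intro scal_commute_mult[of ?m "X * Y" Z]) auto
  from scal_commute_qtr[OF this] show m: "?n * ?m = ?m * ?n" ..
  have "scal ?p * (X * Y * Z) = X * Y * Z * scal ?p"
    using CH_YZ exchD(3)[OF exch(4)] unfolding cayley_hamilton_def mult.assoc[of X Y Z]
    by (intro scal_commute_mult[of ?p X "Y * Z"]) auto
  from scal_commute_qtr[OF this] show p: "?n * ?p = ?p * ?n" ..
  have x: "scal (qtr X) * W = W * scal (qtr X)" if "W \<in> {X, Y, Z}" for W
    using that cent by auto
  have y: "scal (qtr Y) * W = W * scal (qtr Y)" if "W \<in> {X, Y, Z}" for W
    using that cent by auto
  have z: "scal (qtr Z) * W = W * scal (qtr Z)" if "W \<in> {X, Y, Z}" for W
    using that cent by auto
  note c = qtr_central(4)[OF x] qtr_central(4)[OF y] qtr_central(4)[OF z]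
  let ?h = "inverse (inverse qq - qq)" and ?t = "inverse (qq + inverse qq)"
  define u where "u = inverse qq *\<^sub>q (?m * ?p) - qq *\<^sub>q (?p * ?m)"
  define r where "r = qtr X * qtr Z + qtr Y * ?n"
  have mult: "a * b * ?n = ?n * (a * b)" if "a * ?n = ?n * a" "b * ?n = ?n * b" for a b
    using that by (metis mult.assoc)
  have u: "u * ?n = ?n * u"
    unfolding u_def using mult[OF m[symmetric] p[symmetric]] mult[OF p[symmetric] m[symmetric]]
    by (simp only: left_diff_distrib right_diff_distrib mult_scaleq_left mult_scaleq_right)
  have r: "r * ?n = ?n * r"
    unfolding r_def using mult[OF c(1,3)] mult[OF c(2) refl]
    by (simp only: distrib_left distrib_right)
  have "u = (inverse qq - qq) *\<^sub>q (r - (qq + inverse qq) *\<^sub>q ?v)"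
    using qtr_qcomm unfolding u_def r_def .
  then have "?h *\<^sub>q u = r - (qq + inverse qq) *\<^sub>q ?v"
    by (simp only: scaleq_scaleq left_inverse[OF qq_minus'] scaleq_one)
  then have "?t *\<^sub>q (r - ?h *\<^sub>q u) = ?t *\<^sub>q (qq + inverse qq) *\<^sub>q ?v"
    by simp
  then have "?v = ?t *\<^sub>q (r - ?h *\<^sub>q u)"
    by (simp only: scaleq_scaleq left_inverse[OF qq_plus] scaleq_one)
  then show "?n * ?v = ?v * ?n"
    by (simp only: left_diff_distrib right_diff_distrib cq.scale_right_diff_distrib mult_scaleq_left mult_scaleq_right u r)
qed

lemma qtr_comm:
  "qtr X * qtr Y = qtr Y * qtr X" "qtr X * qtr Z = qtr Z * qtr X" "qtr Y * qtr Z = qtr Z * qtr Y"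
  "A \<in> {X, Y, Z, X * Y * Z} \<Longrightarrow> W \<in> {X * Y, Y * Z, X * Z, X * Y * Z} \<Longrightarrow> qtr A * qtr W = qtr W * qtr A"
proof -
  show "qtr X * qtr Y = qtr Y * qtr X" "qtr X * qtr Z = qtr Z * qtr X" "qtr Y * qtr Z = qtr Z * qtr Y"
    by (fact qtr_sym)+
  assume A: "A \<in> {X, Y, Z, X * Y * Z}" and W: "W \<in> {X * Y, Y * Z, X * Z, X * Y * Z}"
  show "qtr A * qtr W = qtr W * qtr A"
  proof (cases "A = X * Y * Z")
    case True
    then show ?thesis using W qtr_n_comm by auto
  next
    case False
    then have "scal (qtr A) * V = V * scal (qtr A)" if "V \<in> {X, Y, Z}" for V
      using A that cent by auto
    from qtr_central[OF this] show ?thesis using W by auto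
  qed
qed

text \<open>By \<open>qtr_XY_YZ\<close> the triple product reduces to \<open>qtr (X Y Z Y\<^sup>-\<^sup>1) qtr (X Z)\<close>, a product of two
  traces differing by a braiding of \<open>Y\<close> and \<open>Z\<close>; replacing \<open>qtr (X Z)\<close> by
  \<open>q X Z + q\<^sup>-\<^sup>1 (X Z)\<^sup>-\<^sup>1\<close> turns it into traces of single words.\<close>

lemma qtr_Omega_rev:
  fixes x y z m p v n
  defines "x \<equiv> qtr X" and "y \<equiv> qtr Y" and "z \<equiv> qtr Z" and "m \<equiv> qtr (X * Y)"
    and "p \<equiv> qtr (Y * Z)" and "v \<equiv> qtr (X * Z)" and "n \<equiv> qtr (X * Y * Z)"
  shows "inverse qq *\<^sub>q (m * p * v) + (inverse qq *\<^sub>q inverse qq *\<^sub>q (m * m) + qq *\<^sub>q qq *\<^sub>q (p * p)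
    + inverse qq *\<^sub>q inverse qq *\<^sub>q (v * v) + n * n + x * x + y * y + z * z)
    - inverse qq *\<^sub>q (m * (x * y + z * n)) - qq *\<^sub>q (p * (y * z + x * n))
    - inverse qq *\<^sub>q (v * (x * z + y * n)) + x * y * z * n
    - (inverse qq *\<^sub>q inverse qq *\<^sub>q 1 + 1 + 1 + qq *\<^sub>q qq *\<^sub>q 1) = 0"
proof -
  note d = x_def y_def z_def m_def p_def v_def n_def
  have c: "y * x = x * y" "z * x = x * z" "z * y = y * z"
    "x * m = m * x" "x * p = p * x" "x * v = v * x" "n * x = x * n"
    "y * m = m * y" "y * p = p * y" "y * v = v * y" "n * y = y * n"
    "z * m = m * z" "z * p = p * z" "z * v = v * z" "n * z = z * n"
    "n * m = m * n" "n * p = p * n" "n * v = v * n"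
    unfolding d by (rule qtr_comm qtr_comm[symmetric]; simp)+
  have c': "y * (x * w) = x * (y * w)" "z * (x * w) = x * (z * w)" "z * (y * w) = y * (z * w)"
    "x * (m * w) = m * (x * w)" "x * (p * w) = p * (x * w)" "x * (v * w) = v * (x * w)"
    "n * (x * w) = x * (n * w)"
    "y * (m * w) = m * (y * w)" "y * (p * w) = p * (y * w)" "y * (v * w) = v * (y * w)"
    "n * (y * w) = y * (n * w)"
    "z * (m * w) = m * (z * w)" "z * (p * w) = p * (z * w)" "z * (v * w) = v * (z * w)"
    "n * (z * w) = z * (n * w)"
    "n * (m * w) = m * (n * w)" "n * (p * w) = p * (n * w)" "n * (v * w) = v * (n * w)" for w
    using c by (metis mult.assoc)+
  have 1: "m * p * v = y * n * v - inverse qq *\<^sub>q (v * v) + x * z * v - qq *\<^sub>q (qtr (X * Y * Z * qinv Y) * v)"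
    unfolding d qtr_XY_YZ by (simp add: ring_nf)
  have 2: "qtr (X * Y * Z * qinv Y) * v = qq *\<^sub>q (inverse qq *\<^sub>q (n * (n - qq *\<^sub>q (x * p)
   - inverse qq *\<^sub>q (m * z) + x * y * z)) - inverse qq *\<^sub>q inverse qq *\<^sub>q (- (inverse qq *\<^sub>q (m * m))
   + m * (x * y) - qq *\<^sub>q (x * x) + inverse qq *\<^sub>q 1 + qq *\<^sub>q 1))
   + inverse qq *\<^sub>q (qq *\<^sub>q (z * z)
   - qq *\<^sub>q qq *\<^sub>q (y * z * p - inverse qq *\<^sub>q (y * y)
   - qq *\<^sub>q (p * p) + inverse qq *\<^sub>q 1 + qq *\<^sub>q 1))"
    unfolding d qtr_XYZYi_XZ qtr_XYZYiXZ qtr_YZYiZi qtr_YZYiZ qtr_YiXZ qtr_YiXiYiX ..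
  show ?thesis
    unfolding 1 2 by (simp add: ring_nf algebra_simps c c')
qed

end

section \<open>Matrices dressed by upper triangular L-operators\<close>

text \<open>The relation between \<open>X\<close> and the upper triangular \<open>L\<close>-operator with entries \<open>k\<close>, \<open>(q - q\<^sup>-\<^sup>1) f\<close>, \<open>ki\<close>
  which says that the entries of \<open>X\<close> span an adjoint submodule for the Borel subalgebra.\<close>

definition dressed :: "'a::cq_algebra \<Rightarrow> 'a \<Rightarrow> 'a \<Rightarrow> 'a mat2 \<Rightarrow> bool" where
  "dressed k ki f X \<longleftrightarrow>
     k * m11 X = m11 X * k \<and> k * m12 X = inverse qq *\<^sub>q (m12 X * k) \<and>
     k * m21 X = qq *\<^sub>q (m21 X * k) \<and> k * m22 X = m22 X * k \<and>
     f * m11 X = m11 X * f + inverse qq *\<^sub>q (m12 X * ki) \<and>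
     f * m12 X = inverse qq *\<^sub>q (m12 X * f) \<and>
     f * m21 X = qq *\<^sub>q (m21 X * f) - m11 X * ki + m22 X * ki \<and>
     f * m22 X = m22 X * f - qq *\<^sub>q (m12 X * ki)"

definition Lplus :: "'a::cq_algebra \<Rightarrow> 'a \<Rightarrow> 'a \<Rightarrow> 'a mat2" where
  "Lplus k ki f = Mat2 k (qq *\<^sub>q f - inverse qq *\<^sub>q f) 0 ki"

text \<open>The corner is - ki (q - q^-1) f k, where moving ki past f contributes a factor
  q.\<close>

definition Lplus_inv :: "'a::cq_algebra \<Rightarrow> 'a \<Rightarrow> 'a \<Rightarrow> 'a mat2" where
  "Lplus_inv k ki f = Mat2 ki (f - qq *\<^sub>q qq *\<^sub>q f) 0 k"

definition borel :: "'a::cq_algebra \<Rightarrow> 'a \<Rightarrow> 'a \<Rightarrow> bool" where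
  "borel k ki f \<longleftrightarrow> k * ki = 1 \<and> ki * k = 1 \<and> k * f = inverse qq *\<^sub>q (f * k)"

lemma mult_assoc_rule: "a * b = c \<Longrightarrow> a * (b * z) = c * (z :: 'a::cq_algebra)"
  by (simp flip: mult.assoc)

lemma ki_rule:
  assumes "k * ki = 1" "ki * k = (1 :: 'a::cq_algebra)" "k * x = c *\<^sub>q (x * k)" "c \<noteq> 0"
  shows "ki * x = inverse c *\<^sub>q (x * ki)"
proof -
  have "ki * x = ki * x * k * ki" by (simp add: mult.assoc assms)
  also have "\<dots> = ki * (inverse c *\<^sub>q (k * x)) * ki"
    by (simp add: assms(3,4) scaleq_scaleq scaleq_one mult.assoc)
  also have "\<dots> = inverse c *\<^sub>q ((ki * k) * x * ki)" by (simp only: mult_scaleq_left mult_scaleq_right mult.assoc)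
  finally show ?thesis by (simp add: assms)
qed

lemma borelD:
  assumes "borel k ki f"
  shows "k * ki = 1" "ki * k = 1" "k * f = inverse qq *\<^sub>q (f * k)" "ki * f = qq *\<^sub>q (f * ki)"
  using assms ki_rule[of k ki f "inverse qq"] by (auto simp: borel_def qq_nonzero)

lemma Lplus_inverse:
  assumes "borel k ki f"
  shows "Lplus k ki f * Lplus_inv k ki f = 1" "Lplus_inv k ki f * Lplus k ki f = 1"
  by (simp_all add: Lplus_def Lplus_inv_def mat2_defs ring_nf borelD[OF assms])

lemma dressedD:
  assumes "dressed k ki f (Mat2 a b c d)" "borel k ki f"
  shows "k * a = a * k" "k * b = inverse qq *\<^sub>q (b * k)" "k * c = qq *\<^sub>q (c * k)" "k * d = d * k"
    "ki * a = a * ki" "ki * b = qq *\<^sub>q (b * ki)" "ki * c = inverse qq *\<^sub>q (c * ki)" "ki * d = d * ki"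
    "f * a = a * f + inverse qq *\<^sub>q (b * ki)" "f * b = inverse qq *\<^sub>q (b * f)"
    "f * c = qq *\<^sub>q (c * f) - a * ki + d * ki" "f * d = d * f - qq *\<^sub>q (b * ki)"
proof -
  show 1: "k * a = a * k" "k * b = inverse qq *\<^sub>q (b * k)" "k * c = qq *\<^sub>q (c * k)" "k * d = d * k"
    "f * a = a * f + inverse qq *\<^sub>q (b * ki)" "f * b = inverse qq *\<^sub>q (b * f)"
    "f * c = qq *\<^sub>q (c * f) - a * ki + d * ki" "f * d = d * f - qq *\<^sub>q (b * ki)"
    using assms(1) by (auto simp: dressed_def)
  note r = ki_rule[OF borelD(1,2)[OF assms(2)]]
  show "ki * a = a * ki" "ki * b = qq *\<^sub>q (b * ki)" "ki * c = inverse qq *\<^sub>q (c * ki)" "ki * d = d * ki"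
    using r[of a 1] r[of d 1] r[of b "inverse qq"] r[of c qq] 1 by (simp_all add: scaleq_one qq_nonzero)
qed

text \<open>On the matrix, k acts by the automorphism D that scales \<open>m12\<close> by q^-1 and
  \<open>m21\<close> by q. The element f acts by D together with the term D(X) N - N D^-1(X) times
  ki, where N is the elementary matrix with its 1 in position 21. This is a skew derivation, so both
  actions respect products.\<close>

lemma dressed_mult:
  assumes "borel k ki f" "dressed k ki f X" "dressed k ki f Y"
  shows "dressed k ki f (X * Y)"
proof -
  obtain a b c d where X: "X = Mat2 a b c d" by (cases X)
  obtain a' b' c' d' where Y: "Y = Mat2 a' b' c' d'" by (cases Y)
  note r = dressedD[OF assms(2)[unfolded X] assms(1)] dressedD[OF assms(3)[unfolded Y] assms(1)]
  show ?thesis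
    unfolding dressed_def X Y by (simp add: mat2_defs ring_nf r r[THEN mult_assoc_rule])
qed

lemma dressed_linear:
  assumes "dressed k ki f X" "dressed k ki f Y"
  shows "dressed k ki f (X + Y)" "dressed k ki f (X - Y)" "dressed k ki f (r *\<^sub>q X)"
proof -
  obtain a b c d where X: "X = Mat2 a b c d" by (cases X)
  obtain a' b' c' d' where Y: "Y = Mat2 a' b' c' d'" by (cases Y)
  show "dressed k ki f (X + Y)" "dressed k ki f (X - Y)" "dressed k ki f (r *\<^sub>q X)"
    using assms unfolding dressed_def X Y
    by (simp_all add: mat2_defs ring_nf cq.scale_left_commute[of r])
qed

lemma dressed_scal: "k * x = x * k \<Longrightarrow> f * x = x * f \<Longrightarrow> dressed k ki f (scal x)"
  by (simp add: dressed_def scal_def)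

text \<open>The weights q and q^-1 in \<open>qtr\<close> are those for which the two multiples of
  m12 X * ki cancel.\<close>

lemma dressed_qtr:
  assumes "borel k ki f" "dressed k ki f X"
  shows "k * qtr X = qtr X * k" "f * qtr X = qtr X * f"
  using assms(2) by (simp_all add: dressed_def qtr_def ring_nf)

definition entries_commute :: "'a::cq_algebra \<Rightarrow> 'a mat2 \<Rightarrow> bool" where
  "entries_commute x A \<longleftrightarrow> m11 A * x = x * m11 A \<and> m12 A * x = x * m12 A \<and>
     m21 A * x = x * m21 A \<and> m22 A * x = x * m22 A"

text \<open>The origin of the exchange relation. The entries of Y commute with those of X and of the
  L-operator, so beyond the Borel relations everything comes from moving L^+ and its inverse past X,
  which \<open>dressed\<close> describes.\<close>

lemma exch_dressed:
  assumes "borel k ki f" "dressed k ki f X"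
    and "entries_commute k Y" "entries_commute ki Y" "entries_commute f Y"
    and "entries_commute (m11 X) Y" "entries_commute (m12 X) Y" "entries_commute (m21 X) Y" "entries_commute (m22 X) Y"
  shows "exch (Lplus k ki f * Y * Lplus_inv k ki f) X"
proof -
  obtain a b c d where X: "X = Mat2 a b c d" by (cases X)
  obtain a' b' c' d' where Y: "Y = Mat2 a' b' c' d'" by (cases Y)
  note r = dressedD[OF assms(2)[unfolded X] assms(1)] borelD[OF assms(1)]
    assms(3-)[unfolded entries_commute_def X Y mat2.sel, THEN conjunct1]
    assms(3-)[unfolded entries_commute_def X Y mat2.sel, THEN conjunct2, THEN conjunct1]
    assms(3-)[unfolded entries_commute_def X Y mat2.sel, THEN conjunct2, THEN conjunct2, THEN conjunct1]
    assms(3-)[unfolded entries_commute_def X Y mat2.sel, THEN conjunct2, THEN conjunct2, THEN conjunct2]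
  show ?thesis
    unfolding exch_def X Y Lplus_def Lplus_inv_def qtr_def
    by (simp add: mat2_defs scal_def ring_nf algebra_simps r r[THEN mult_assoc_rule])
qed

definition Lminus_inv :: "'a::cq_algebra \<Rightarrow> 'a \<Rightarrow> 'a \<Rightarrow> 'a mat2" where
  "Lminus_inv k ki e = Mat2 k 0 (inverse qq *\<^sub>q e) ki"

lemma dressed_L:
  assumes "borel k ki f" "borel K Ki F" "K * E = qq *\<^sub>q (E * K)" "E * F = F * E + K * K - Ki * Ki"
    and c: "\<And>x y. x \<in> {K, Ki, F, E} \<Longrightarrow> y \<in> {k, ki, f} \<Longrightarrow> x * y = y * x"
  shows "dressed (k * K) (ki * Ki) (f * Ki + k * F)
    (Lplus k ki f * (Lplus K Ki F * Lminus_inv K Ki E) * Lplus_inv k ki f)"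
proof -
  have "x * k = k * x" "x * ki = ki * x" "x * f = f * x" if "x \<in> {K, Ki, F, E}" for x
    using c[OF that] by auto
  note c = this[OF insertI1] this[OF insertI2[OF insertI1]]
    this[OF insertI2[OF insertI2[OF insertI1]]] this[OF insertI2[OF insertI2[OF insertI2[OF insertI1]]]]
  note b = borelD[OF assms(1)] borelD[OF assms(2)]
  note r = c b assms(3,4) ki_rule[OF b(5,6) assms(3) qq_nonzero]
  show ?thesis
    unfolding dressed_def
    by (simp add: Lplus_def Lminus_inv_def Lplus_inv_def mat2_defs ring_nf r r[THEN mult_assoc_rule])
qed

lemma cayley_hamilton_L:
  assumes "borel K Ki F" "K * E = qq *\<^sub>q (E * K)" "E * F = F * E + K * K - Ki * Ki"
  shows "cayley_hamilton (Lplus K Ki F * Lminus_inv K Ki E)"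
proof -
  note b = borelD[OF assms(1)]
  note r = b assms(2,3) ki_rule[OF b(1,2) assms(2) qq_nonzero]
  show ?thesis
    unfolding cayley_hamilton_def
    by (simp add: Lplus_def Lminus_inv_def mat2_defs ring_nf scal_def qtr_def r r[THEN mult_assoc_rule])
qed

section \<open>Commuting copies of the quantum group\<close>

text \<open>Here \<open>E\<close> is the usual generator rescaled by \<open>q - q\<^sup>-\<^sup>1\<close>, which removes the denominator.\<close>

locale uq_family =
  fixes K Ki E F :: "nat \<Rightarrow> 'a::cq_algebra"
  assumes inv: "K i * Ki i = 1" "Ki i * K i = 1"
    and KE: "K i * E i = qq *\<^sub>q (E i * K i)" and KF: "K i * F i = inverse qq *\<^sub>q (F i * K i)"
    and EF: "E i * F i = F i * E i + K i * K i - Ki i * Ki i"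
    and slots_commute: "i \<noteq> j \<Longrightarrow> x \<in> {K i, Ki i, E i, F i} \<Longrightarrow> y \<in> {K j, Ki j, E j, F j} \<Longrightarrow> x * y = y * x"
begin

definition cent :: "nat set \<Rightarrow> 'a set" where
  "cent I = {a. \<forall>i\<in>I. \<forall>x\<in>{K i, Ki i, E i, F i}. a * x = x * a}"

text \<open>The bicommutant stands in for the subalgebra generated by the copies in \<open>I\<close>.\<close>

definition loc :: "nat set \<Rightarrow> 'a set" where
  "loc I = {a. \<forall>b\<in>cent I. a * b = b * a}"

lemma loc_closed:
  "1 \<in> loc I" "0 \<in> loc I"
  "a \<in> loc I \<Longrightarrow> b \<in> loc I \<Longrightarrow> a + b \<in> loc I"
  "a \<in> loc I \<Longrightarrow> b \<in> loc I \<Longrightarrow> a - b \<in> loc I"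
  "a \<in> loc I \<Longrightarrow> b \<in> loc I \<Longrightarrow> a * b \<in> loc I"
  "a \<in> loc I \<Longrightarrow> c *\<^sub>q a \<in> loc I"
  by (simp_all add: loc_def ring_nf) (metis mult.assoc)

lemma loc_gens: "i \<in> I \<Longrightarrow> K i \<in> loc I" "i \<in> I \<Longrightarrow> Ki i \<in> loc I" "i \<in> I \<Longrightarrow> E i \<in> loc I" "i \<in> I \<Longrightarrow> F i \<in> loc I"
  by (auto simp: loc_def cent_def)

lemma loc_mono: "I \<subseteq> J \<Longrightarrow> loc I \<subseteq> loc J"
  by (auto simp: loc_def cent_def)

text \<open>The generators of the copies in I lie in \<open>cent J\<close>, hence commute with b.
  This puts b into \<open>cent I\<close>, with which a commutes.\<close>

lemma loc_commute:
  assumes "a \<in> loc I" "b \<in> loc J" "I \<inter> J = {}"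
  shows "a * b = b * a"
proof -
  have "x \<in> cent J" if "i \<in> I" "x \<in> {K i, Ki i, E i, F i}" for i x
  proof -
    have "i \<noteq> j" if "j \<in> J" for j using that \<open>i \<in> I\<close> assms(3) by auto
    then show ?thesis unfolding cent_def using slots_commute that(2) by blast
  qed
  then have "b \<in> cent I"
    using assms(2) unfolding cent_def[of I] loc_def by blast
  then show ?thesis using assms(1) by (auto simp: loc_def)
qed

definition mat_loc :: "nat set \<Rightarrow> 'a mat2 set" where
  "mat_loc I = {A. m11 A \<in> loc I \<and> m12 A \<in> loc I \<and> m21 A \<in> loc I \<and> m22 A \<in> loc I}"

lemma mat_loc_closed:
  "1 \<in> mat_loc I"
  "A \<in> mat_loc I \<Longrightarrow> B \<in> mat_loc I \<Longrightarrow> A + B \<in> mat_loc I"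
  "A \<in> mat_loc I \<Longrightarrow> B \<in> mat_loc I \<Longrightarrow> A - B \<in> mat_loc I"
  "A \<in> mat_loc I \<Longrightarrow> B \<in> mat_loc I \<Longrightarrow> A * B \<in> mat_loc I"
  "A \<in> mat_loc I \<Longrightarrow> c *\<^sub>q A \<in> mat_loc I"
  "x \<in> loc I \<Longrightarrow> scal x \<in> mat_loc I"
  "A \<in> mat_loc I \<Longrightarrow> qtr A \<in> loc I"
  by (simp_all add: mat_loc_def mat2_defs loc_closed scal_def qtr_def)

lemma mat_loc_mono: "I \<subseteq> J \<Longrightarrow> A \<in> mat_loc I \<Longrightarrow> A \<in> mat_loc J"
  using loc_mono by (auto simp: mat_loc_def)

lemma entries_commute_loc:
  "A \<in> mat_loc I \<Longrightarrow> x \<in> loc J \<Longrightarrow> I \<inter> J = {} \<Longrightarrow> entries_commute x A"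
  by (auto simp: entries_commute_def mat_loc_def intro: loc_commute)

text \<open>Together with \<open>kiT\<close>, \<open>fT\<close> and \<open>eT\<close>: the iterated
  coproducts of the generators in the d copies i, ..., i + d - 1, built by appending the last copy.
  For d = 0 they are the counit values.\<close>

primrec kT :: "nat \<Rightarrow> nat \<Rightarrow> 'a" where
  "kT i 0 = 1" | "kT i (Suc d) = kT i d * K (i + d)"

primrec kiT :: "nat \<Rightarrow> nat \<Rightarrow> 'a" where
  "kiT i 0 = 1" | "kiT i (Suc d) = kiT i d * Ki (i + d)"

primrec fT :: "nat \<Rightarrow> nat \<Rightarrow> 'a" where
  "fT i 0 = 0" | "fT i (Suc d) = fT i d * Ki (i + d) + kT i d * F (i + d)"

primrec eT :: "nat \<Rightarrow> nat \<Rightarrow> 'a" where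
  "eT i 0 = 0" | "eT i (Suc d) = eT i d * Ki (i + d) + kT i d * E (i + d)"

lemma T_loc: "kT i d \<in> loc {i..<i+d}" "kiT i d \<in> loc {i..<i+d}" "fT i d \<in> loc {i..<i+d}" "eT i d \<in> loc {i..<i+d}"
proof -
  have "kT i d \<in> loc {i..<i+d} \<and> kiT i d \<in> loc {i..<i+d} \<and> fT i d \<in> loc {i..<i+d} \<and> eT i d \<in> loc {i..<i+d}"
  proof (induction d)
    case 0
    then show ?case by (simp add: loc_closed)
  next
    case (Suc d)
    have "loc {i..<i+d} \<subseteq> loc {i..<i+Suc d}" by (rule loc_mono) auto
    with Suc have "kT i d \<in> loc {i..<i+Suc d}" "kiT i d \<in> loc {i..<i+Suc d}"
      "fT i d \<in> loc {i..<i+Suc d}" "eT i d \<in> loc {i..<i+Suc d}" by blast+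
    then show ?case by (simp add: loc_closed loc_gens)
  qed
  then show "kT i d \<in> loc {i..<i+d}" "kiT i d \<in> loc {i..<i+d}" "fT i d \<in> loc {i..<i+d}" "eT i d \<in> loc {i..<i+d}"
    by auto
qed

lemma T_commute:
  assumes "x \<in> {K (i+d), Ki (i+d), E (i+d), F (i+d)}"
  shows "x * kT i d = kT i d * x" "x * kiT i d = kiT i d * x" "x * fT i d = fT i d * x" "x * eT i d = eT i d * x"
proof -
  have "x \<in> loc {i+d}" using assms loc_gens by auto
  then show "x * kT i d = kT i d * x" "x * kiT i d = kiT i d * x" "x * fT i d = fT i d * x" "x * eT i d = eT i d * x"
    by - (rule loc_commute, assumption, rule T_loc, simp)+
qed

lemmas T_commute' = T_commute[OF insertI1] T_commute[OF insertI2[OF insertI1]]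
  T_commute[OF insertI2[OF insertI2[OF insertI1]]] T_commute[OF insertI2[OF insertI2[OF insertI2[OF insertI1]]]]

lemma borel_slot: "borel (K i) (Ki i) (F i)"
  by (simp add: borel_def inv KF)

lemma borel_T: "borel (kT i d) (kiT i d) (fT i d)"
proof (induction d)
  case 0
  then show ?case by (simp add: borel_def)
next
  case (Suc d)
  note r = borelD[OF Suc] borelD[OF borel_slot[of "i+d"]] T_commute'
  show ?case by (simp add: borel_def ring_nf r r[THEN mult_assoc_rule])
qed

definition T :: "nat \<Rightarrow> nat \<Rightarrow> 'a mat2" where "T i d = Lplus (kT i d) (kiT i d) (fT i d)"
definition Ti :: "nat \<Rightarrow> nat \<Rightarrow> 'a mat2" where "Ti i d = Lplus_inv (kT i d) (kiT i d) (fT i d)"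
definition N :: "nat \<Rightarrow> nat \<Rightarrow> 'a mat2" where "N i d = Lminus_inv (kT i d) (kiT i d) (eT i d)"
definition L :: "nat \<Rightarrow> 'a mat2" where "L i = Lplus (K i) (Ki i) (F i) * Lminus_inv (K i) (Ki i) (E i)"

lemma T_0: "T i 0 = 1" "Ti i 0 = 1" "N i 0 = 1"
  by (simp_all add: T_def Ti_def N_def Lplus_def Lplus_inv_def Lminus_inv_def mat2_defs)

lemma T_inverse: "T i d * Ti i d = 1" "Ti i d * T i d = 1"
  by (simp_all add: T_def Ti_def Lplus_inverse borel_T)

lemma T_Suc: "T i (Suc d) = T i d * Lplus (K (i+d)) (Ki (i+d)) (F (i+d))"
  by (simp add: T_def Lplus_def mat2_defs ring_nf)

text \<open>The order is opposite to that in \<open>T_Suc\<close>. Hence T * N is nested, with the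
  newest L-operator in the middle.\<close>

lemma N_Suc: "N i (Suc d) = Lminus_inv (K (i+d)) (Ki (i+d)) (E (i+d)) * N i d"
  by (simp add: N_def Lminus_inv_def mat2_defs ring_nf T_commute')

lemma T_add: "T i (d + d') = T i d * T (i + d) d'"
  by (induction d') (simp_all add: T_0 T_Suc add.assoc mult.assoc)

lemma mat_loc_T: "T i d \<in> mat_loc {i..<i+d}" "Ti i d \<in> mat_loc {i..<i+d}" "N i d \<in> mat_loc {i..<i+d}"
  using T_loc by (auto simp: mat_loc_def T_def Ti_def N_def Lplus_def Lplus_inv_def Lminus_inv_def intro!: loc_closed)

lemma mat_loc_L: "L i \<in> mat_loc {i}"
  unfolding L_def by (intro mat_loc_closed)
    (auto simp: mat_loc_def Lplus_def Lminus_inv_def intro!: loc_closed loc_gens)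

text \<open>With \<open>L j = L\<^sup>+ (L\<^sup>-)\<^sup>-\<^sup>1\<close> in the \<open>j\<close>-th copy, the conjugating \<open>L\<^sup>+\<close>-factors telescope, so that
  \<open>M j \<dots> M i\<close> is conjugate to \<open>L\<^sup>+ (L\<^sup>-)\<^sup>-\<^sup>1\<close> for the coproduct in the copies \<open>i, \<dots>, j\<close>.\<close>

definition M :: "nat \<Rightarrow> 'a mat2" where "M j = T 0 j * L j * Ti 0 j"

text \<open>The corner of L^+ enters both diagonal entries multiplied by m21 W; after reordering,
  the weights q and q^-1 make the two terms cancel.\<close>

lemma qtr_T_conj:
  assumes "W \<in> mat_loc J" "{i..<i+d} \<inter> J = {}"
  shows "qtr (T i d * W * Ti i d) = qtr W"
proof -
  obtain a b c e where W: "W = Mat2 a b c e" by (cases W)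
  have l: "a \<in> loc J" "b \<in> loc J" "c \<in> loc J" "e \<in> loc J" using assms(1) by (simp_all add: mat_loc_def W)
  have *: "x * y = y * x" if "x \<in> {a,b,c,e}" "y \<in> loc {i..<i+d}" for x y
    using that l loc_commute assms(2) by blast
  have c: "x * kT i d = kT i d * x" "x * kiT i d = kiT i d * x" "x * fT i d = fT i d * x"
    if "x \<in> {a,b,c,e}" for x
    by (rule *[OF that] T_loc)+
  note r = c[OF insertI1] c[OF insertI2[OF insertI1]]
    c[OF insertI2[OF insertI2[OF insertI1]]] c[OF insertI2[OF insertI2[OF insertI2[OF insertI1]]]]
    borelD[OF borel_T[of i d]]
  show ?thesis unfolding W T_def Ti_def qtr_def
    by (simp add: Lplus_def Lplus_inv_def mat2_defs ring_nf r r[THEN mult_assoc_rule])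
qed

text \<open>A product of matrices \<open>M j\<close> lies in \<open>lower m\<close> if all \<open>j < m\<close> and in \<open>upper m\<close> if all \<open>m \<le> j\<close>, and
  these two classes exchange.\<close>

definition lower :: "nat \<Rightarrow> 'a mat2 set" where
  "lower m = {X \<in> mat_loc {..<m}. dressed (kT 0 m) (kiT 0 m) (fT 0 m) X}"

definition upper :: "nat \<Rightarrow> 'a mat2 set" where
  "upper m = {T 0 m * Y * Ti 0 m | Y. Y \<in> mat_loc {m..}}"

lemma exch_upper_lower: "X \<in> upper m \<Longrightarrow> Y \<in> lower m \<Longrightarrow> exch X Y"
proof -
  assume X: "X \<in> upper m" and Y: "Y \<in> lower m"
  then obtain W where W: "X = T 0 m * W * Ti 0 m" "W \<in> mat_loc {m..}" by (auto simp: upper_def)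
  have "entries_commute x W" if "x \<in> loc {..<m}" for x
    by (rule entries_commute_loc[OF W(2) that]) auto
  then show "exch X Y"
    unfolding W(1) T_def Ti_def using Y T_loc[of 0 m]
    by (intro exch_dressed borel_T) (auto simp: lower_def mat_loc_def atLeast0LessThan)
qed

lemma lower_closed:
  "1 \<in> lower m"
  "A \<in> lower m \<Longrightarrow> B \<in> lower m \<Longrightarrow> A * B \<in> lower m"
  "A \<in> lower m \<Longrightarrow> qinv A \<in> lower m"
  unfolding lower_def qinv_def
  using dressed_scal[of "kT 0 m" 1 "fT 0 m" "kiT 0 m"] dressed_qtr[OF borel_T[of 0 m], of A]
  by (auto simp: scal_algebra intro!: mat_loc_closed dressed_mult borel_T dressed_linear dressed_scal)

lemma upper_closed:
  "1 \<in> upper m"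
  "A \<in> upper m \<Longrightarrow> B \<in> upper m \<Longrightarrow> A * B \<in> upper m"
  "A \<in> upper m \<Longrightarrow> qinv A \<in> upper m"
proof -
  show "1 \<in> upper m"
    unfolding upper_def using T_inverse mat_loc_closed(1) by (auto intro!: exI[of _ 1])
next
  assume "A \<in> upper m" "B \<in> upper m"
  then obtain V W where V: "A = T 0 m * V * Ti 0 m" "V \<in> mat_loc {m..}"
    and W: "B = T 0 m * W * Ti 0 m" "W \<in> mat_loc {m..}" by (auto simp: upper_def)
  have "A * B = T 0 m * V * (Ti 0 m * T 0 m) * W * Ti 0 m" by (simp only: V W mult.assoc)
  then have "A * B = T 0 m * (V * W) * Ti 0 m" by (simp add: T_inverse mult.assoc)
  then show "A * B \<in> upper m" unfolding upper_def using V W mat_loc_closed by auto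
next
  assume "A \<in> upper m"
  then obtain V where V: "A = T 0 m * V * Ti 0 m" "V \<in> mat_loc {m..}" by (auto simp: upper_def)
  have t: "qtr A = qtr V" unfolding V(1) by (rule qtr_T_conj[OF V(2)]) auto
  have "scal (qtr V) * T 0 m = T 0 m * scal (qtr V)"
    using loc_commute[OF mat_loc_closed(7)[OF V(2)], of _ "{..<m}"] mat_loc_T(1)[of 0 m]
    by (simp add: scal_def mat2_defs mat_loc_def disjoint_iff atLeast0LessThan)
  then have "scal (qtr V) = T 0 m * scal (qtr V) * Ti 0 m"
    by (metis T_inverse(1) mult.assoc mult.right_neutral)
  then have "qinv A = T 0 m * qinv V * Ti 0 m"
    unfolding qinv_def t
    by (simp only: V(1) right_diff_distrib left_diff_distrib mult_scaleq_left mult_scaleq_right)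
  then show "qinv A \<in> upper m"
    unfolding upper_def using V mat_loc_closed by (auto simp: qinv_def)
qed

text \<open>The class \<open>lower m\<close> refers to the Borel generators of exactly m copies.
  Passing to m + 1 replaces them by coproducts, whose new factors lie in copy m and commute with
  X.\<close>

lemma lower_Suc: "lower m \<subseteq> lower (Suc m)"
proof
  fix X assume X: "X \<in> lower m"
  obtain a b c d where m: "X = Mat2 a b c d" by (cases X)
  have l: "a \<in> loc {..<m}" "b \<in> loc {..<m}" "c \<in> loc {..<m}" "d \<in> loc {..<m}"
    using X by (simp_all add: lower_def mat_loc_def m)
  have "y * x = x * y" if "x \<in> {a,b,c,d}" "y \<in> {K m, Ki m, E m, F m}" for x y
    using that l loc_commute[of x "{..<m}" y "{m}"] loc_gens[of m "{m}"] by auto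
  then have cm: "K m * x = x * K m" "Ki m * x = x * Ki m" "F m * x = x * F m"
    if "x \<in> {a,b,c,d}" for x using that by auto
  have "dressed (kT 0 m) (kiT 0 m) (fT 0 m) X" using X by (simp add: lower_def)
  note D = dressedD[OF this[unfolded m] borel_T]
  note r = D borelD[OF borel_T[of 0 m]] borelD[OF borel_slot[of "m"]] T_commute'[of 0 m, simplified]
    cm[OF insertI1] cm[OF insertI2[OF insertI1]]
    cm[OF insertI2[OF insertI2[OF insertI1]]] cm[OF insertI2[OF insertI2[OF insertI2[OF insertI1]]]]
  have "dressed (kT 0 (Suc m)) (kiT 0 (Suc m)) (fT 0 (Suc m)) X"
    unfolding dressed_def m
    by (simp add: ring_nf r r[THEN mult_assoc_rule])
  moreover have "X \<in> mat_loc {..<Suc m}"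
    using X mat_loc_mono[of "{..<m}" "{..<Suc m}"] by (auto simp: lower_def)
  ultimately show "X \<in> lower (Suc m)" by (simp add: lower_def)
qed

lemma M_lower_Suc: "M m \<in> lower (Suc m)"
proof -
  have "M m \<in> mat_loc {..<Suc m}"
    unfolding M_def using mat_loc_T[of 0 m] mat_loc_L[of m]
      mat_loc_mono[of "{..<m}" "{..<Suc m}"] mat_loc_mono[of "{m}" "{..<Suc m}"]
    by (simp add: atLeast0LessThan mat_loc_closed)
  moreover have "dressed (kT 0 (Suc m)) (kiT 0 (Suc m)) (fT 0 (Suc m)) (M m)"
    unfolding M_def T_def Ti_def L_def kT.simps kiT.simps fT.simps add_0
    by (rule dressed_L) (auto simp: borel_T borel_slot KE EF T_commute'[of 0 m, simplified])
  ultimately show ?thesis by (simp add: lower_def)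
qed

lemma M_lower: "j < m \<Longrightarrow> M j \<in> lower m"
proof (induction m)
  case (Suc m)
  then show ?case using M_lower_Suc lower_Suc[of m] by (cases "j = m") auto
qed simp

lemma M_upper:
  assumes "m \<le> j" shows "M j \<in> upper m"
proof -
  define d where "d = j - m"
  have j: "j = m + d" using assms by (simp add: d_def)
  have T: "T 0 j = T 0 m * T m d" unfolding j using T_add[of 0 m d] by simp
  have "Ti 0 j = Ti 0 j * (T 0 m * (T m d * Ti m d) * Ti 0 m)" by (simp add: T_inverse)
  also have "\<dots> = Ti 0 j * T 0 j * Ti m d * Ti 0 m" by (simp only: T mult.assoc)
  finally have Ti: "Ti 0 j = Ti m d * Ti 0 m" by (simp add: T_inverse)
  have "M j = T 0 m * (T m d * L j * Ti m d) * Ti 0 m" by (simp add: M_def T Ti mult.assoc)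
  moreover have "T m d * L j * Ti m d \<in> mat_loc {m..}"
  proof -
    have "{m..<m+d} \<subseteq> {m..}" "{j} \<subseteq> {m..}" using j by auto
    note mat_loc_mono[OF this(1) mat_loc_T(1)] mat_loc_mono[OF this(1) mat_loc_T(2)]
      mat_loc_mono[OF this(2) mat_loc_L]
    then show ?thesis by (intro mat_loc_closed)
  qed
  ultimately show ?thesis by (auto simp: upper_def)
qed

lemma CH_L: "cayley_hamilton (L i)"
  unfolding L_def by (rule cayley_hamilton_L) (rule borel_slot KE EF)+

lemma CH_M: "cayley_hamilton (M j)"
proof -
  have L: "L j \<in> mat_loc {j}" by (rule mat_loc_L)
  have t: "qtr (M j) = qtr (L j)" unfolding M_def by (rule qtr_T_conj[OF L]) auto
  have c: "scal (qtr (L j)) * T 0 j = T 0 j * scal (qtr (L j))"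
      "scal (qtr (L j)) * Ti 0 j = Ti 0 j * scal (qtr (L j))"
    using loc_commute[OF mat_loc_closed(7)[OF L], of _ "{..<j}"] mat_loc_T[of 0 j]
    by (simp_all add: scal_def mat2_defs mat_loc_def disjoint_iff atLeast0LessThan)
  have LL: "L j * L j = inverse qq *\<^sub>q scal (qtr (L j)) * L j - inverse qq *\<^sub>q inverse qq *\<^sub>q 1"
     "L j * scal (qtr (L j)) = scal (qtr (L j)) * L j"
    using CH_L[of j] by (auto simp: cayley_hamilton_def)
  have "M j * M j = T 0 j * (L j * L j) * Ti 0 j"
    by (simp add: M_def mult.assoc T_inverse mult_assoc_rule[OF T_inverse(2)])
  also have "\<dots> = inverse qq *\<^sub>q scal (qtr (L j)) * M j - inverse qq *\<^sub>q inverse qq *\<^sub>q 1"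
    by (simp add: LL ring_nf T_inverse M_def mult_assoc_rule[OF c(1)[symmetric]])
  finally show ?thesis
    unfolding cayley_hamilton_def t
    by (simp add: M_def mult.assoc c(1) LL(2) mult_assoc_rule[OF c(1)] mult_assoc_rule[OF LL(2)] c(2)[symmetric])
qed

end

section \<open>Ordered products over arbitrary finite sets and their normalised traces\<close>

lemma cayley_hamilton_one: "cayley_hamilton 1"
  by (simp add: cayley_hamilton_def qtr_scal scal_algebra ring_nf)

lemma sorted_list_of_set_Un:
  assumes "finite A" "finite B" "A \<prec> B"
  shows "sorted_list_of_set (A \<union> B) = sorted_list_of_set A @ sorted_list_of_set B"
  by (rule strict_sorted_equal) (use assms in \<open>auto simp: sorted_wrt_append set_less_def\<close>)

lemma scaleq_left_cancel: "c \<noteq> 0 \<Longrightarrow> c *\<^sub>q x = c *\<^sub>q y \<Longrightarrow> x = (y :: 'a::cq_module)"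
  by simp

text \<open>The ordering in \<Omega> calls for p * m. Exchanging the first two factors of
  \<open>qtr_Omega_rev\<close> by \<open>qtr_qcomm\<close> turns q^-1 m p v into q p m v and the
  coefficient q^-2 of v^2 into q^2.\<close>

lemma (in qtriple_full) qtr_Omega:
  fixes x y z m p v n
  defines "x \<equiv> qtr X" and "y \<equiv> qtr Y" and "z \<equiv> qtr Z" and "m \<equiv> qtr (X * Y)"
    and "p \<equiv> qtr (Y * Z)" and "v \<equiv> qtr (X * Z)" and "n \<equiv> qtr (X * Y * Z)"
  shows "qq *\<^sub>q (p * m * v) + (qq *\<^sub>q qq *\<^sub>q (p * p) + inverse qq *\<^sub>q inverse qq *\<^sub>q (m * m)
    + qq *\<^sub>q qq *\<^sub>q (v * v) + n * n + z * z + y * y + x * x)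
    - qq *\<^sub>q (p * (z * y + x * n)) - inverse qq *\<^sub>q (m * (y * x + z * n))
    - qq *\<^sub>q (v * (z * x + y * n)) + z * y * x * n
    - (qq *\<^sub>q qq *\<^sub>q 1 + 1 + 1 + inverse qq *\<^sub>q inverse qq *\<^sub>q 1) = 0"
proof -
  note d = x_def y_def z_def m_def p_def v_def n_def
  have c: "y * x = x * y" "z * x = x * z" "z * y = y * z" "z * v = v * z" "n * v = v * n"
    "x * v = v * x" "y * v = v * y"
    unfolding d by (rule qtr_comm qtr_comm[symmetric]; simp)+
  have c': "y * (x * w) = x * (y * w)" "z * (x * w) = x * (z * w)" "z * (y * w) = y * (z * w)"
    "z * (v * w) = v * (z * w)" "n * (v * w) = v * (n * w)" "x * (v * w) = v * (x * w)"
    "y * (v * w) = v * (y * w)" for w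
    using c by (metis mult.assoc)+
  have "inverse qq *\<^sub>q (m * p) = qq *\<^sub>q (p * m)
      + (inverse qq - qq) *\<^sub>q (x * z + y * n - (qq + inverse qq) *\<^sub>q v)"
    using qtr_qcomm by (simp add: d algebra_simps)
  from arg_cong[OF this, of "\<lambda>w. w * v"]
  have e: "inverse qq *\<^sub>q (m * p * v) = qq *\<^sub>q (p * m * v)
      + (inverse qq - qq) *\<^sub>q ((x * z + y * n) * v - (qq + inverse qq) *\<^sub>q (v * v))"
    by (simp add: ring_nf)
  show ?thesis
    using qtr_Omega_rev[folded d] unfolding e by (simp add: ring_nf algebra_simps c c')
qed

context uq_family begin

text \<open>The factors are multiplied in decreasing order, which is the order matching \<open>qcomm\<close> in \<open>C_seq\<close>.\<close>

definition Mprod :: "nat set \<Rightarrow> 'a mat2" where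
  "Mprod S = prod_list (map M (rev (sorted_list_of_set S)))"

lemma Mprod_empty: "Mprod {} = 1" by (simp add: Mprod_def)

lemma Mprod_single: "Mprod {j} = M j" by (simp add: Mprod_def)

lemma Mprod_Un:
  "finite A \<Longrightarrow> finite B \<Longrightarrow> A \<prec> B \<Longrightarrow> Mprod (A \<union> B) = Mprod B * Mprod A"
  by (simp add: Mprod_def sorted_list_of_set_Un)

lemma Mprod_lower:
  assumes "S \<subseteq> {..<m}" shows "Mprod S \<in> lower m"
proof -
  have "prod_list (map M xs) \<in> lower m" if "set xs \<subseteq> {..<m}" for xs
    using that by (induction xs) (auto intro: lower_closed M_lower)
  moreover have "finite S" using assms finite_subset by blast
  ultimately show ?thesis using assms by (simp add: Mprod_def)
qed

lemma Mprod_upper: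
  assumes "S \<subseteq> {m..}" "finite S" shows "Mprod S \<in> upper m"
proof -
  have "prod_list (map M xs) \<in> upper m" if "set xs \<subseteq> {m..}" for xs
    using that by (induction xs) (auto intro: upper_closed M_upper)
  then show ?thesis using assms by (simp add: Mprod_def)
qed

lemma cut:
  assumes "A \<prec> B" "finite A"
  obtains m where "A \<subseteq> {..<m}" "B \<subseteq> {m..}"
proof (cases "A = {}")
  case True
  then show ?thesis using that[of 0] by auto
next
  case False
  show ?thesis
  proof (rule that)
    show "A \<subseteq> {..<Suc (Max A)}" using assms(2) by (auto simp: less_Suc_eq_le)
    show "B \<subseteq> {Suc (Max A)..}"
      using Max_in[OF assms(2) False] assms(1) by (auto simp: set_less_def Suc_le_eq)
  qed
qed

lemma CH_Mprod: "finite S \<Longrightarrow> cayley_hamilton (Mprod S)"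
proof (induction S rule: finite_linorder_max_induct)
  case empty
  then show ?case by (simp add: Mprod_empty cayley_hamilton_one)
next
  case (insert b A)
  have "Mprod (insert b A) = M b * Mprod A"
    using Mprod_Un[of A "{b}"] insert by (simp add: set_less_def Mprod_single)
  moreover have "exch (M b) (Mprod A)"
    using insert by (intro exch_upper_lower[of _ b] M_upper Mprod_lower) auto
  ultimately show ?case using insert CH_M by (simp add: cayley_hamilton_mult)
qed

text \<open>One threshold separates A from H and B, another one A and H from B, and each required
  pair is split by one of them. \<open>A \<prec> B\<close> is a separate hypothesis because H may be
  empty, and then it does not follow from the other two.\<close>

lemma Mprod_triple:
  assumes "finite A" "finite H" "finite B" "A \<prec> H" "H \<prec> B" "A \<prec> B"
  shows "qtriple_full (Mprod B) (Mprod H) (Mprod A)"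
proof -
  have 1: "A \<prec> H \<union> B" "A \<union> H \<prec> B" using assms by (auto simp: set_less_def)
  obtain m where m: "A \<subseteq> {..<m}" "H \<union> B \<subseteq> {m..}" using cut[OF 1(1)] assms by blast
  obtain l where l: "A \<union> H \<subseteq> {..<l}" "B \<subseteq> {l..}" using cut[OF 1(2)] assms by blast
  have u: "Mprod B \<in> upper m" "Mprod H \<in> upper m" "Mprod A \<in> lower m"
    "Mprod B \<in> upper l" "Mprod H \<in> lower l" "Mprod A \<in> lower l"
    using m l assms by (auto intro!: Mprod_upper Mprod_lower)
  note CH = assms(1-3)[THEN CH_Mprod]
  have e: "exch (Mprod B) (Mprod H)" "exch (Mprod B) (Mprod A)" "exch (Mprod H) (Mprod A)"
    "exch (Mprod B) (Mprod H * Mprod A)" "exch (Mprod B) (Mprod H * Mprod A * qinv (Mprod H) * qinv (Mprod A))"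
    by (rule exch_upper_lower[of _ l] exch_upper_lower[of _ m]; intro upper_closed lower_closed u)+
  have "exch (Mprod B * Mprod H) (Mprod A)" "exch (qinv (Mprod H) * qinv (Mprod B) * qinv (Mprod H) * Mprod B) (Mprod A)"
    by (rule exch_upper_lower[of _ m]; intro upper_closed lower_closed u)+
  with e CH show ?thesis by (intro qtriple_full.intro qtriple.intro qtriple_full_axioms.intro)
qed

definition Cas :: "nat set \<Rightarrow> 'a" where
  "Cas S = inverse (qq + inverse qq) *\<^sub>q qtr (Mprod S)"

lemma qtr_Mprod: "qtr (Mprod S) = (qq + inverse qq) *\<^sub>q Cas S"
  by (simp add: Cas_def scaleq_scaleq qq_plus scaleq_one)

lemma Cas_empty: "Cas {} = 1"
  by (simp add: Cas_def Mprod_empty qtr_scal scaleq_scaleq left_inverse[OF qq_plus] scaleq_one flip: scaleq_add_left)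

lemma Mprod_Un3:
  assumes "finite A" "finite H" "finite B" "A \<prec> H" "H \<prec> B" "A \<prec> B"
  shows "Mprod B * Mprod A = Mprod (A \<union> B)" "Mprod H * Mprod A = Mprod (A \<union> H)" "Mprod B * Mprod H = Mprod (H \<union> B)"
    "Mprod B * Mprod H * Mprod A = Mprod (A \<union> H \<union> B)"
proof -
  have "A \<union> H \<prec> B" using assms by (auto simp: set_less_def)
  then have "Mprod (A \<union> H \<union> B) = Mprod B * Mprod (A \<union> H)" by (intro Mprod_Un) (use assms in auto)
  then show "Mprod B * Mprod H * Mprod A = Mprod (A \<union> H \<union> B)" using assms by (simp add: Mprod_Un mult.assoc)
qed (use assms in \<open>auto simp: Mprod_Un\<close>)

text \<open>Products run in decreasing order, so Y Z belongs to \<open>A \<union> H\<close> and X Y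
  to \<open>H \<union> B\<close>, which puts the arguments of \<open>qcomm\<close> in the order of
  \<open>C_seq\<close>. It remains to clear the factor (q + q^-1)^2.\<close>

lemma Cas_qcomm:
  assumes "finite A" "finite H" "finite B" "A \<prec> H" "H \<prec> B" "A \<prec> B"
  shows "Cas (A \<union> B) = - qcomm (Cas (A \<union> H)) (Cas (H \<union> B)) + Cas A * Cas B + Cas H * Cas (A \<union> H \<union> B)"
proof -
  interpret qtriple_full "Mprod B" "Mprod H" "Mprod A" by (rule Mprod_triple[OF assms])
  let ?t = "qq + inverse qq" and ?h = "inverse qq - qq"
  have ab: "Cas A * Cas B = Cas B * Cas A"
    using qtr_sym(2) by (simp add: Cas_def mult_scaleq_left mult_scaleq_right)
  have "(?t * ?t) *\<^sub>q (inverse qq *\<^sub>q (Cas (H \<union> B) * Cas (A \<union> H)) - qq *\<^sub>q (Cas (A \<union> H) * Cas (H \<union> B)))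
    = (?t * ?t) *\<^sub>q (?h *\<^sub>q (Cas B * Cas A + Cas H * Cas (A \<union> H \<union> B) - Cas (A \<union> B)))"
    using qtr_qcomm[unfolded Mprod_Un3(4)[OF assms], unfolded Mprod_Un3(1-3)[OF assms]] unfolding qtr_Mprod
    by (simp add: mult_scaleq_left mult_scaleq_right scaleq_scaleq mult_ac
      cq.scale_right_diff_distrib scaleq_add_right)
  then have "inverse qq *\<^sub>q (Cas (H \<union> B) * Cas (A \<union> H)) - qq *\<^sub>q (Cas (A \<union> H) * Cas (H \<union> B))
    = ?h *\<^sub>q (Cas A * Cas B + Cas H * Cas (A \<union> H \<union> B) - Cas (A \<union> B))"
    unfolding ab by (rule scaleq_left_cancel[rotated]) (use qq_plus in simp)
  then have "qq *\<^sub>q (Cas (A \<union> H) * Cas (H \<union> B)) - inverse qq *\<^sub>q (Cas (H \<union> B) * Cas (A \<union> H))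
    = (qq - inverse qq) *\<^sub>q (Cas A * Cas B + Cas H * Cas (A \<union> H \<union> B) - Cas (A \<union> B))"
    by (simp add: cq.scale_left_diff_distrib algebra_simps)
  then have "qcomm (Cas (A \<union> H)) (Cas (H \<union> B)) = Cas A * Cas B + Cas H * Cas (A \<union> H \<union> B) - Cas (A \<union> B)"
    by (simp only: qcomm_def scaleq_scaleq left_inverse[OF qq_minus] scaleq_one)
  then show ?thesis by simp
qed

lemma Mprod_interval: "Mprod {i..<i+d} = T 0 i * (T i d * N i d) * Ti 0 i"
proof (induction d)
  case 0
  then show ?case by (simp add: Mprod_empty T_0 T_inverse)
next
  case (Suc d)
  have T: "T 0 (i + d) = T 0 i * T i d" using T_add[of 0 i d] by simp
  have "Mprod {i..<i + Suc d} = M (i + d) * Mprod {i..<i+d}"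
    using Mprod_Un[of "{i..<i+d}" "{i+d}"] by (simp add: set_less_def Mprod_single atLeastLessThanSuc Un_commute)
  also have "\<dots> = T 0 (i + d) * L (i + d) * (Ti 0 (i + d) * (T 0 i * T i d)) * N i d * Ti 0 i"
    by (simp only: Suc M_def mult.assoc)
  \<comment> \<open>The \<open>Ti 0 (i + d)\<close> that ends \<open>M (i + d)\<close> meets T 0 i *
    T i d = T 0 (i + d) from the induction hypothesis and cancels.\<close>
  also have "\<dots> = T 0 i * (T i (Suc d) * N i (Suc d)) * Ti 0 i"
    by (simp only: T[symmetric] T_inverse) (simp add: T T_Suc N_Suc L_def mult.assoc)
  finally show ?case .
qed

lemma Cas_interval: "Cas {i..<i+d} = inverse (qq + inverse qq) *\<^sub>q
   ((qq - inverse qq) *\<^sub>q (fT i d * eT i d) + qq *\<^sub>q (kT i d * kT i d) + inverse qq *\<^sub>q (kiT i d * kiT i d))"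
proof -
  have "T i d * N i d \<in> mat_loc {i..<i+d}" by (intro mat_loc_closed mat_loc_T)
  from qtr_T_conj[OF this, of 0 i] have "qtr (Mprod {i..<i+d}) = qtr (T i d * N i d)"
    unfolding Mprod_interval by simp
  also have "\<dots> = (qq - inverse qq) *\<^sub>q (fT i d * eT i d) + qq *\<^sub>q (kT i d * kT i d) + inverse qq *\<^sub>q (kiT i d * kiT i d)"
    by (simp add: qtr_def T_def N_def Lplus_def Lminus_inv_def mat2_defs ring_nf)
  finally show ?thesis by (simp add: Cas_def)
qed

lemma Cas_Omega:
  assumes "finite A" "finite H" "finite B" "A \<prec> H" "H \<prec> B" "A \<prec> B"
  shows "qq *\<^sub>q (Cas (A \<union> H) * Cas (H \<union> B) * Cas (A \<union> B))
      + inverse (qq + inverse qq) *\<^sub>q (qq\<^sup>2 *\<^sub>q (Cas (A \<union> H))\<^sup>2 + (inverse qq)\<^sup>2 *\<^sub>q (Cas (H \<union> B))\<^sup>2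
          + qq\<^sup>2 *\<^sub>q (Cas (A \<union> B))\<^sup>2 + (Cas (A \<union> H \<union> B))\<^sup>2 + (Cas A)\<^sup>2 + (Cas H)\<^sup>2 + (Cas B)\<^sup>2)
      - qq *\<^sub>q (Cas (A \<union> H) * (Cas A * Cas H + Cas B * Cas (A \<union> H \<union> B)))
      - inverse qq *\<^sub>q (Cas (H \<union> B) * (Cas H * Cas B + Cas A * Cas (A \<union> H \<union> B)))
      - qq *\<^sub>q (Cas (A \<union> B) * (Cas A * Cas B + Cas H * Cas (A \<union> H \<union> B)))
      + (qq + inverse qq) *\<^sub>q (Cas A * Cas H * Cas B * Cas (A \<union> H \<union> B))
      - inverse (qq + inverse qq) *\<^sub>q 1 = 0" (is "?O = 0")
proof -
  interpret qtriple_full "Mprod B" "Mprod H" "Mprod A" by (rule Mprod_triple[OF assms])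
  define t s where "t = qq + inverse qq" and "s = inverse t"
  have ts: "t *\<^sub>q s *\<^sub>q x = x" "s *\<^sub>q t *\<^sub>q x = x" for x :: 'a
    by (simp_all add: s_def t_def scaleq_scaleq right_inverse[OF qq_plus] left_inverse[OF qq_plus] scaleq_one)
  define x y z p m v n where "x = Cas A" and "y = Cas H" and "z = Cas B" and "p = Cas (A \<union> H)"
    and "m = Cas (H \<union> B)" and "v = Cas (A \<union> B)" and "n = Cas (A \<union> H \<union> B)"
  note d = x_def y_def z_def m_def p_def v_def n_def
  have Q: "qtr (Mprod A) = t *\<^sub>q x" "qtr (Mprod H) = t *\<^sub>q y" "qtr (Mprod B) = t *\<^sub>q z"
    "qtr (Mprod H * Mprod A) = t *\<^sub>q p" "qtr (Mprod B * Mprod H) = t *\<^sub>q m" "qtr (Mprod B * Mprod A) = t *\<^sub>q v"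
    "qtr (Mprod B * Mprod H * Mprod A) = t *\<^sub>q n"
    unfolding d t_def qtr_Mprod[symmetric] Mprod_Un3[OF assms, symmetric] by (rule refl)+
  have t1: "qq *\<^sub>q qq *\<^sub>q 1 + 1 + 1 + inverse qq *\<^sub>q inverse qq *\<^sub>q 1 = t *\<^sub>q t *\<^sub>q (1 :: 'a)"
    by (simp add: t_def scaleq_nf add_ac)
  have tq: "t *\<^sub>q qq *\<^sub>q w = qq *\<^sub>q t *\<^sub>q w" "t *\<^sub>q inverse qq *\<^sub>q w = inverse qq *\<^sub>q t *\<^sub>q w" for w :: 'a
    by (rule cq.scale_left_commute)+
  \<comment> \<open>Every trace is t times a \<open>Cas\<close>. Multiplying by t^3 turns the
    coefficients t, 1, t^-1 of the terms with four, three and two factors into t^4, t^3, t^2, and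
    the constant into t^2 = q^2 + 2 + q^-2.\<close>
  have "t *\<^sub>q t *\<^sub>q t *\<^sub>q ?O = 0"
    using qtr_Omega[unfolded Q t1]
    unfolding d[symmetric] t_def[symmetric] s_def[symmetric] power2_eq_square scaleq_scaleq[symmetric]
    by (simp only: scaleq_add_right cq.scale_right_diff_distrib mult_scaleq_left mult_scaleq_right
        distrib_left mult.assoc ts tq)
  then show ?thesis using qq_plus unfolding t_def by simp
qed

end

section \<open>The recursion for sequences of connected sets, read as a trace identity\<close>

lemma hole_interval:
  assumes "a \<le> b" "b < c" "c \<le> d"
  shows "hole {a..b} {c..d} = {b<..<c}"
proof (rule set_eqI)
  fix x
  have "b \<in> {a..b}" "c \<in> {c..d}" using assms by auto
  then have "x \<in> hole {a..b} {c..d} \<Longrightarrow> b < x \<and> x < c \<or> c < x \<and> x < b"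
    unfolding hole_def by blast
  moreover have "b < x \<and> x < c \<Longrightarrow> x \<in> hole {a..b} {c..d}"
    unfolding hole_def by simp
  ultimately show "x \<in> hole {a..b} {c..d} \<longleftrightarrow> x \<in> {b<..<c}"
    using assms(2) by (metis greaterThanLessThan_iff less_trans less_asym)
qed

lemma cq_algebra_homD:
  assumes "cq_algebra_hom f"
  shows "f (x + y) = f x + f y" "f (c *\<^sub>q x) = c *\<^sub>q f x" "f (x * y) = f x * f y" "f 1 = 1"
    "f (x - y) = f x - f y" "f (- x) = - f x" "f 0 = 0"
proof -
  show 1: "f (x + y) = f x + f y" "f (c *\<^sub>q x) = c *\<^sub>q f x" "f (x * y) = f x * f y" "f 1 = 1" for x y c
    using assms by (simp_all add: cq_algebra_hom_def)
  show "f (x - y) = f x - f y" using 1(1)[of "x - y" y] by (metis add_diff_cancel_right' diff_add_cancel)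
  show z: "f 0 = 0" using 1(1)[of 0 0] by simp
  show "f (- x) = - f x" using 1(1)[of "- x" x] z by (metis add.left_inverse eq_neg_iff_add_eq_0)
qed

lemma cq_algebra_hom_qcomm:
  "cq_algebra_hom f \<Longrightarrow> f (qcomm x y) = qcomm (f x) (f y)"
  by (simp add: qcomm_def cq_algebra_homD)

text \<open>The recursion of \<open>C_seq\<close> has the shape of \<open>Cas_qcomm\<close>, with A
  the first block, H the hole and B the union of all remaining blocks, which need not be connected.
  The sequences containing \<open>Js\<close> have one block less, so induction on the length
  applies.\<close>

lemma (in uq_family) hom_C_seq:
  assumes "cq_algebra_hom f" "\<And>I. is_connected I \<Longrightarrow> I \<subseteq> {1..n} \<Longrightarrow> f (g I) = Cas I"
  shows "sorted_wrt (\<prec>) Is \<Longrightarrow> (\<forall>I\<in>set Is. is_connected I \<and> I \<subseteq> {1..n}) \<Longrightarrow> f (C_seq g Is) = Cas (\<Union> (set Is))"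
proof (induction "length Is" arbitrary: Is rule: less_induct)
  case less
  consider "Is = []" | I where "Is = [I]" | I J Js where "Is = I # J # Js"
    by (metis neq_Nil_conv)
  then show ?case
  proof cases
    case 1
    then show ?thesis using assms(1) by (simp add: Cas_empty cq_algebra_homD)
  next
    case 2
    then show ?thesis using assms(2) less.prems by simp
  next
    case 3
    note Is = 3
    obtain a b c d where ab: "I = {a..b}" "a \<le> b" and cd: "J = {c..d}" "c \<le> d"
      using less.prems(2) Is by (auto simp: is_connected_def)
    have IJ: "I \<prec> J" "\<forall>U\<in>set Js. I \<prec> U" "\<forall>U\<in>set Js. J \<prec> U" "sorted_wrt (\<prec>) Js"
      using less.prems(1) Is by auto
    have Js: "\<forall>U\<in>set Js. is_connected U \<and> U \<subseteq> {1..n}" "I \<subseteq> {1..n}" "J \<subseteq> {1..n}"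
      using less.prems(2) Is by auto
    have in_IJ: "a \<in> I" "b \<in> I" "c \<in> J" "d \<in> J" using ab cd by auto
    then have bc: "b < c" using IJ(1) unfolding set_less_def by blast
    have an: "1 \<le> a" "d \<le> n" using in_IJ(1,4) Js(2,3) by (meson atLeastAtMost_iff subsetD)+
    have H: "hole I J = {b<..<c}" by (simp only: ab(1) cd(1) hole_interval[OF ab(2) bc cd(2)])
    have IH: "f (C_seq g Us) = Cas (\<Union> (set Us))"
      if "length Us < length Is" "sorted_wrt (\<prec>) Us" "\<forall>I\<in>set Us. is_connected I \<and> I \<subseteq> {1..n}" for Us
      using less.hyps that by blast
    have con: "is_connected {u..v}" if "u \<le> v" for u v using that by (auto simp: is_connected_def)
    \<comment> \<open>The first blocks fused into one: u = a gives I, the hole and J together, u =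
      Suc b gives the hole with J.\<close>
    have seq: "f (C_seq g ({u..d} # Js)) = Cas ({u..d} \<union> \<Union> (set Js))" if "u = a \<or> u = Suc b" for u
    proof -
      have "{u..d} \<prec> U" if "U \<in> set Js" for U
      proof -
        have "d < y" if "y \<in> U" for y
          using IJ(3) \<open>U \<in> set Js\<close> that in_IJ(4) unfolding set_less_def by blast
        then show ?thesis unfolding set_less_def by (metis atLeastAtMost_iff le_less_trans)
      qed
      moreover have "{u..d} \<subseteq> {1..n}" "u \<le> d" using that an ab(2) cd(2) bc by auto
      ultimately show ?thesis using IH[of "{u..d} # Js"] IJ(4) Js(1) con Is by simp
    qed
    have JJs: "f (C_seq g (J # Js)) = Cas (J \<union> \<Union> (set Js))"
      using IH[of "J # Js"] less.prems Is by simp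
    show ?thesis
    proof (cases "hole I J = {}")
      case True
      then have "Suc b \<notin> {b<..<c}" using H by simp
      then have "c = Suc b" using bc by simp
      then have "I \<union> J = {a..d}" using ab cd by auto
      then show ?thesis using seq[of a] True Is by (simp add: Un_assoc[symmetric])
    next
      case False
      then obtain x where "x \<in> {b<..<c}" using H by blast
      then have Sb: "Suc b < c" by simp
      let ?H = "{b<..<c}" and ?B = "J \<union> \<Union> (set Js)"
      have eq: "I \<union> ?H = {a..c-1}" "?H \<union> J = {Suc b..d}" "I \<union> ?H \<union> J = {a..d}" "?H = {Suc b..c-1}"
        using ab cd bc by auto
      have sub: "{a..c-1} \<subseteq> {1..n}" "{Suc b..c-1} \<subseteq> {1..n}"
        using ab(2) cd(2) bc an by auto
      have 1: "f (g (I \<union> ?H)) = Cas (I \<union> ?H)" "f (g ?H) = Cas ?H" "f (g I) = Cas I"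
      proof -
        show "f (g (I \<union> ?H)) = Cas (I \<union> ?H)" unfolding eq(1)
          by (rule assms(2)[OF con sub(1)]) (use ab bc in simp)
        show "f (g ?H) = Cas ?H" unfolding eq(4)
          by (rule assms(2)[OF con sub(2)]) (use Sb in simp)
        show "f (g I) = Cas I" using assms(2)[OF con[OF ab(2)]] Js(2) ab(1) by simp
      qed
      have fin: "finite I" "finite ?H" "finite ?B"
        using ab cd Js(1) is_connected_finite by auto
      have less: "I \<prec> ?H" "?H \<prec> ?B" "I \<prec> ?B"
      proof -
        show "I \<prec> ?H" using ab(1) unfolding set_less_def by auto
        have "c \<le> y" if "y \<in> ?B" for y
          using that cd(1) IJ(3) in_IJ(3) unfolding set_less_def by (force intro: less_imp_le)
        then show "?H \<prec> ?B" unfolding set_less_def by (metis greaterThanLessThan_iff less_le_trans)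
        show "I \<prec> ?B" using IJ(1,2) unfolding set_less_def by blast
      qed
      have u: "f (C_seq g ((?H \<union> J) # Js)) = Cas (?H \<union> ?B)"
        "f (C_seq g ((I \<union> ?H \<union> J) # Js)) = Cas (I \<union> ?H \<union> ?B)"
        using seq[of "Suc b"] seq[of a] unfolding Un_assoc[symmetric] eq(2,3) by simp_all
      have "C_seq g Is = - qcomm (g (I \<union> ?H)) (C_seq g ((?H \<union> J) # Js))
          + g I * C_seq g (J # Js) + g ?H * C_seq g ((I \<union> ?H \<union> J) # Js)"
        unfolding H[symmetric] using False by (simp add: Is)
      then have "f (C_seq g Is) = - qcomm (Cas (I \<union> ?H)) (Cas (?H \<union> ?B))
          + Cas I * Cas ?B + Cas ?H * Cas (I \<union> ?H \<union> ?B)"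
        by (simp only: cq_algebra_homD[OF assms(1)] cq_algebra_hom_qcomm[OF assms(1)] 1 u JJs)
      also have "\<dots> = Cas (I \<union> ?B)" using Cas_qcomm[OF fin less] by simp
      finally show ?thesis by (simp add: Is)
    qed
  qed
qed

section \<open>Iterated coproducts and tensor slots\<close>

lemma tcat_assoc: "(r \<boxtimes> s) \<boxtimes> t = r \<boxtimes> s \<boxtimes> (t :: 'a::cq_algebra tens)"
proof -
  have 1: "(pure x \<boxtimes> pure y) \<boxtimes> t = pure x \<boxtimes> pure y \<boxtimes> t" for x y :: "'a list"
    by (induction t rule: tens_induct) (simp_all add: tcat_bilinear tcat_pure)
  have 2: "(pure x \<boxtimes> s) \<boxtimes> t = pure x \<boxtimes> s \<boxtimes> t" for x :: "'a list"
    by (induction s rule: tens_induct) (simp_all add: tcat_bilinear 1)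
  show ?thesis
    by (induction r rule: tens_induct) (simp_all add: tcat_bilinear 2)
qed

lemma tcat_Nil: "s \<boxtimes> pure [] = (s :: 'a::cq_algebra tens)" "pure [] \<boxtimes> s = s"
  by (induction s rule: tens_induct; simp add: tcat_bilinear tcat_pure)+

lemma tcat_mult:
  fixes s s' t t' :: "'a::cq_algebra tens"
  assumes "s \<in> tdegree m" "s' \<in> tdegree m" "t \<in> tdegree n" "t' \<in> tdegree n"
  shows "(s \<boxtimes> t) * (s' \<boxtimes> t') = (s * s') \<boxtimes> (t * t')"
proof -
  note b = tcat_bilinear times_tens_bilinear
  have 1: "(pure x \<boxtimes> pure y) * (pure x' \<boxtimes> pure y') = (pure x * pure x') \<boxtimes> (pure y * pure y')"
    if "length x = m" "length x' = m" "length y = n" "length y' = n" for x x' y y' :: "'a list"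
    using that by (simp add: tcat_pure pure_mult)
  have 2: "(pure x \<boxtimes> pure y) * (pure x' \<boxtimes> t') = (pure x * pure x') \<boxtimes> (pure y * t')"
    if "length x = m" "length x' = m" "length y = n" for x x' y :: "'a list"
    using assms(4) by (induction rule: tdegree_induct) (simp_all add: b 1 that)
  have 3: "(pure x \<boxtimes> t) * (pure x' \<boxtimes> t') = (pure x * pure x') \<boxtimes> (t * t')"
    if "length x = m" "length x' = m" for x x' :: "'a list"
    using assms(3) by (induction rule: tdegree_induct) (simp_all add: b 2 that)
  have 4: "(pure x \<boxtimes> t) * (s' \<boxtimes> t') = (pure x * s') \<boxtimes> (t * t')"
    if "length x = m" for x :: "'a list"
    using assms(2) by (induction rule: tdegree_induct) (simp_all add: b 3 that)
  show ?thesis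
    using assms(1) by (induction rule: tdegree_induct) (simp_all add: b 4)
qed

lemma comult_head_simps:
  "comult_head (pure (x # xs)) = Rep_tpow (comult x) \<boxtimes> pure xs"
  "comult_head (s + t) = comult_head s + comult_head t"
  "comult_head (c *\<^sub>q s) = c *\<^sub>q comult_head s" "comult_head 0 = 0"
  by (simp_all add: comult_head_def tens_lift_simps multilinear_comult_head_tuple comult_head_tuple_def)

lemma Rep_comult: "Rep_tpow (comult x) \<in> tdegree 2"
  using Rep_tpow[of "comult x"] by simp

lemma comult_head_mult:
  assumes "s \<in> tdegree (Suc m)" "t \<in> tdegree (Suc m)"
  shows "comult_head (s * t) = comult_head s * comult_head t"
proof -
  note b = comult_head_simps times_tens_bilinear
  have 1: "comult_head (pure xs * pure ys) = comult_head (pure xs) * comult_head (pure ys)"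
    if len: "length xs = Suc m" "length ys = Suc m" for xs ys
  proof -
    obtain x xs' y ys' where xs: "xs = x # xs'" "ys = y # ys'" using len unfolding length_Suc_conv by auto
    then have l: "length xs' = m" "length ys' = m" using len by auto
    have "comult (x * y) = comult x * comult y" using cq_algebra_homD[OF comult_hom] by simp
    then show ?thesis
      using tcat_mult[OF Rep_comult Rep_comult tdegree_pure[OF l(1)] tdegree_pure[OF l(2)], of x y]
      by (simp add: xs l pure_mult comult_head_simps times_tpow.rep_eq)
  qed
  have 2: "comult_head (pure xs * t) = comult_head (pure xs) * comult_head t"
    if "length xs = Suc m" for xs
    using assms(2) by (induction rule: tdegree_induct) (simp_all add: b 1 that)
  show ?thesis
    using assms(1) by (induction rule: tdegree_induct) (simp_all add: b 2)
qed

lemma comult_head_tcat: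
  assumes "s \<in> tdegree (Suc m)"
  shows "comult_head (s \<boxtimes> t) = comult_head s \<boxtimes> t"
proof -
  note b = comult_head_simps tcat_bilinear
  have 1: "comult_head (pure xs \<boxtimes> t) = comult_head (pure xs) \<boxtimes> t"
    if len: "length xs = Suc m" for xs
  proof -
    obtain x xs' where xs: "xs = x # xs'" using len by (cases xs) simp_all
    show ?thesis
      by (induction t rule: tens_induct) (simp_all add: b tcat_pure xs tcat_assoc)
  qed
  show ?thesis
    using assms by (induction rule: tdegree_induct) (simp_all add: b 1)
qed

lemma iter_comult_hom:
  "iter_comult m (x + y) = iter_comult m x + iter_comult m y"
  "iter_comult m (c *\<^sub>q x) = c *\<^sub>q iter_comult m x"
  "iter_comult m (x * y) = iter_comult m x * iter_comult m y"
proof -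
  have p: "pure [x + y] = pure [x] + pure [y]" "pure [c *\<^sub>q x] = c *\<^sub>q pure [x]" for x y :: uq and c
    using pure_multilinear[where 'a = uq] unfolding multilinear_def by (metis append_Nil)+
  show "iter_comult m (x + y) = iter_comult m x + iter_comult m y"
    "iter_comult m (c *\<^sub>q x) = c *\<^sub>q iter_comult m x"
    "iter_comult m (x * y) = iter_comult m x * iter_comult m y"
    by (induction m) (simp_all add: p comult_head_simps pure_mult comult_head_mult[OF tdegree_iter_comult tdegree_iter_comult])
qed

lemma Rep_tpair: "Rep_tpow (tpair x y) = pure [x, y]"
  by (simp add: tpair.rep_eq)

text \<open>By definition the iterated coproduct splits the first factor, whereas \<open>kT\<close>
  and its companions append a last one. As \<open>comult_head\<close> touches only the first factor,
  the last one is inert from the second step on, and induction gives the change of side without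
  coassociativity.\<close>

lemma iter_comult_generators:
  "iter_comult (Suc m) uK = iter_comult m uK \<boxtimes> pure [uK]"
  "iter_comult (Suc m) uKi = iter_comult m uKi \<boxtimes> pure [uKi]"
  "iter_comult (Suc m) uE = iter_comult m uE \<boxtimes> pure [uKi] + iter_comult m uK \<boxtimes> pure [uE]"
  "iter_comult (Suc m) uF = iter_comult m uF \<boxtimes> pure [uKi] + iter_comult m uK \<boxtimes> pure [uF]"
proof -
  note t = comult_head_tcat[OF tdegree_iter_comult]
  note s = comult_head_simps comult_generators plus_tpow.rep_eq Rep_tpair tcat_pure tcat_Nil tcat_bilinear
  have step: "iter_comult (Suc (Suc m)) x = comult_head (iter_comult (Suc m) x)" for m x by simp
  show K: "iter_comult (Suc m) uK = iter_comult m uK \<boxtimes> pure [uK]"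
  proof (induction m)
    case (Suc m)
    show ?case unfolding step by (subst Suc, subst t) simp
  qed (simp add: s)
  show "iter_comult (Suc m) uKi = iter_comult m uKi \<boxtimes> pure [uKi]"
  proof (induction m)
    case (Suc m)
    show ?case unfolding step by (subst Suc, subst t) simp
  qed (simp add: s)
  show "iter_comult (Suc m) uE = iter_comult m uE \<boxtimes> pure [uKi] + iter_comult m uK \<boxtimes> pure [uE]"
  proof (induction m)
    case (Suc m)
    show ?case unfolding step by (subst Suc) (simp add: comult_head_simps(2) t)
  qed (simp add: s)
  show "iter_comult (Suc m) uF = iter_comult m uF \<boxtimes> pure [uKi] + iter_comult m uK \<boxtimes> pure [uF]"
  proof (induction m)
    case (Suc m)
    show ?case unfolding step by (subst Suc) (simp add: comult_head_simps(2) t)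
  qed (simp add: s)
qed

section \<open>Single copies and coproduct blocks inside the tensor power\<close>

lift_definition slot :: "nat \<Rightarrow> 'a::cq_algebra \<Rightarrow> ('a, 'n::finite) tpow" is
  "\<lambda>i x. pure ((replicate CARD('n) 1)[i - 1 := x])"
  by (rule tdegree_pure) simp

lemma nth_unit_update:
  "k < n \<Longrightarrow> (replicate n 1)[i := x] ! k = (if k = i then x else 1)"
  by (cases "k = i") simp_all

lemma slot_mult: "slot i x * slot i y = (slot i (x * y) :: ('a::cq_algebra, 'n::finite) tpow)"
proof -
  have "map2 (*) ((replicate n 1)[j := x]) ((replicate n 1)[j := y]) = (replicate n 1)[j := x * y]" for n j
    by (rule nth_equalityI) (simp_all add: nth_unit_update)
  then show ?thesis by transfer (simp add: pure_mult)
qed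

lemma slot_one: "slot i (1 :: 'a::cq_algebra) = 1"
proof -
  have "(replicate n 1)[j := 1] = replicate n (1 :: 'a)" for n j
    by (rule nth_equalityI) (simp_all add: nth_unit_update)
  then show ?thesis
    unfolding Rep_tpow_inject[symmetric] by (simp add: slot.rep_eq one_tpow.rep_eq)
qed

text \<open>The bounds exclude index 0: by truncated subtraction, \<open>slot 0\<close> coincides
  with \<open>slot 1\<close>.\<close>

lemma slot_commute:
  assumes "i \<noteq> j" "i \<ge> 1" "j \<ge> 1"
  shows "slot i x * slot j y = (slot j y * slot i x :: ('a::cq_algebra, 'n::finite) tpow)"
proof -
  have "i - 1 \<noteq> j - 1" using assms by simp
  then have "map2 (*) ((replicate CARD('n) 1)[i - 1 := x]) ((replicate CARD('n) 1)[j - 1 := y])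
     = map2 (*) ((replicate CARD('n) 1)[j - 1 := y]) ((replicate CARD('n) 1)[i - 1 := x])"
    by (intro nth_equalityI) (simp_all add: nth_unit_update)
  then show ?thesis
    unfolding Rep_tpow_inject[symmetric] by (simp add: slot.rep_eq times_tpow.rep_eq pure_mult)
qed

lemma slot_linear:
  assumes "1 \<le> i" "i \<le> CARD('n)"
  shows "slot i (x + y) = (slot i x + slot i y :: ('a::cq_algebra, 'n::finite) tpow)"
    "slot i (x - y) = (slot i x - slot i y :: ('a::cq_algebra, 'n::finite) tpow)"
    "slot i (c *\<^sub>q x) = (c *\<^sub>q slot i x :: ('a::cq_algebra, 'n::finite) tpow)"
proof -
  have u: "(replicate CARD('n) 1)[i - 1 := z] =
      take (i - 1) (replicate CARD('n) 1) @ z # drop i (replicate CARD('n) 1)" for z :: 'a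
    using assms by (simp add: upd_conv_take_nth_drop)
  note m = pure_multilinear[where 'a = 'a, unfolded multilinear_def]
  show 1: "slot i (x + y) = (slot i x + slot i y :: ('a, 'n) tpow)" for x y
    unfolding Rep_tpow_inject[symmetric] slot.rep_eq plus_tpow.rep_eq u using m by blast
  show "slot i (c *\<^sub>q x) = (c *\<^sub>q slot i x :: ('a, 'n) tpow)"
    unfolding Rep_tpow_inject[symmetric] slot.rep_eq scaleq_tpow.rep_eq u using m by blast
  show "slot i (x - y) = (slot i x - slot i y :: ('a, 'n) tpow)"
    using 1[of "x - y" y] by (simp add: eq_diff_eq)
qed

text \<open>Outside \<open>{1..n}\<close> the family is padded with the counit values \<open>z\<close>, so that the relations of
  \<open>uq_family\<close> hold for all indices.\<close>

definition slot_gen :: "uq \<Rightarrow> (uq, 'n::finite) tpow \<Rightarrow> nat \<Rightarrow> (uq, 'n) tpow" where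
  "slot_gen x z i = (if 1 \<le> i \<and> i \<le> CARD('n) then slot i x else z)"

definition uG :: uq where "uG = qq *\<^sub>q uE - inverse qq *\<^sub>q uE"

lemma uG_relations: "uK * uG = qq *\<^sub>q (uG * uK)" "uG * uF = uF * uG + uK * uK - uKi * uKi"
proof -
  show "uK * uG = qq *\<^sub>q (uG * uK)" by (simp add: uG_def ring_nf uq_relations)
  have g: "uG = (qq - inverse qq) *\<^sub>q uE" by (simp add: uG_def scaleq_nf)
  have "uG * uF - uF * uG = (qq - inverse qq) *\<^sub>q (uE * uF - uF * uE)"
    by (simp add: g mult_scaleq_left mult_scaleq_right cq.scale_right_diff_distrib)
  also have "\<dots> = uK * uK - uKi * uKi"
    by (simp only: uq_relations(5) scaleq_scaleq right_inverse[OF qq_minus] scaleq_one)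
  finally show "uG * uF = uF * uG + uK * uK - uKi * uKi" by (simp add: algebra_simps)
qed

interpretation slots: uq_family "slot_gen uK 1 :: nat \<Rightarrow> (uq, 'n::finite) tpow" "slot_gen uKi 1" "slot_gen uG 0" "slot_gen uF 0"
proof
  fix i j :: nat and x y :: "(uq, 'n) tpow"
  assume "i \<noteq> j" "x \<in> {slot_gen uK 1 i, slot_gen uKi 1 i, slot_gen uG 0 i, slot_gen uF 0 i}"
     "y \<in> {slot_gen uK 1 j, slot_gen uKi 1 j, slot_gen uG 0 j, slot_gen uF 0 j}"
  then show "x * y = y * x"
    by (auto simp: slot_gen_def slot_commute[of i j] split: if_splits)
qed (auto simp: slot_gen_def slot_mult uq_relations slot_one uG_relations slot_linear)

definition block :: "nat \<Rightarrow> nat \<Rightarrow> uq \<Rightarrow> (uq, 'n::finite) tpow" where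
  "block i m x = Abs_tpow (pure (replicate (i - 1) 1) \<boxtimes> iter_comult m x \<boxtimes>
     pure (replicate (CARD('n) - (i + m)) 1))"

lemma Rep_block:
  assumes "1 \<le> i" "i + m \<le> CARD('n)"
  shows "Rep_tpow (block i m x :: (uq, 'n::finite) tpow) = pure (replicate (i - 1) 1) \<boxtimes> iter_comult m x \<boxtimes>
     pure (replicate (CARD('n) - (i + m)) 1)"
proof -
  have "i - 1 + (Suc m + (CARD('n) - (i + m))) = CARD('n)" using assms by simp
  moreover have "pure (replicate (i - 1) 1) \<boxtimes> iter_comult m x \<boxtimes>
     pure (replicate (CARD('n) - (i + m)) 1) \<in> tdegree (i - 1 + (Suc m + (CARD('n) - (i + m))))"
    by (intro tdegree_tcat tdegree_iter_comult tdegree_pure) simp_all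
  ultimately show ?thesis by (simp add: block_def Abs_tpow_inverse)
qed

lemma pure_replicate_mult:
  "pure (replicate n 1) * pure (replicate n 1) = (pure (replicate n 1) :: 'a::cq_algebra tens)"
  by (rule tdegree_unit) (simp add: tdegree_pure)

lemma block_hom:
  assumes "1 \<le> i" "i + m \<le> CARD('n)"
  shows "block i m (x + y) = (block i m x + block i m y :: (uq, 'n::finite) tpow)"
    "block i m (c *\<^sub>q x) = (c *\<^sub>q block i m x :: (uq, 'n) tpow)"
    "block i m (x * y) = (block i m x * block i m y :: (uq, 'n) tpow)"
proof -
  have t: "pure (replicate k 1) \<in> tdegree k" for k by (simp add: tdegree_pure)
  note it = tdegree_iter_comult
  show "block i m (x + y) = (block i m x + block i m y :: (uq, 'n::finite) tpow)"
    "block i m (c *\<^sub>q x) = (c *\<^sub>q block i m x :: (uq, 'n) tpow)"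
    unfolding Rep_tpow_inject[symmetric] plus_tpow.rep_eq scaleq_tpow.rep_eq Rep_block[OF assms]
    by (simp_all add: iter_comult_hom tcat_bilinear)
  show "block i m (x * y) = (block i m x * block i m y :: (uq, 'n) tpow)"
    unfolding Rep_tpow_inject[symmetric] times_tpow.rep_eq Rep_block[OF assms]
    by (simp add: tcat_mult[OF t t tdegree_tcat[OF it t] tdegree_tcat[OF it t]] tcat_mult[OF it it t t]
        iter_comult_hom pure_replicate_mult)
qed

lemma Rep_slot:
  assumes "1 \<le> i" "i \<le> CARD('n)"
  shows "Rep_tpow (slot i x :: ('a::cq_algebra, 'n::finite) tpow) =
    pure (replicate (i - 1) 1 @ [x] @ replicate (CARD('n) - i) 1)"
  using assms by (simp add: slot.rep_eq upd_conv_take_nth_drop)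

lemma block_0:
  assumes "1 \<le> i" "i \<le> CARD('n)"
  shows "block i 0 x = (slot i x :: (uq, 'n::finite) tpow)"
  unfolding Rep_tpow_inject[symmetric]
  using assms by (simp add: Rep_block Rep_slot tcat_pure)

text \<open>An element of the next copy takes the place of the first 1 in the right-hand padding, so
  both factors are regrouped into degrees i - 1, m + 2 and the rest.\<close>

lemma block_slot:
  assumes "1 \<le> i" "i + Suc m \<le> CARD('n)"
  shows "Rep_tpow (block i m x * slot (i + Suc m) y :: (uq, 'n::finite) tpow) =
    pure (replicate (i - 1) 1) \<boxtimes> (iter_comult m x \<boxtimes> pure [y]) \<boxtimes> pure (replicate (CARD('n) - (i + Suc m)) 1)"
proof -
  define r where "r = CARD('n) - (i + Suc m)"
  have t: "pure (replicate k 1) \<in> tdegree k" for k by (simp add: tdegree_pure)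
  have t1: "pure [z] \<in> tdegree 1" for z :: uq by (simp add: tdegree_pure)
  note it = tdegree_iter_comult
  have "CARD('n) - (i + m) = Suc r" using assms by (simp add: r_def)
  then have 1: "Rep_tpow (block i m x :: (uq, 'n) tpow) =
      pure (replicate (i - 1) 1) \<boxtimes> (iter_comult m x \<boxtimes> pure [1]) \<boxtimes> pure (replicate r 1)"
    using Rep_block[of i m x, where 'n = 'n] assms by (simp add: tcat_assoc tcat_pure)
  have e: "i + Suc m - 1 = (i - 1) + Suc m" using assms by simp
  have "replicate (i + Suc m - 1) 1 = replicate (i - 1) 1 @ replicate (Suc m) (1 :: uq)"
    unfolding e replicate_add ..
  then have 2: "Rep_tpow (slot (i + Suc m) y :: (uq, 'n) tpow) =
      pure (replicate (i - 1) 1) \<boxtimes> (pure (replicate (Suc m) 1) \<boxtimes> pure [y]) \<boxtimes> pure (replicate r 1)"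
    using Rep_slot[of "i + Suc m" y, where 'n = 'n] assms by (simp add: tcat_assoc tcat_pure r_def)
  define P where "P = pure (replicate (i - 1) (1 :: uq))"
  define R where "R = pure (replicate r (1 :: uq))"
  have PR: "P \<in> tdegree (i - 1)" "R \<in> tdegree r" "P * P = P" "R * R = R"
    by (simp_all add: P_def R_def t pure_replicate_mult)
  have "(iter_comult m x \<boxtimes> pure [1]) * (pure (replicate (Suc m) 1) \<boxtimes> pure [y]) =
      (iter_comult m x * pure (replicate (Suc m) 1)) \<boxtimes> (pure [1] * pure [y])"
    by (rule tcat_mult[OF it t t1 t1])
  also have "\<dots> = iter_comult m x \<boxtimes> pure [y]"
    by (simp only: tdegree_unit(2)[OF it]) (simp add: pure_mult)
  finally have 3: "(iter_comult m x \<boxtimes> pure [1]) * (pure (replicate (Suc m) 1) \<boxtimes> pure [y]) =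
    iter_comult m x \<boxtimes> pure [y]" .
  note d = tdegree_tcat[OF it t1] tdegree_tcat[OF t t1, of "Suc m"]
  show ?thesis
    unfolding times_tpow.rep_eq 1 2 r_def[symmetric] P_def[symmetric] R_def[symmetric]
    by (simp only: tcat_mult[OF PR(1) PR(1) tdegree_tcat[OF d(1) PR(2)] tdegree_tcat[OF d(2) PR(2)]]
      tcat_mult[OF d PR(2) PR(2)] 3 PR(3,4))
qed

lemma block_generators:
  assumes "1 \<le> i" "i + Suc m \<le> CARD('n)"
  shows "block i (Suc m) uK = (block i m uK * slot (i + Suc m) uK :: (uq, 'n::finite) tpow)"
    "block i (Suc m) uKi = (block i m uKi * slot (i + Suc m) uKi :: (uq, 'n) tpow)"
    "block i (Suc m) uE = (block i m uE * slot (i + Suc m) uKi + block i m uK * slot (i + Suc m) uE :: (uq, 'n) tpow)"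
    "block i (Suc m) uF = (block i m uF * slot (i + Suc m) uKi + block i m uK * slot (i + Suc m) uF :: (uq, 'n) tpow)"
  unfolding Rep_tpow_inject[symmetric] plus_tpow.rep_eq block_slot[OF assms] Rep_block[OF assms] iter_comult_generators
  by (simp_all only: tcat_bilinear)

lemma slot_gen_in: "1 \<le> i \<Longrightarrow> i \<le> CARD('n) \<Longrightarrow> slot_gen x z i = (slot i x :: (uq, 'n::finite) tpow)"
  by (simp add: slot_gen_def)

lemma slot_uG:
  "1 \<le> i \<Longrightarrow> i \<le> CARD('n) \<Longrightarrow>
    slot i uG = (qq *\<^sub>q slot i uE - inverse qq *\<^sub>q slot i uE :: (uq, 'n::finite) tpow)"
  by (simp add: uG_def slot_linear)

text \<open>The shift by one arises because the m-fold coproduct has m + 1 tensor factors. The last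
  component carries the factor q - q^-1 by which E is rescaled.\<close>

lemma T_block:
  assumes "1 \<le> i" "i + m \<le> CARD('n)"
  shows "slots.kT i (Suc m) = (block i m uK :: (uq, 'n::finite) tpow) \<and> slots.kiT i (Suc m) = (block i m uKi :: (uq, 'n) tpow)
    \<and> slots.fT i (Suc m) = (block i m uF :: (uq, 'n) tpow)
    \<and> slots.eT i (Suc m) = (qq *\<^sub>q block i m uE - inverse qq *\<^sub>q block i m uE :: (uq, 'n) tpow)"
  using assms(2)
proof (induction m)
  case 0
  then show ?case using assms by (simp add: slot_gen_in block_0 slot_uG)
next
  case (Suc m)
  then have i: "1 \<le> i + Suc m" "i + Suc m \<le> CARD('n)" by auto
  have IH: "slots.kT i (Suc m) = (block i m uK :: (uq, 'n::finite) tpow)" "slots.kiT i (Suc m) = (block i m uKi :: (uq, 'n) tpow)"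
    "slots.fT i (Suc m) = (block i m uF :: (uq, 'n) tpow)"
    "slots.eT i (Suc m) = (qq *\<^sub>q block i m uE - inverse qq *\<^sub>q block i m uE :: (uq, 'n) tpow)"
    using Suc by auto
  note r = slots.kT.simps(2)[of i "Suc m"] slots.kiT.simps(2)[of i "Suc m"] slots.fT.simps(2)[of i "Suc m"] slots.eT.simps(2)[of i "Suc m"]
  show ?case
    unfolding r IH block_generators[OF assms(1) Suc.prems]
    using i by (simp add: slot_gen_in slot_uG ring_nf)
qed

lemma Q_casimir_eq:
  assumes "is_connected I" "I \<subseteq> {1..CARD('n)}"
  shows "(Q_casimir I :: (uq, 'n::finite) tpow) = slots.Cas I"
proof -
  obtain i j where ij: "i \<le> j" "I = {i..j}" using assms(1) by (auto simp: is_connected_def)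
  define m where "m = j - i"
  have "i \<in> I" "j \<in> I" using ij by auto
  then have i: "1 \<le> i" "i + m \<le> CARD('n)" using assms(2) ij(1) unfolding m_def by auto
  have I: "I = {i..<i + Suc m}" using ij by (auto simp: m_def)
  have M: "Min {i..j} = i" "Max {i..j} = j" using ij by (auto intro: Min_eqI Max_eqI)
  have "Rep_tpow (Q_casimir I :: (uq, 'n) tpow) = Rep_tpow (block i m casimir :: (uq, 'n) tpow)"
    unfolding Rep_block[OF i]
    using assms ij by (simp add: Q_casimir_def conn_casimir.rep_eq Abs_conn_inverse M m_def)
  then have "Q_casimir I = (block i m casimir :: (uq, 'n) tpow)" by (simp add: Rep_tpow_inject)
  \<comment> \<open>The coefficient (q - q^-1)^2 of F E splits: one factor is in the corner of L^+,
    the other is the rescaling of E.\<close>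
  also have "\<dots> = slots.Cas I"
    unfolding I slots.Cas_interval T_block[OF i, THEN conjunct1] T_block[OF i, THEN conjunct2, THEN conjunct1]
      T_block[OF i, THEN conjunct2, THEN conjunct2, THEN conjunct1] T_block[OF i, THEN conjunct2, THEN conjunct2, THEN conjunct2]
    unfolding casimir_def power2_eq_square block_hom[OF i] scaleq_scaleq[symmetric]
    by (simp only: ring_nf scaleq_cancel)
  finally show ?thesis .
qed

section \<open>Vanishing of the central elements\<close>

lemma subset_Union_max_connected:
  assumes "finite U" shows "U \<subseteq> \<Union> (max_connected U)"
proof
  fix x assume x: "x \<in> U"
  define A where "A = {J. is_connected J \<and> x \<in> J \<and> J \<subseteq> U}"
  have "is_connected {x}" unfolding is_connected_def by (intro exI[of _ x]) simp
  then have "{x} \<in> A" using x by (simp add: A_def)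
  moreover have "finite A" by (rule finite_subset[of _ "Pow U"]) (use assms in \<open>auto simp: A_def\<close>)
  ultimately obtain I where I: "I \<in> A" "\<forall>J\<in>A. I \<subseteq> J \<longrightarrow> I = J"
    using finite_has_maximal[of A] by (metis empty_iff)
  have "I \<in> max_connected U"
    unfolding max_connected_def mem_Collect_eq
  proof (intro conjI allI impI)
    show "is_connected I" "I \<subseteq> U" using I(1) by (simp_all add: A_def)
    fix J assume J: "is_connected J" "I \<subseteq> J" "J \<subseteq> U"
    then have "J \<in> A" using I(1) by (auto simp: A_def)
    then show "J = I" using I(2) J(2) by blast
  qed
  then show "x \<in> \<Union> (max_connected U)" using I(1) by (auto simp: A_def)
qed

lemma cq_algebra_hom_sum:
  assumes "cq_algebra_hom f" shows "f (sum g A) = (\<Sum>a\<in>A. f (g a))"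
  by (induction A rule: infinite_finite_induct) (simp_all add: cq_algebra_homD[OF assms])

theorem proposition6p3:
  fixes \<phi> :: "'n::finite aw \<Rightarrow> (uq, 'n) tpow"
    and S I1 I2 I3 :: "nat set"
  assumes "CARD('n) \<ge> 3"
    and "cq_algebra_hom \<phi>"
    and "\<And>I. is_connected I \<Longrightarrow> I \<subseteq> {1..CARD('n)} \<Longrightarrow> \<phi> (aw_gen I) = Q_casimir I"
    and "S \<subseteq> {1..CARD('n)}" and "card S \<ge> 3"
    and "I1 \<noteq> {}" and "I2 \<noteq> {}" and "I3 \<noteq> {}"
    and "I1 \<prec> I2" and "I2 \<prec> I3" and "I1 \<union> I2 \<union> I3 = S"
  shows "\<phi> (omega I1 I2 I3) = 0"
proof -
  note hom = cq_algebra_homD[OF assms(2)]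
  have C: "\<phi> (C_set U) = slots.Cas U" if U: "U \<subseteq> {1..CARD('n)}" for U
  proof -
    have fin: "finite U" using U finite_subset by blast
    note c = components_correct[OF fin]
    have "\<Union> (set (components U)) = U"
      unfolding c(2)
    proof
      show "\<Union> (max_connected U) \<subseteq> U" using max_connectedD(2) by blast
      show "U \<subseteq> \<Union> (max_connected U)" by (rule subset_Union_max_connected[OF fin])
    qed
    moreover have "\<forall>I\<in>set (components U). is_connected I \<and> I \<subseteq> {1..CARD('n)}"
      unfolding c(2) using max_connectedD(1,2) U by blast
    ultimately show ?thesis
      unfolding C_set_def
      using slots.hom_C_seq[OF assms(2), of "CARD('n)" aw_gen "components U"] assms(3) Q_casimir_eq c(1)
      by metis
  qed
  have O: "\<phi> (Omega I J K) = 0" if IJK: "I \<subseteq> I1" "J \<subseteq> I2" "K \<subseteq> I3" for I J K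
  proof -
    have sub: "I \<subseteq> {1..CARD('n)}" "J \<subseteq> {1..CARD('n)}" "K \<subseteq> {1..CARD('n)}" using IJK assms by auto
    then have fin: "finite I" "finite J" "finite K"
      by (simp_all add: sub[THEN finite_subset])
    \<comment> \<open>An element of I2 links I1 to I3. The relation \<open>I \<prec> K\<close> must
      be inherited from I1 and I3, since J may be empty.\<close>
    obtain y where "y \<in> I2" using assms(7) by blast
    then have "x < z" if "x \<in> I1" "z \<in> I3" for x z
      using assms(9,10) that less_trans[of x y z] unfolding set_less_def by simp
    then have less: "I \<prec> J" "J \<prec> K" "I \<prec> K"
      using IJK assms(9,10) unfolding set_less_def by (meson subsetD)+
    show ?thesis
      using slots.Cas_Omega[OF fin less, where 'n = 'n] sub
      unfolding Omega_def Let_def hom power2_eq_square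
      by (simp only: C Un_least simp_thms)
  qed
  show ?thesis
    unfolding omega_def cq_algebra_hom_sum[OF assms(2)] hom(2)
    by (intro sum.neutral ballI) (simp add: O)
qed

end
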